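(* Let $n,m\ge1$, and let $X=X(n,m)$ be the competition complexity of $n$ bidders with additive valuations over $m$ independent, regular items. Then the competition complexity of $n$ bidders with valuations that are additive subject to randomly drawn downward-closed constraints over $m$ independent, regular items is at most $X+2(m-1)$, where every set system in the support of the distribution of constraints is downward-closed and contains all singletons $\{j\}$, $j\in[m]$.
   Context: A one-dimensional distribution $F_j$ on $[0,\infty)$ (identified with its CDF) is taken to be continuous, with density $f_j$ positive on an interval; its virtual value function is $\varphi_j(x)=x-\frac{1-F_j(x)}{f_j(x)}$, and $F_j$ is regular if $\varphi_j$ is non-decreasing. A set system $([m],\mathcal I)$ is downward-closed if $T\subseteq S\in\mathcal I$ implies $T\in\mathcal I$. A distribution $F$ over valuations is additive over $m$ independent, regular items if there are regular $F_1,\dots,F_m$ such that $v\sim F$ is obtained by drawing $v_j\sim F_j$ independently and setting $v(S)=\sum_{j\in S}v_j$. It is additive subject to randomly drawn downward-closed constraints over $m$ independent, regular items if there are a distribution $F_0$ over downward-closed set systems on $[m]$ and regular $F_1,\dots,F_m$ such that $v\sim F$ is obtained by drawing $\mathcal I\sim F_0$ and $v_j\sim F_j$, all independently, and setting $v(S)=\max_{T\subseteq S,\,T\in\mathcal I}\sum_{j\in T}v_j$. Bidders' valuations (including constraints) are i.i.d. from $F$; utilities are quasi-linear. A (possibly randomized) mechanism maps bids to an allocation of the items (each item to at most one bidder) and payments. It is BIC if truth-telling maximizes each bidder's expected utility given that the others report truthfully, and BIR if each bidder's expected utility from truthful reporting is non-negative (expectations over the mechanism's randomness and the others' valuations). $\mathrm{OPT}(F,n)$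 is the optimal (supremum) expected revenue over all BIC and BIR mechanisms for $n$ bidders with valuations i.i.d. from $F$. $\mathrm{Rev}(M,F,k)$ is the expected revenue of mechanism $M$ with $k$ bidders with valuations i.i.d. from $F$. VCG chooses a welfare-maximizing allocation and charges each bidder her externality (maximum welfare of the others without her, minus the welfare of the others in the chosen allocation). The competition complexity of $n$ bidders for a class $\mathcal D$ of distributions is the least integer $c\ge0$ such that $\mathrm{OPT}(F,n)\le\mathrm{Rev}(\mathrm{VCG},F,n+c)$ for all $F\in\mathcal D$. *)

theory Defs
  imports "HOL-Probability.Probability" "HOL-Library.Extended_Nat"
begin

text \<open>
  Items are \<open>{..<m}\<close>, bidders are \<open>{..<n}\<close>. A valuation is a set function on \<open>Pow {..<m}\<close>; bids,
  mechanisms and distributions over valuations are all expressed over the following measurable space.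
\<close>

type_synonym valuation = "nat set \<Rightarrow> real"

definition valuations :: "nat \<Rightarrow> valuation measure" where
  "valuations m = PiM (Pow {..<m}) (\<lambda>_. borel)"


section \<open>Distributions over valuations\<close>

definition virtual_value :: "real measure \<Rightarrow> (real \<Rightarrow> real) \<Rightarrow> real \<Rightarrow> real" where
  "virtual_value D f x = x - (1 - cdf D x) / f x"

text \<open>
  The density is positive exactly on an interval \<open>J\<close>; the virtual value is only meaningful, hence
  only required to be monotone, on \<open>J\<close>.
\<close>

definition regular :: "real measure \<Rightarrow> bool" where
  "regular D \<longleftrightarrow> prob_space D \<and>
     (\<exists>f J. f \<in> borel_measurable borel \<and> D = density lborel (\<lambda>x. ennreal (f x)) \<and>
            is_interval J \<and> J \<subseteq> {0..} \<and> (\<forall>x\<in>J. f x > 0) \<and> (\<forall>x. x \<notin> J \<longrightarrow> f x = 0) \<and>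
            mono_on J (virtual_value D f))"

definition additive_valuation :: "nat \<Rightarrow> (nat \<Rightarrow> real) \<Rightarrow> valuation" where
  "additive_valuation m x = (\<lambda>S\<in>Pow {..<m}. \<Sum>j\<in>S. x j)"

definition constrained_valuation :: "nat \<Rightarrow> nat set set \<Rightarrow> (nat \<Rightarrow> real) \<Rightarrow> valuation" where
  "constrained_valuation m \<I> x =
     (\<lambda>S\<in>Pow {..<m}. Max ((\<lambda>T. \<Sum>j\<in>T. x j) ` {T. T \<subseteq> S \<and> T \<in> \<I>}))"

definition downward_closed :: "nat \<Rightarrow> nat set set \<Rightarrow> bool" where
  "downward_closed m \<I> \<longleftrightarrow> \<I> \<subseteq> Pow {..<m} \<and> (\<forall>S T. S \<in> \<I> \<longrightarrow> T \<subseteq> S \<longrightarrow> T \<in> \<I>)"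

definition additive_class :: "nat \<Rightarrow> valuation measure set" where
  "additive_class m =
     {distr (PiM {..<m} D) (valuations m) (additive_valuation m) |D. \<forall>j<m. regular (D j)}"

text \<open>There are only finitely many set systems on \<open>{..<m}\<close>, so a pmf is a general distribution.\<close>

definition constrained_class :: "nat \<Rightarrow> valuation measure set" where
  "constrained_class m =
     {distr (measure_pmf D0 \<Otimes>\<^sub>M PiM {..<m} D) (valuations m)
        (\<lambda>(\<I>, x). constrained_valuation m \<I> x) |D0 D.
        (\<forall>\<I>\<in>set_pmf D0. downward_closed m \<I> \<and> (\<forall>j<m. {j} \<in> \<I>)) \<and> (\<forall>j<m. regular (D j))}"

text \<open>Topological support; all norms on the finite-dimensional space of valuations are equivalent.\<close>

definition support :: "nat \<Rightarrow> valuation measure \<Rightarrow> valuation set" where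
  "support m F = {v \<in> space (valuations m).
     \<forall>e>0. measure F {w \<in> space (valuations m). \<forall>S\<in>Pow {..<m}. \<bar>w S - v S\<bar> < e} > 0}"


section \<open>Mechanisms\<close>

definition allocations :: "nat \<Rightarrow> nat \<Rightarrow> (nat \<Rightarrow> nat set) set" where
  "allocations n m = {A \<in> {..<n} \<rightarrow>\<^sub>E Pow {..<m}. disjoint_family_on A {..<n}}"

text \<open>
  An outcome is an allocation together with a payment for every bidder (possibly negative). A
  randomized mechanism is a Markov kernel from bid profiles to outcomes.
\<close>

type_synonym outcome = "(nat \<Rightarrow> nat set) \<times> (nat \<Rightarrow> real)"
type_synonym mechanism = "(nat \<Rightarrow> valuation) \<Rightarrow> outcome measure"

definition outcomes :: "nat \<Rightarrow> nat \<Rightarrow> outcome measure" where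
  "outcomes n m = count_space (allocations n m) \<Otimes>\<^sub>M PiM {..<n} (\<lambda>_. borel)"

definition is_mechanism :: "nat \<Rightarrow> nat \<Rightarrow> mechanism \<Rightarrow> bool" where
  "is_mechanism n m M \<longleftrightarrow>
     M \<in> measurable (PiM {..<n} (\<lambda>_. valuations m)) (prob_algebra (outcomes n m))"

definition truthful_outcome :: "nat \<Rightarrow> valuation measure \<Rightarrow> mechanism \<Rightarrow> outcome measure" where
  "truthful_outcome n F M = PiM {..<n} (\<lambda>_. F) \<bind> M"

text \<open>Distribution of the outcome when bidder \<open>i\<close> reports \<open>r\<close> and all others report truthfully.\<close>

definition interim_outcome ::
    "nat \<Rightarrow> valuation measure \<Rightarrow> mechanism \<Rightarrow> nat \<Rightarrow> valuation \<Rightarrow> outcome measure" where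
  "interim_outcome n F M i r = PiM {..<n} (\<lambda>_. F) \<bind> (\<lambda>b. M (b(i := r)))"

definition interim_utility ::
    "nat \<Rightarrow> valuation measure \<Rightarrow> mechanism \<Rightarrow> nat \<Rightarrow> valuation \<Rightarrow> valuation \<Rightarrow> real" where
  "interim_utility n F M i v r = (\<integral>(A, p). v (A i) - p i \<partial>interim_outcome n F M i r)"

text \<open>
  All expectations involved have to exist: interim expected payments are finite, and every bidder's
  ex ante expected payment exists and is not \<open>-\<infinity>\<close>. The latter has to be asked of each bidder rather
  than of the total: otherwise transfers between bidders for which Fubini's theorem fails would
  yield arbitrary revenue without violating any interim constraint.
\<close>

definition expectations_exist :: "nat \<Rightarrow> nat \<Rightarrow> valuation measure \<Rightarrow> mechanism \<Rightarrow> bool" where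
  "expectations_exist n m F M \<longleftrightarrow>
     (\<forall>i<n. \<forall>r\<in>support m F. integrable (interim_outcome n F M i r) (\<lambda>(A, p). p i)) \<and>
     (\<forall>i<n. (\<integral>\<^sup>+(A, p). ennreal (- p i) \<partial>truthful_outcome n F M) < \<infinity>)"

definition BIC :: "nat \<Rightarrow> nat \<Rightarrow> valuation measure \<Rightarrow> mechanism \<Rightarrow> bool" where
  "BIC n m F M \<longleftrightarrow> (\<forall>i<n. \<forall>v\<in>support m F. \<forall>r\<in>support m F.
     interim_utility n F M i v r \<le> interim_utility n F M i v v)"

definition BIR :: "nat \<Rightarrow> nat \<Rightarrow> valuation measure \<Rightarrow> mechanism \<Rightarrow> bool" where
  "BIR n m F M \<longleftrightarrow> (\<forall>i<n. \<forall>v\<in>support m F. 0 \<le> interim_utility n F M i v v)"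

text \<open>
  Expectation of the total payment in the extended reals (\<open>ennreal\<close> truncates at 0, so this is
  positive part minus negative part).
\<close>

definition Rev :: "mechanism \<Rightarrow> valuation measure \<Rightarrow> nat \<Rightarrow> ereal" where
  "Rev M F n =
     enn2ereal (\<integral>\<^sup>+(A, p). ennreal (\<Sum>i<n. p i) \<partial>truthful_outcome n F M) -
     enn2ereal (\<integral>\<^sup>+(A, p). ennreal (- (\<Sum>i<n. p i)) \<partial>truthful_outcome n F M)"

definition OPT :: "nat \<Rightarrow> valuation measure \<Rightarrow> nat \<Rightarrow> ereal" where
  "OPT m F n = (SUP M \<in> {M. is_mechanism n m M \<and> expectations_exist n m F M \<and>
                             BIC n m F M \<and> BIR n m F M}. Rev M F n)"


section \<open>VCG and competition complexity\<close>

definition welfare :: "nat set \<Rightarrow> (nat \<Rightarrow> valuation) \<Rightarrow> (nat \<Rightarrow> nat set) \<Rightarrow> real" where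
  "welfare N b A = (\<Sum>i\<in>N. b i (A i))"

text \<open>
  Ties are broken by the choice operator, which picks from the finite set of maximizers; the total
  VCG payment does not depend on the maximizer picked.
\<close>

definition vcg_allocation :: "nat \<Rightarrow> nat \<Rightarrow> (nat \<Rightarrow> valuation) \<Rightarrow> nat \<Rightarrow> nat set" where
  "vcg_allocation n m b = arg_max_on (welfare {..<n} b) (allocations n m)"

definition vcg_payment :: "nat \<Rightarrow> nat \<Rightarrow> (nat \<Rightarrow> valuation) \<Rightarrow> nat \<Rightarrow> real" where
  "vcg_payment n m b = (\<lambda>i\<in>{..<n}.
     Max (welfare ({..<n} - {i}) b ` allocations n m)
       - welfare ({..<n} - {i}) b (vcg_allocation n m b))"

definition VCG :: "nat \<Rightarrow> nat \<Rightarrow> mechanism" where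
  "VCG n m b = return (outcomes n m) (vcg_allocation n m b, vcg_payment n m b)"

text \<open>Infinite if no number of additional bidders suffices.\<close>

definition competition_complexity :: "nat \<Rightarrow> nat \<Rightarrow> valuation measure set \<Rightarrow> enat" where
  "competition_complexity n m \<D> =
     Inf (enat ` {c. \<forall>F\<in>\<D>. OPT m F n \<le> Rev (VCG (n + c) m) F (n + c)})"

end

theory Submission
  imports Defs
begin

text \<open>
  Two comparisons are combined, where \<open>F\<close> is the constrained and \<open>F\<^sup>+\<close> the additive distribution.

  \<open>OPT(F, n) \<le> OPT(F\<^sup>+, n)\<close>: given a mechanism for \<open>F\<close>, draw constraints on behalf of the additive
  bidders, run the mechanism on the resulting constrained valuations, and hand every bidder only her best
  feasible part of the bundle. A misreport then gains no more than it would in the original mechanism.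

  \<open>Rev(VCG, F\<^sup>+, k) \<le> Rev(VCG, F, k + 2(m - 1))\<close>: the left-hand side is the sum over the items of the
  expected second-highest of \<open>k\<close> values. On the right, the externality of a winner is at least the welfare
  that the bidders without any item obtain from her bundle. Fix an item \<open>j\<close> and all values for the
  other items. At most \<open>m - 1\<close> bidders \<open>B\<close> are served when \<open>j\<close> is absent. Once \<open>j\<close> is added, it goes
  either to the bidder outside \<open>B\<close> who values it most, or to one \<open>b \<in> B\<close> that depends only on the values of
  \<open>B\<close> for \<open>j\<close>; in the latter case at most \<open>m - 1\<close> bidders other than \<open>b\<close> are served or needed to absorb the
  rest of the bundle of \<open>b\<close>. So at least \<open>k\<close> bidders remain whose values for \<open>j\<close> are fresh and
  whose second-highest value bounds the contribution of \<open>j\<close> to the revenue.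
\<close>

section \<open>Maxima and second-highest values\<close>

text \<open>The benchmark is a sum over items, whereas the externality of a winner is not a sum over
  the items of her bundle. It is broken up into the marginal contributions of these items to the
  best welfare that the bidders without any item obtain from the bundle: the marginals add up to at
  most the whole, and each can be bounded with the other items held fixed. The delicate point is
  dependence: the bidders whose second-highest value bounds the price of \<open>j\<close> must be
  selected without looking at their own values for \<open>j\<close>. The selection therefore uses
  only the other items and the values of \<open>B\<close> for \<open>j\<close>. If \<open>b\<close>
  wins a bundle of size s, there are at most m - s other winners and s - 1 bidders absorbing the
  bundle without \<open>j\<close>; together with \<open>B\<close> these make up 2(m - 1). Expected
  revenues of VCG are handled as integrals in \<open>ennreal\<close>, where sums, Fubini and
  monotonicity apply to infinite values as well. In the comparison of optima, incentive constraints
  refer to topological supports, so constraining a type from the additive support has to yield a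
  type in the constrained support.\<close>

lemma Inf_enat_in:
  fixes S :: "enat set"
  assumes "Inf S \<noteq> \<infinity>"
  shows "Inf S \<in> S"
proof -
  have "S \<noteq> {}" using assms by (auto simp: Inf_enat_def)
  then show ?thesis unfolding Inf_enat_def by (auto intro: LeastI)
qed

lemma arg_max_on_finite:
  fixes f :: "'a \<Rightarrow> real"
  assumes "finite S" "S \<noteq> {}"
  shows "arg_max_on f S \<in> S" "f (arg_max_on f S) = Max (f ` S)"
proof -
  have "Max (f ` S) \<in> f ` S" using assms by (intro Max_in) auto
  then obtain a where a: "a \<in> S" "f a = Max (f ` S)" by auto
  have "is_arg_max f (\<lambda>x. x \<in> S) (arg_max_on f S)"
    unfolding arg_max_on_def arg_max_def
    by (rule someI[of _ a]) (use a assms in \<open>auto simp: is_arg_max_linorder\<close>)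
  then show "arg_max_on f S \<in> S" "f (arg_max_on f S) = Max (f ` S)"
    using assms by (auto simp: is_arg_max_linorder intro!: Max_eqI[symmetric])
qed

text \<open>Taking the maximum over a fixed finite set is 1-Lipschitz in the sup norm. This gives
  the continuity of \<open>constrained_valuation\<close> in the item values.\<close>

lemma abs_Max_diff_le:
  fixes f g :: "'a \<Rightarrow> real"
  assumes "finite R" "R \<noteq> {}" "\<And>t. t \<in> R \<Longrightarrow> \<bar>f t - g t\<bar> \<le> d"
  shows "\<bar>Max (f ` R) - Max (g ` R)\<bar> \<le> d"
proof -
  have "Max (f ` R) \<le> Max (g ` R) + d" if "\<And>t. t \<in> R \<Longrightarrow> \<bar>f t - g t\<bar> \<le> d" for f g :: "'a \<Rightarrow> real"
  proof (subst Max_le_iff)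
    show "\<forall>a\<in>f ` R. a \<le> Max (g ` R) + d"
    proof safe
      fix t assume t: "t \<in> R"
      then have "g t \<le> Max (g ` R)" using assms(1) by simp
      then show "f t \<le> Max (g ` R) + d" using that[OF t] by linarith
    qed
  qed (use assms in auto)
  from this[of f g] this[of g f] show ?thesis
    using assms(3) by (fastforce simp: abs_minus_commute)
qed

text \<open>Leaving out a bidder lowers the maximum only if she is the unique top one, so minimizing
  over the bidder left out yields the second-highest value, without any ranking or tie-breaking. The
  inserted 0 makes the value 0 for a single bidder and floors it there in general.\<close>

definition second_highest :: "nat set \<Rightarrow> (nat \<Rightarrow> real) \<Rightarrow> real" where
  "second_highest S y = (MIN i\<in>S. Max (insert 0 (y ` (S - {i}))))"

text \<open>Leaving out any one element bounds the minimum from above. In the applications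
  \<open>i\<close> is the winner, who need not lie in \<open>S\<close>; if she does not, an
  arbitrary element is left out.\<close>

lemma second_highest_leI:
  assumes "finite S" "S \<noteq> {}" "0 \<le> r" "\<And>l. l \<in> S \<Longrightarrow> l \<noteq> i \<Longrightarrow> y l \<le> r"
  shows "second_highest S y \<le> r"
proof -
  obtain i' where i': "i' \<in> S" "i \<in> S \<Longrightarrow> i' = i"
    using assms(2) by (cases "i \<in> S") auto
  have "second_highest S y \<le> Max (insert 0 (y ` (S - {i'})))"
    unfolding second_highest_def using assms(1) i' by (intro Min_le) auto
  also have "\<dots> \<le> r"
    using assms i' by (subst Max_le_iff) auto
  finally show ?thesis .
qed

lemma second_highest_nonneg:
  assumes "finite S" "S \<noteq> {}"
  shows "0 \<le> second_highest S y"
  unfolding second_highest_def using assms by (subst Min_ge_iff) (auto intro!: Max_ge)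

lemma sum_leave_one_out:
  fixes f :: "nat \<Rightarrow> real"
  assumes "finite S"
  shows "(\<Sum>i\<in>S. \<Sum>l\<in>S - {i}. f l) = (real (card S) - 1) * sum f S"
proof -
  have "(\<Sum>i\<in>S. \<Sum>l\<in>S - {i}. f l) = (\<Sum>i\<in>S. sum f S - f i)"
    using assms by (intro sum.cong refl) (simp add: sum_diff1)
  then show ?thesis
    by (simp add: sum_subtractf algebra_simps)
qed

text \<open>Once one top bidder is fixed, leaving out any other bidder keeps the maximum, so all
  terms but one cancel. The left-hand side is the total VCG payment for a single item, in the form
  of \<open>sum_vcg_payment\<close>.\<close>

lemma sum_max_leave_one_out:
  assumes S: "finite S" "S \<noteq> {}"
  shows "(\<Sum>i\<in>S. Max (insert 0 (y ` (S - {i})))) - (real (card S) - 1) * Max (insert 0 (y ` S))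
    = second_highest S y"
proof -
  have "Max (y ` S) \<in> y ` S" using S by (intro Max_in) auto
  then obtain i where i: "i \<in> S" "y i = Max (y ` S)" by auto
  have yi: "y l \<le> y i" if "l \<in> S" for l
    using that S i(2) by simp
  have top: "Max (insert 0 (y ` (S - {l}))) = Max (insert 0 (y ` S))" if "l \<in> S" "l \<noteq> i" for l
  proof (rule antisym)
    show "Max (insert 0 (y ` (S - {l}))) \<le> Max (insert 0 (y ` S))"
      using S by (intro Max_mono) auto
    have "y i \<le> Max (insert 0 (y ` (S - {l})))"
      using S i(1) \<open>l \<noteq> i\<close> by (intro Max_ge insertI2 imageI) auto
    then have "y a \<le> Max (insert 0 (y ` (S - {l})))" if "a \<in> S" for a
      using yi[OF that] by linarith
    then show "Max (insert 0 (y ` S)) \<le> Max (insert 0 (y ` (S - {l})))"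
      using S by (subst Max_le_iff) auto
  qed
  have le: "Max (insert 0 (y ` (S - {i}))) \<le> Max (insert 0 (y ` S))"
    using S by (intro Max_mono) auto
  have sec: "second_highest S y = Max (insert 0 (y ` (S - {i})))"
    unfolding second_highest_def
  proof (rule Min_eqI)
    fix r assume "r \<in> (\<lambda>l. Max (insert 0 (y ` (S - {l})))) ` S"
    then obtain l where l: "l \<in> S" "r = Max (insert 0 (y ` (S - {l})))" by auto
    then show "Max (insert 0 (y ` (S - {i}))) \<le> r"
      using le top[of l] by (cases "l = i") auto
  qed (use S i in auto)
  have "(\<Sum>l\<in>S. Max (insert 0 (y ` (S - {l}))))
      = Max (insert 0 (y ` (S - {i}))) + (\<Sum>l\<in>S - {i}. Max (insert 0 (y ` (S - {l}))))"
    using S i by (simp add: sum.remove)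
  also have "(\<Sum>l\<in>S - {i}. Max (insert 0 (y ` (S - {l})))) = (\<Sum>l\<in>S - {i}. Max (insert 0 (y ` S)))"
    using top by (intro sum.cong) auto
  also have "\<dots> = (real (card S) - 1) * Max (insert 0 (y ` S))"
    using S i card_gt_0_iff[of S] by (simp add: of_nat_diff)
  finally show ?thesis using sec by simp
qed

lemma second_highest_mono:
  assumes "finite S'" "S \<subseteq> S'" "S \<noteq> {}"
  shows "second_highest S y \<le> second_highest S' y"
proof -
  have S: "finite S" "S' \<noteq> {}" using assms finite_subset by auto
  then have "second_highest S' y \<in> (\<lambda>i. Max (insert 0 (y ` (S' - {i})))) ` S'"
    unfolding second_highest_def using assms by (intro Min_in) auto
  then obtain i where "i \<in> S'" "second_highest S' y = Max (insert 0 (y ` (S' - {i})))" by auto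
  then show ?thesis
    using assms S by (intro second_highest_leI[of _ _ i]) (auto intro!: Max_ge)
qed

lemma second_highest_reindex:
  assumes "inj_on h S"
  shows "second_highest (h ` S) y = second_highest S (\<lambda>i. y (h i))"
proof -
  have "h ` S - {h i} = h ` (S - {i})" if "i \<in> S" for i
    using assms that by (auto simp: inj_on_def)
  then have "y ` (h ` S - {h i}) = (\<lambda>i. y (h i)) ` (S - {i})" if "i \<in> S" for i
    using that by (simp add: image_image)
  then show ?thesis
    unfolding second_highest_def image_image by (metis (mono_tags, lifting) image_cong)
qed

lemma second_highest_cong:
  assumes "\<And>i. i \<in> S \<Longrightarrow> y i = y' i"
  shows "second_highest S y = second_highest S y'"
proof -
  have "y ` (S - {i}) = y' ` (S - {i})" for i using assms by auto
  then show ?thesis by (simp add: second_highest_def)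
qed

section \<open>VCG revenue\<close>

lemma finite_allocations: "finite (allocations n m)"
proof -
  have "allocations n m \<subseteq> {..<n} \<rightarrow>\<^sub>E Pow {..<m}" by (auto simp: allocations_def)
  moreover have "finite ({..<n} \<rightarrow>\<^sub>E Pow {..<m} :: (nat \<Rightarrow> nat set) set)"
    by (intro finite_PiE) auto
  ultimately show ?thesis by (rule finite_subset)
qed

lemma allocations_nonempty: "allocations n m \<noteq> {}"
proof -
  have "(\<lambda>i\<in>{..<n}. {}) \<in> allocations n m"
    by (auto simp: allocations_def disjoint_family_on_def)
  then show ?thesis by auto
qed

lemma vcg_allocation_in: "vcg_allocation n m b \<in> allocations n m"
  unfolding vcg_allocation_def by (intro arg_max_on_finite finite_allocations allocations_nonempty)

lemma vcg_payment_nonneg: "i < n \<Longrightarrow> 0 \<le> vcg_payment n m b i"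
  by (auto simp: vcg_payment_def finite_allocations vcg_allocation_in)

text \<open>The value of a bidder for her bundle is subtracted in the payments of the n - 1 others.
  So the chosen allocation enters only through its total welfare, which is maximal, and tie-breaking
  drops out.\<close>

lemma sum_vcg_payment:
  "(\<Sum>i<n. vcg_payment n m b i) =
     (\<Sum>i<n. Max (welfare ({..<n} - {i}) b ` allocations n m))
       - (real n - 1) * Max (welfare {..<n} b ` allocations n m)"
proof -
  let ?A = "vcg_allocation n m b"
  have "(\<Sum>i<n. welfare ({..<n} - {i}) b ?A) = (real n - 1) * welfare {..<n} b ?A"
    unfolding welfare_def using sum_leave_one_out[of "{..<n}" "\<lambda>i. b i (?A i)"] by simp
  also have "welfare {..<n} b ?A = Max (welfare {..<n} b ` allocations n m)"
    unfolding vcg_allocation_def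
    by (intro arg_max_on_finite finite_allocations allocations_nonempty)
  finally show ?thesis
    by (simp add: vcg_payment_def sum_subtractf)
qed

text \<open>Additive welfare splits over the items, and an item may stay unsold, hence the inserted
  0. The set \<open>N\<close> varies because VCG also evaluates the welfare without one
  bidder.\<close>

lemma max_welfare_additive:
  assumes N: "N \<subseteq> {..<k}" and b: "\<And>i. i \<in> N \<Longrightarrow> b i = additive_valuation m (x i)"
  shows "Max (welfare N b ` allocations k m) = (\<Sum>j<m. Max (insert 0 ((\<lambda>i. x i j) ` N)))"
proof (rule Max_eqI)
  show "finite (welfare N b ` allocations k m)" using finite_allocations by auto
  have finN: "finite N" using N finite_subset by auto
  have welfare: "welfare N b A = (\<Sum>j<m. \<Sum>i | i \<in> N \<and> j \<in> A i. x i j)"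
    if A: "A \<in> allocations k m" for A
  proof -
    have sub: "A i \<subseteq> {..<m}" if "i \<in> N" for i using A N that by (auto simp: allocations_def)
    have "welfare N b A = (\<Sum>i\<in>N. \<Sum>j\<in>{j \<in> {..<m}. j \<in> A i}. x i j)"
      unfolding welfare_def
    proof (intro sum.cong refl)
      fix i assume i: "i \<in> N"
      then have "{j \<in> {..<m}. j \<in> A i} = A i" using sub by auto
      then show "b i (A i) = (\<Sum>j\<in>{j \<in> {..<m}. j \<in> A i}. x i j)"
        using b[OF i] sub[OF i] by (simp add: additive_valuation_def)
    qed
    also have "\<dots> = (\<Sum>j<m. \<Sum>i | i \<in> N \<and> j \<in> A i. x i j)"
      using finN by (intro sum.swap_restrict) auto
    finally show ?thesis .
  qed
  show "w \<le> (\<Sum>j<m. Max (insert 0 ((\<lambda>i. x i j) ` N)))" if w: "w \<in> welfare N b ` allocations k m" for w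
  proof -
    obtain A where A: "A \<in> allocations k m" "w = welfare N b A" using w by auto
    have "(\<Sum>i | i \<in> N \<and> j \<in> A i. x i j) \<le> Max (insert 0 ((\<lambda>i. x i j) ` N))" for j
    proof (cases "\<exists>i\<in>N. j \<in> A i")
      case True
      then obtain i where i: "i \<in> N" "j \<in> A i" by auto
      have "i' = i" if "i' \<in> N" "j \<in> A i'" for i'
        using A(1) i N that unfolding allocations_def disjoint_family_on_def by blast
      then have "{i. i \<in> N \<and> j \<in> A i} = {i}" using i by blast
      then show ?thesis using i finN by simp
    next
      case False
      then have none: "{i. i \<in> N \<and> j \<in> A i} = {}" by auto
      show ?thesis unfolding none using finN by simp
    qed
    then show ?thesis unfolding A(2) welfare[OF A(1)] by (intro sum_mono)
  qed
  \<comment> \<open>\<open>None\<close> leaves the item unsold. A maximum other than 0 is the value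
    of some bidder in \<open>N\<close>, so the choice in the second branch is from a nonempty
    set.\<close>
  define sel where "sel j = (if Max (insert 0 ((\<lambda>i. x i j) ` N)) = 0 then None
    else Some (SOME i. i \<in> N \<and> x i j = Max (insert 0 ((\<lambda>i. x i j) ` N))))" for j
  have sel: "i \<in> N \<and> x i j = Max (insert 0 ((\<lambda>i. x i j) ` N))" if "sel j = Some i" for i j
  proof -
    have "Max (insert 0 ((\<lambda>i. x i j) ` N)) \<in> insert 0 ((\<lambda>i. x i j) ` N)"
      using finN by (intro Max_in) auto
    then have "\<exists>i. i \<in> N \<and> x i j = Max (insert 0 ((\<lambda>i. x i j) ` N))"
      using that by (auto simp: sel_def split: if_splits)
    from someI_ex[OF this] show ?thesis using that by (auto simp: sel_def split: if_splits)
  qed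
  define A where "A = (\<lambda>i\<in>{..<k}. {j. j < m \<and> sel j = Some i})"
  have A: "A \<in> allocations k m"
    by (auto simp: A_def allocations_def disjoint_family_on_def)
  have "(\<Sum>i | i \<in> N \<and> j \<in> A i. x i j) = Max (insert 0 ((\<lambda>i. x i j) ` N))" if j: "j < m" for j
  proof (cases "sel j")
    case None
    then have none: "{i. i \<in> N \<and> j \<in> A i} = {}" using N by (auto simp: A_def)
    have "Max (insert 0 ((\<lambda>i. x i j) ` N)) = 0"
      using None by (auto simp: sel_def split: if_splits)
    then show ?thesis unfolding none by simp
  next
    case (Some i)
    then have single: "{i. i \<in> N \<and> j \<in> A i} = {i}" using N sel[OF Some] j by (auto simp: A_def)
    show ?thesis unfolding single using sel[OF Some] by simp
  qed
  then have "(\<Sum>j<m. Max (insert 0 ((\<lambda>i. x i j) ` N))) = welfare N b A"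
    unfolding welfare[OF A] by simp
  then show "(\<Sum>j<m. Max (insert 0 ((\<lambda>i. x i j) ` N))) \<in> welfare N b ` allocations k m"
    using A by auto
qed

lemma vcg_revenue_additive:
  assumes k: "0 < k" and b: "\<And>i. i < k \<Longrightarrow> b i = additive_valuation m (x i)"
  shows "(\<Sum>i<k. vcg_payment k m b i) = (\<Sum>j<m. second_highest {..<k} (\<lambda>i. x i j))"
proof -
  have "(\<Sum>i<k. vcg_payment k m b i)
      = (\<Sum>i<k. \<Sum>j<m. Max (insert 0 ((\<lambda>i. x i j) ` ({..<k} - {i}))))
        - (real k - 1) * (\<Sum>j<m. Max (insert 0 ((\<lambda>i. x i j) ` {..<k})))"
    unfolding sum_vcg_payment using b
    by (intro arg_cong2[where f = minus] sum.cong refl arg_cong2[where f = times] max_welfare_additive) auto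
  also have "\<dots> = (\<Sum>j<m. (\<Sum>i<k. Max (insert 0 ((\<lambda>i. x i j) ` ({..<k} - {i}))))
        - (real k - 1) * Max (insert 0 ((\<lambda>i. x i j) ` {..<k})))"
    by (subst sum.swap) (simp add: sum_subtractf sum_distrib_left)
  also have "\<dots> = (\<Sum>j<m. second_highest {..<k} (\<lambda>i. x i j))"
    using k sum_max_leave_one_out[of "{..<k}"] by (intro sum.cong refl) (simp add: lessThan_empty_iff)
  finally show ?thesis .
qed

section \<open>Feasible assignments of items\<close>

definition assigned_value :: "(nat \<Rightarrow> nat \<Rightarrow> real) \<Rightarrow> (nat \<times> nat) set \<Rightarrow> real" where
  "assigned_value x E = (\<Sum>(i, j)\<in>E. x i j)"

text \<open>An edge (i, j) gives item \<open>j\<close> to bidder \<open>i\<close>; injectivity of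
  \<open>snd\<close> says that no item is given twice. In contrast to an allocation, an assignment
  contains only what a bidder can use, so \<open>Domain E\<close> is the set of bidders served, and
  adding or dropping an item is a set operation.\<close>

definition feasible :: "nat \<Rightarrow> nat \<Rightarrow> (nat \<Rightarrow> nat set set) \<Rightarrow> (nat \<times> nat) set \<Rightarrow> bool" where
  "feasible n m C E \<longleftrightarrow> E \<subseteq> {..<n} \<times> {..<m} \<and> inj_on snd E \<and> (\<forall>i<n. E `` {i} \<in> C i)"

definition best_value ::
    "nat \<Rightarrow> nat \<Rightarrow> (nat \<Rightarrow> nat set set) \<Rightarrow> (nat \<Rightarrow> nat \<Rightarrow> real) \<Rightarrow> nat set \<Rightarrow> nat set \<Rightarrow> real" where
  "best_value n m C x N Q = Max (assigned_value x ` {E. feasible n m C E \<and> E \<subseteq> N \<times> Q})"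

definition optimal ::
    "nat \<Rightarrow> nat \<Rightarrow> (nat \<Rightarrow> nat set set) \<Rightarrow> (nat \<Rightarrow> nat \<Rightarrow> real) \<Rightarrow> (nat \<times> nat) set \<Rightarrow> bool" where
  "optimal n m C x E \<longleftrightarrow> feasible n m C E \<and> assigned_value x E = best_value n m C x {..<n} {..<m}"

text \<open>The marginal contribution of item \<open>j\<close> to the best welfare that the bidders
  without any item could obtain from the bundle of \<open>i\<close>. It serves as the part of the
  externality of \<open>i\<close> that is attributed to \<open>j\<close>.\<close>

definition loser_price ::
    "nat \<Rightarrow> nat \<Rightarrow> (nat \<Rightarrow> nat set set) \<Rightarrow> (nat \<Rightarrow> nat \<Rightarrow> real) \<Rightarrow> (nat \<times> nat) set \<Rightarrow> nat \<Rightarrow> nat \<Rightarrow> real" where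
  "loser_price n m C x E i j =
     best_value n m C x ({..<n} - Domain E) (E `` {i})
       - best_value n m C x ({..<n} - Domain E) (E `` {i} - {j})"

text \<open>
  The optimal assignment is almost surely unique. Summing over all optimal ones avoids a choice among
  them and keeps the price measurable.
\<close>

definition item_price ::
    "nat \<Rightarrow> nat \<Rightarrow> (nat \<Rightarrow> nat set set) \<Rightarrow> (nat \<Rightarrow> nat \<Rightarrow> real) \<Rightarrow> nat \<Rightarrow> real" where
  "item_price n m C x j =
     (\<Sum>E | optimal n m C x E. \<Sum>i | (i, j) \<in> E. loser_price n m C x E i j)"

lemma feasible_subset_Pow: "{E. feasible n m C E \<and> P E} \<subseteq> Pow ({..<n} \<times> {..<m})"
  by (auto simp: feasible_def)

lemma finite_feasible: "finite {E. feasible n m C E \<and> P E}"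
  by (rule finite_subset[OF feasible_subset_Pow]) auto

lemma feasible_finite: "feasible n m C E \<Longrightarrow> finite E"
  unfolding feasible_def by (meson finite_SigmaI finite_lessThan finite_subset)

text \<open>Every bidder served holds an item, and no item is held twice.\<close>

lemma card_Domain_le:
  assumes "feasible n m C E" "Range E \<subseteq> Q" "finite Q"
  shows "card (Domain E) \<le> card Q"
proof -
  have "card (Domain E) \<le> card E"
    using assms feasible_finite by (auto simp: Domain_fst intro: card_image_le)
  also have "card E = card (Range E)"
    using assms by (auto simp: feasible_def Range_snd card_image)
  also have "\<dots> \<le> card Q" using assms by (intro card_mono)
  finally show ?thesis .
qed

lemma best_value_ge:
  assumes "feasible n m C E" "E \<subseteq> N \<times> Q"
  shows "assigned_value x E \<le> best_value n m C x N Q"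
  unfolding best_value_def using assms by (intro Max_ge) (auto simp: finite_feasible)

lemma assigned_value_insert:
  "finite E \<Longrightarrow> (i, j) \<notin> E \<Longrightarrow> assigned_value x (insert (i, j) E) = x i j + assigned_value x E"
  by (simp add: assigned_value_def)

lemma assigned_value_Un:
  "finite E \<Longrightarrow> finite E' \<Longrightarrow> E \<inter> E' = {} \<Longrightarrow>
     assigned_value x (E \<union> E') = assigned_value x E + assigned_value x E'"
  by (simp add: assigned_value_def sum.union_disjoint)

lemma assigned_value_remove:
  "finite E \<Longrightarrow> (i, j) \<in> E \<Longrightarrow> assigned_value x E = x i j + assigned_value x (E - {(i, j)})"
  by (simp add: assigned_value_def sum.remove)

lemma assigned_value_row:
  assumes "finite E"
  shows "assigned_value x (E \<inter> {i} \<times> UNIV) = (\<Sum>j\<in>E `` {i}. x i j)"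
  unfolding assigned_value_def
  by (rule sum.reindex_bij_witness[of _ "\<lambda>j. (i, j)" snd]) auto

lemma assigned_value_rows:
  assumes "E \<subseteq> N \<times> UNIV" "finite N" "finite E"
  shows "assigned_value x E = (\<Sum>i\<in>N. \<Sum>j\<in>E `` {i}. x i j)"
proof -
  have "assigned_value x E = (\<Sum>(i, j)\<in>Sigma N (\<lambda>i. E `` {i}). x i j)"
    unfolding assigned_value_def using assms by (intro sum.cong) auto
  also have "\<dots> = (\<Sum>i\<in>N. \<Sum>j\<in>E `` {i}. x i j)"
    using assms by (intro sum.Sigma[symmetric] ballI finite_Image) auto
  finally show ?thesis .
qed

lemma assigned_value_cong:
  "(\<And>i j. (i, j) \<in> E \<Longrightarrow> x i j = x' i j) \<Longrightarrow> assigned_value x E = assigned_value x' E"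
  unfolding assigned_value_def by (intro sum.cong) auto

section \<open>Assignments under fixed set systems and the VCG payments they imply\<close>

locale constrained_bidders =
  fixes n m :: nat and C :: "nat \<Rightarrow> nat set set"
  assumes m_pos: "0 < m"
    and closed: "i < n \<Longrightarrow> downward_closed m (C i)"
    and singletons: "i < n \<Longrightarrow> j < m \<Longrightarrow> {j} \<in> C i"
begin

lemma subset_in_C: "i < n \<Longrightarrow> S \<in> C i \<Longrightarrow> T \<subseteq> S \<Longrightarrow> T \<in> C i"
  using closed by (auto simp: downward_closed_def)

lemma C_subset: "i < n \<Longrightarrow> S \<in> C i \<Longrightarrow> S \<subseteq> {..<m}"
  using closed by (auto simp: downward_closed_def)

lemma empty_in_C: "i < n \<Longrightarrow> {} \<in> C i"
  using subset_in_C[OF _ singletons[OF _ m_pos]] by auto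

lemma feasible_empty: "feasible n m C {}"
  by (auto simp: feasible_def empty_in_C)

lemma feasible_subset: "feasible n m C E \<Longrightarrow> E' \<subseteq> E \<Longrightarrow> feasible n m C E'"
  unfolding feasible_def
  by (auto intro: inj_on_subset subset_in_C[where S = "E `` {_}"])

lemma feasible_Un:
  assumes E: "feasible n m C E" "feasible n m C E'"
    and disj: "Domain E \<inter> Domain E' = {}" "Range E \<inter> Range E' = {}"
  shows "feasible n m C (E \<union> E')"
proof -
  have "(E \<union> E') `` {i} \<in> C i" if i: "i < n" for i
  proof (cases "i \<in> Domain E")
    case True
    then have "(E \<union> E') `` {i} = E `` {i}" using disj by blast
    then show ?thesis using E i by (simp add: feasible_def)
  next
    case False
    then have "(E \<union> E') `` {i} = E' `` {i}" by blast
    then show ?thesis using E i by (simp add: feasible_def)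
  qed
  moreover have "inj_on snd (E \<union> E')"
    using E disj by (auto simp: feasible_def inj_on_Un Range_snd)
  ultimately show ?thesis using E unfolding feasible_def by blast
qed

lemma single_row: "{(i, j)} `` {l} = (if l = i then {j} else {})"
  by auto

lemma feasible_single: "i < n \<Longrightarrow> j < m \<Longrightarrow> feasible n m C {(i, j)}"
  using Image_singleton_iff[of _ "{(i, j)}"]
  by (auto simp: feasible_def single_row singletons empty_in_C)

lemma feasible_insert:
  assumes "feasible n m C E" "i < n" "j < m" "i \<notin> Domain E" "j \<notin> Range E"
  shows "feasible n m C (insert (i, j) E)"
  using feasible_Un[OF feasible_single[OF assms(2,3)] assms(1)] assms by auto

lemma best_value_attained:
  obtains E where "feasible n m C E" "E \<subseteq> N \<times> Q" "assigned_value x E = best_value n m C x N Q"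
proof -
  have "best_value n m C x N Q \<in> assigned_value x ` {E. feasible n m C E \<and> E \<subseteq> N \<times> Q}"
    unfolding best_value_def using feasible_empty by (intro Max_in) (auto simp: finite_feasible)
  then show ?thesis using that by auto
qed

lemma best_value_empty: "best_value n m C x N {} = assigned_value x {}"
proof -
  have "{E. feasible n m C E \<and> E = {}} = {{}}" using feasible_empty by auto
  then show ?thesis by (simp add: best_value_def)
qed

lemma best_value_le_iff:
  "best_value n m C x N Q \<le> r \<longleftrightarrow> (\<forall>E. feasible n m C E \<and> E \<subseteq> N \<times> Q \<longrightarrow> assigned_value x E \<le> r)"
  by (metis best_value_attained best_value_ge order_trans)

lemma best_value_mono: "N \<subseteq> N' \<Longrightarrow> Q \<subseteq> Q' \<Longrightarrow> best_value n m C x N Q \<le> best_value n m C x N' Q'"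
  unfolding best_value_le_iff by (auto intro!: best_value_ge)

lemma optimal_iff:
  "optimal n m C x E \<longleftrightarrow>
     feasible n m C E \<and> (\<forall>E'. feasible n m C E' \<longrightarrow> assigned_value x E' \<le> assigned_value x E)"
proof -
  have "E' \<subseteq> {..<n} \<times> {..<m}" if "feasible n m C E'" for E'
    using that by (simp add: feasible_def)
  then show ?thesis
    unfolding optimal_def by (metis best_value_attained best_value_ge order_antisym)
qed

lemma optimal_exists: obtains E where "optimal n m C x E"
  by (metis best_value_attained optimal_def)

lemma finite_optimal: "finite {E. optimal n m C x E}"
  unfolding optimal_def by (rule finite_feasible)

lemma loser_price_nonneg: "0 \<le> loser_price n m C x E i j"
  unfolding loser_price_def using best_value_mono by (simp add: Diff_subset)

lemma finite_column: "optimal n m C x E \<Longrightarrow> finite {i. (i, j) \<in> E}"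
  by (rule finite_subset[of _ "{..<n}"]) (auto simp: optimal_def feasible_def)

lemma item_price_nonneg: "0 \<le> item_price n m C x j"
  unfolding item_price_def by (intro sum_nonneg loser_price_nonneg)

lemma item_price_ge:
  assumes "optimal n m C x E" "(i, j) \<in> E"
  shows "loser_price n m C x E i j \<le> item_price n m C x j"
proof -
  have "loser_price n m C x E i j \<le> (\<Sum>i | (i, j) \<in> E. loser_price n m C x E i j)"
    using assms finite_column loser_price_nonneg by (intro member_le_sum) auto
  also have "\<dots> \<le> item_price n m C x j"
    unfolding item_price_def using assms
    by (intro member_le_sum[of E] sum_nonneg) (auto simp: finite_optimal loser_price_nonneg)
  finally show ?thesis .
qed

text \<open>Passes between allocations and edge sets. From an allocation every bidder keeps a
  maximizing feasible part of her bundle, which gives an assignment of the same welfare; conversely,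
  the bundles of an assignment are feasible, so their valuations are at least the sums of the
  edges.\<close>

lemma max_welfare:
  assumes N: "N \<subseteq> {..<n}" and b: "\<And>i. i \<in> N \<Longrightarrow> b i = constrained_valuation m (C i) (x i)"
  shows "Max (welfare N b ` allocations n m) = best_value n m C x N {..<m}"
proof (rule antisym)
  have fin: "finite N" using N finite_subset by auto
  have finT: "finite {T. T \<subseteq> S \<and> T \<in> C i}" if "i < n" for S i
    by (rule finite_subset[of _ "Pow {..<m}"]) (use that C_subset in auto)
  show "Max (welfare N b ` allocations n m) \<le> best_value n m C x N {..<m}"
  proof (subst Max_le_iff)
    show "\<forall>w\<in>welfare N b ` allocations n m. w \<le> best_value n m C x N {..<m}"
    proof
      fix w assume "w \<in> welfare N b ` allocations n m"
      then obtain A where A: "A \<in> allocations n m" "w = welfare N b A" by auto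
      have "\<exists>T. T \<subseteq> A i \<and> T \<in> C i \<and> b i (A i) = (\<Sum>j\<in>T. x i j)" if i: "i \<in> N" for i
      proof -
        have "A i \<subseteq> {..<m}" using A i N by (auto simp: allocations_def)
        moreover have "Max ((\<lambda>T. \<Sum>j\<in>T. x i j) ` {T. T \<subseteq> A i \<and> T \<in> C i})
            \<in> (\<lambda>T. \<Sum>j\<in>T. x i j) ` {T. T \<subseteq> A i \<and> T \<in> C i}"
          using i N empty_in_C finT by (intro Max_in) auto
        ultimately show ?thesis
          using b[OF i] by (auto simp: constrained_valuation_def)
      qed
      then obtain T where T: "\<And>i. i \<in> N \<Longrightarrow> T i \<subseteq> A i \<and> T i \<in> C i \<and> b i (A i) = (\<Sum>j\<in>T i. x i j)"
        by metis
      let ?E = "Sigma N T"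
      have row: "?E `` {i} = (if i \<in> N then T i else {})" for i by auto
      have "inj_on snd ?E"
      proof (rule inj_onI)
        fix p q assume pq: "p \<in> ?E" "q \<in> ?E" "snd p = snd q"
        then have "snd p \<in> A (fst p) \<inter> A (fst q)" "fst p < n" "fst q < n"
          using T N by (auto simp: subset_iff)
        then have "fst p = fst q"
          using A(1) unfolding allocations_def disjoint_family_on_def by blast
        then show "p = q" using pq(3) by (simp add: prod_eq_iff)
      qed
      moreover have "?E `` {i} \<in> C i" if "i < n" for i
        using that T empty_in_C unfolding row by auto
      moreover have "?E \<subseteq> N \<times> {..<m}"
        using T N C_subset by fastforce
      ultimately have feas: "feasible n m C ?E" and sub: "?E \<subseteq> N \<times> {..<m}"
        using N by (auto simp: feasible_def)
      have "w = (\<Sum>i\<in>N. \<Sum>j\<in>T i. x i j)"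
        using A T by (simp add: welfare_def)
      also have "\<dots> = assigned_value x ?E"
        using assigned_value_rows[OF Sigma_mono[OF subset_refl subset_UNIV] fin feasible_finite[OF feas], of x]
        by (simp add: row)
      also have "\<dots> \<le> best_value n m C x N {..<m}"
        by (rule best_value_ge[OF feas sub])
      finally show "w \<le> best_value n m C x N {..<m}" .
    qed
  qed (use finite_allocations allocations_nonempty in auto)
  obtain E where E: "feasible n m C E" "E \<subseteq> N \<times> {..<m}"
      "assigned_value x E = best_value n m C x N {..<m}"
    by (rule best_value_attained)
  define A where "A = (\<lambda>i\<in>{..<n}. E `` {i})"
  have A: "A \<in> allocations n m"
  proof -
    have "E `` {i} \<inter> E `` {i'} = {}" if "i \<noteq> i'" for i i'
      using E(1) that by (force simp: feasible_def inj_on_def)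
    moreover have "E `` {i} \<subseteq> {..<m}" for i
      using E(1) by (auto simp: feasible_def)
    ultimately show ?thesis
      unfolding allocations_def A_def disjoint_family_on_def by auto
  qed
  have "best_value n m C x N {..<m} = (\<Sum>i\<in>N. \<Sum>j\<in>E `` {i}. x i j)"
    using E fin feasible_finite assigned_value_rows[of E N x] by auto
  also have "\<dots> \<le> welfare N b A"
    unfolding welfare_def
  proof (rule sum_mono)
    fix i assume i: "i \<in> N"
    then have "A i = E `` {i}" "E `` {i} \<in> C i" "E `` {i} \<subseteq> {..<m}" "i < n"
      using N E by (auto simp: A_def feasible_def)
    then show "(\<Sum>j\<in>E `` {i}. x i j) \<le> b i (A i)"
      using b[OF i] finT[of i] by (auto simp: constrained_valuation_def intro!: Max_ge)
  qed
  also have "\<dots> \<le> Max (welfare N b ` allocations n m)"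
    using A finite_allocations by (intro Max_ge) auto
  finally show "best_value n m C x N {..<m} \<le> Max (welfare N b ` allocations n m)" .
qed

text \<open>Fix one optimal assignment \<open>D\<close> of the bundle to the losers. Deleting the
  edge of \<open>j\<close> from \<open>D\<close> leaves a candidate for the bundle without
  \<open>j\<close>, so the marginal of \<open>j\<close> is at most the value of that edge; these
  edges make up \<open>D\<close>.\<close>

lemma loser_prices_self_bounding:
  assumes E: "feasible n m C E" "i < n"
  shows "(\<Sum>j\<in>E `` {i}. loser_price n m C x E i j)
    \<le> best_value n m C x ({..<n} - Domain E) (E `` {i})"
proof -
  let ?L = "{..<n} - Domain E" and ?S = "E `` {i}"
  obtain D where D: "feasible n m C D" "D \<subseteq> ?L \<times> ?S"
      "assigned_value x D = best_value n m C x ?L ?S"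
    by (rule best_value_attained)
  have finD: "finite D" "finite ?S"
    using D(1) E feasible_finite by auto
  have "(\<Sum>j\<in>?S. loser_price n m C x E i j) \<le> (\<Sum>j\<in>?S. assigned_value x (D \<inter> UNIV \<times> {j}))"
  proof (rule sum_mono)
    fix j assume "j \<in> ?S"
    have "assigned_value x (D - UNIV \<times> {j}) \<le> best_value n m C x ?L (?S - {j})"
      using D by (intro best_value_ge feasible_subset[OF D(1)]) auto
    moreover have "assigned_value x D
        = assigned_value x (D - UNIV \<times> {j}) + assigned_value x (D \<inter> UNIV \<times> {j})"
      using finD by (subst assigned_value_Un[symmetric]) (auto intro!: arg_cong[where f = "assigned_value x"])
    ultimately show "loser_price n m C x E i j \<le> assigned_value x (D \<inter> UNIV \<times> {j})"
      using D(3) by (simp add: loser_price_def)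
  qed
  also have "\<dots> = assigned_value x (\<Union>j\<in>?S. D \<inter> UNIV \<times> {j})"
    unfolding assigned_value_def using finD by (intro sum.UNION_disjoint[symmetric]) auto
  also have "(\<Union>j\<in>?S. D \<inter> UNIV \<times> {j}) = D"
    using D by auto
  finally show ?thesis using D(3) by simp
qed

text \<open>Without \<open>i\<close>, the other winners can keep their bundles while her items go to
  the losers. The union is feasible because losers hold nothing in \<open>E\<close> and the items of
  \<open>i\<close> are free.\<close>

lemma externality_ge_losers:
  assumes E: "optimal n m C x E" and i: "i < n"
  shows "best_value n m C x ({..<n} - Domain E) (E `` {i})
    \<le> best_value n m C x ({..<n} - {i}) {..<m} - (assigned_value x E - (\<Sum>j\<in>E `` {i}. x i j))"
proof -
  let ?L = "{..<n} - Domain E" and ?S = "E `` {i}"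
  have feas: "feasible n m C E" using E by (simp add: optimal_def)
  obtain D where D: "feasible n m C D" "D \<subseteq> ?L \<times> ?S"
      "assigned_value x D = best_value n m C x ?L ?S"
    by (rule best_value_attained)
  let ?R = "E - {i} \<times> UNIV"
  have inj: "a = a'" if "(a, j) \<in> E" "(a', j) \<in> E" for a a' j
    using feas that by (force simp: feasible_def inj_on_def)
  have fin: "finite E" "finite D" using feas D feasible_finite by auto
  have feasU: "feasible n m C (?R \<union> D)"
  proof (rule feasible_Un[OF feasible_subset[OF feas] D(1)])
    show "Domain ?R \<inter> Domain D = {}" using D by auto
    show "Range ?R \<inter> Range D = {}" using D inj by blast
  qed auto
  have subU: "?R \<union> D \<subseteq> ({..<n} - {i}) \<times> {..<m}"
    using feas D feasU by (fastforce simp: feasible_def)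
  have "assigned_value x ?R + assigned_value x D = assigned_value x (?R \<union> D)"
    using fin D by (intro assigned_value_Un[symmetric]) auto
  also have "\<dots> \<le> best_value n m C x ({..<n} - {i}) {..<m}"
    by (rule best_value_ge[OF feasU subU])
  finally have "assigned_value x ?R + best_value n m C x ?L ?S
      \<le> best_value n m C x ({..<n} - {i}) {..<m}"
    using D by simp
  moreover have "assigned_value x E = assigned_value x ?R + (\<Sum>j\<in>?S. x i j)"
    using fin
    by (subst assigned_value_row[OF fin(1), symmetric], subst assigned_value_Un[symmetric])
       (auto intro!: arg_cong[where f = "assigned_value x"])
  ultimately show ?thesis by simp
qed

lemma vcg_revenue_ge_loser_prices:
  assumes b: "\<And>i. i < n \<Longrightarrow> b i = constrained_valuation m (C i) (x i)" and E: "optimal n m C x E"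
  shows "(\<Sum>(i, j)\<in>E. loser_price n m C x E i j) \<le> (\<Sum>i<n. vcg_payment n m b i)"
proof -
  have feas: "feasible n m C E" using E by (simp add: optimal_def)
  have sub: "E \<subseteq> {..<n} \<times> UNIV" and fin: "finite E"
    using feas feasible_finite by (auto simp: feasible_def)
  have "(\<Sum>(i, j)\<in>E. loser_price n m C x E i j) = (\<Sum>i<n. \<Sum>j\<in>E `` {i}. loser_price n m C x E i j)"
    using assigned_value_rows[OF sub _ fin, of "loser_price n m C x E"] by (simp add: assigned_value_def)
  also have "\<dots> \<le> (\<Sum>i<n. best_value n m C x ({..<n} - {i}) {..<m}
      - (assigned_value x E - (\<Sum>j\<in>E `` {i}. x i j)))"
    using loser_prices_self_bounding[OF feas] externality_ge_losers[OF E]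
    by (intro sum_mono) (meson lessThan_iff order_trans)
  \<comment> \<open>The own values of the bidders add up to one \<open>assigned_value x E\<close>,
    so in total the optimum is subtracted n - 1 times, as in \<open>sum_vcg_payment\<close>.\<close>
  also have "\<dots> = (\<Sum>i<n. best_value n m C x ({..<n} - {i}) {..<m}) - real n * assigned_value x E
      + assigned_value x E"
    using assigned_value_rows[OF sub _ fin, of x] by (simp add: sum_subtractf)
  also have "assigned_value x E = best_value n m C x {..<n} {..<m}"
    using E by (simp add: optimal_def)
  also have "(\<Sum>i<n. best_value n m C x ({..<n} - {i}) {..<m})
      - real n * best_value n m C x {..<n} {..<m} + best_value n m C x {..<n} {..<m}
      = (\<Sum>i<n. vcg_payment n m b i)"
    unfolding sum_vcg_payment using b
    by (subst (1 2) max_welfare[of _ b x]) (auto simp: max_welfare[of _ b x] algebra_simps)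
  finally show ?thesis .
qed

text \<open>Injectivity makes the optimal assignment unique, which reduces the outer sum in
  \<open>item_price\<close> to one term. With several optima that sum could exceed the
  revenue.\<close>

lemma vcg_revenue_ge_item_prices:
  assumes b: "\<And>i. i < n \<Longrightarrow> b i = constrained_valuation m (C i) (x i)"
    and unique: "inj_on (assigned_value x) (Pow ({..<n} \<times> {..<m}))"
  shows "(\<Sum>j<m. item_price n m C x j) \<le> (\<Sum>i<n. vcg_payment n m b i)"
proof -
  obtain E where E: "optimal n m C x E" by (rule optimal_exists)
  then have feas: "feasible n m C E" by (simp add: optimal_def)
  have single: "{E. optimal n m C x E} = {E}"
  proof -
    have "E' = E" if "optimal n m C x E'" for E'
    proof (rule inj_onD[OF unique])
      show "assigned_value x E' = assigned_value x E"
        using that E by (simp only: optimal_def)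
      show "E' \<in> Pow ({..<n} \<times> {..<m})" "E \<in> Pow ({..<n} \<times> {..<m})"
        using that E by (simp_all only: optimal_def feasible_def Pow_iff)
    qed
    then show ?thesis using E by blast
  qed
  have "(\<Sum>j<m. item_price n m C x j) = (\<Sum>j<m. \<Sum>i\<in>{i. (i, j) \<in> E}. loser_price n m C x E i j)"
    unfolding item_price_def single by simp
  also have "\<dots> = (\<Sum>(j, i)\<in>Sigma {..<m} (\<lambda>j. {i. (i, j) \<in> E}). loser_price n m C x E i j)"
    using finite_column[OF E] by (subst sum.Sigma) simp_all
  also have "\<dots> = (\<Sum>(i, j)\<in>E. loser_price n m C x E i j)"
    using feas by (intro sum.reindex_bij_witness[of _ prod.swap prod.swap])
      (auto simp: feasible_def)
  finally show ?thesis using vcg_revenue_ge_loser_prices[OF b E] by simp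
qed

text \<open>\<open>D\<close> is a best way for the losers to absorb the bundle without
  \<open>j\<close>. A loser \<open>l\<close> who is idle in \<open>D\<close> can take
  \<open>j\<close> on top of it, as singletons are feasible, so \<open>j\<close> adds at least her
  value.\<close>

lemma loser_price_ge:
  assumes E: "feasible n m C E" "(i, j) \<in> E"
    and D: "feasible n m C D" "D \<subseteq> ({..<n} - Domain E) \<times> (E `` {i} - {j})"
      "assigned_value x D = best_value n m C x ({..<n} - Domain E) (E `` {i} - {j})"
    and l: "l < n" "l \<notin> Domain E" "l \<notin> Domain D"
  shows "x l j \<le> loser_price n m C x E i j"
proof -
  have j: "j < m" using E by (auto simp: feasible_def)
  have "feasible n m C (insert (l, j) D)"
    using D l j by (intro feasible_insert) auto
  then have "assigned_value x (insert (l, j) D)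
      \<le> best_value n m C x ({..<n} - Domain E) (E `` {i})"
    using D l E by (intro best_value_ge) auto
  moreover have "assigned_value x (insert (l, j) D) = x l j + assigned_value x D"
    using D(1) l feasible_finite by (intro assigned_value_insert) auto
  ultimately show ?thesis using D(3) by (simp add: loser_price_def)
qed

text \<open>
  \<open>B\<close> are the bidders served when item \<open>j\<close> is absent. Adding \<open>j\<close> either serves the bidder outside
  \<open>B\<close> with the highest value for \<open>j\<close>, or it goes to a bidder \<open>b \<in> B\<close> that is determined by the
  values of \<open>B\<close> alone. Hence the values for \<open>j\<close> outside of \<open>B\<close> do not influence \<open>G\<close>.
\<close>

lemma item_price_ge_second_highest:
  assumes j: "j < m" and k: "0 < k" "k + 2 * (m - 1) \<le> n"
  obtains B where "B \<subseteq> {..<n}"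
    and "\<forall>u. \<exists>G \<subseteq> {..<n} - B. k \<le> card G \<and>
      (\<forall>y. (\<forall>i<n. 0 \<le> y i) \<longrightarrow> (\<forall>i\<in>B. y i = u i) \<longrightarrow>
        second_highest G y \<le> item_price n m C (\<lambda>i. (x i)(j := y i)) j)"
proof -
  define X where "X y = (\<lambda>i. (x i)(j := y i))" for y :: "nat \<Rightarrow> real"
  \<comment> \<open>A best assignment of the other items. It does not involve column
    \<open>j\<close> and is therefore fixed before \<open>y\<close>.\<close>
  obtain E0 where E0: "feasible n m C E0" "E0 \<subseteq> {..<n} \<times> ({..<m} - {j})"
      "assigned_value x E0 = best_value n m C x {..<n} ({..<m} - {j})"
    by (rule best_value_attained)
  define v0 where "v0 = assigned_value x E0"
  define B where "B = Domain E0"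
  have B: "B \<subseteq> {..<n}" using E0 by (auto simp: B_def)
  have finB: "finite B" using B finite_subset by auto
  have cardB: "card B \<le> m - 1"
    using card_Domain_le[OF E0(1), of "{..<m} - {j}"] E0(2) j by (auto simp: B_def)
  have no_j: "assigned_value x E \<le> v0" if "feasible n m C E" "j \<notin> Range E" for E
    unfolding v0_def E0(3) using that
    by (intro best_value_ge) (force simp: feasible_def)+
  have X_no_j: "assigned_value (X y) E = assigned_value x E" if "j \<notin> Range E" for y E
    using that by (intro assigned_value_cong) (auto simp: X_def)
  have j_removed: "j \<notin> Range (E - {(w, j)})" if "feasible n m C E" "(w, j) \<in> E" for E w
    using that by (force simp: feasible_def inj_on_def)
  have X_j: "assigned_value (X y) E = y w + assigned_value x (E - {(w, j)})"
    if "feasible n m C E" "(w, j) \<in> E" for y E w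
    using that j_removed[OF that] assigned_value_remove[OF feasible_finite, OF that, of "X y"]
    by (simp add: X_no_j) (simp add: X_def)
  \<comment> \<open>If \<open>w\<close> holds \<open>j\<close>, the total value is
    \<open>y w\<close> plus that of the remaining edges, which do not involve column
    \<open>j\<close>. So the best completion \<open>Ew w\<close> and the value \<open>c w\<close> of
    its remaining edges are the same for all \<open>y\<close>.\<close>
  define S where "S w = {E. feasible n m C E \<and> (w, j) \<in> E}" for w
  define Ew where "Ew w = arg_max_on (\<lambda>E. assigned_value x (E - {(w, j)})) (S w)" for w
  define c where "c w = assigned_value x (Ew w - {(w, j)})" for w
  have S: "finite (S w)" for w by (simp add: S_def finite_feasible)
  have Ew: "feasible n m C (Ew w)" "(w, j) \<in> Ew w" if "w < n" for w
  proof -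
    have "S w \<noteq> {}" using feasible_single[OF that j] by (auto simp: S_def)
    then have "Ew w \<in> S w" unfolding Ew_def using S by (intro arg_max_on_finite)
    then show "feasible n m C (Ew w)" "(w, j) \<in> Ew w" by (auto simp: S_def)
  qed
  have c: "assigned_value x (E - {(w, j)}) \<le> c w" if "feasible n m C E" "(w, j) \<in> E" for E w
  proof -
    have "E \<in> S w" using that by (simp add: S_def)
    then have "S w \<noteq> {}" by auto
    then show ?thesis
      using arg_max_on_finite(2)[OF S, of w "\<lambda>E. assigned_value x (E - {(w, j)})"] \<open>E \<in> S w\<close> S
      by (simp add: c_def Ew_def)
  qed
  have n_card: "k + m - 1 \<le> card ({..<n} - B)"
    using B finB cardB k m_pos by (simp add: card_Diff_subset)
  \<comment> \<open>Without \<open>j\<close> an assignment is worth at most \<open>v0\<close>, and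
    \<open>y t\<close> is nonnegative. With \<open>j\<close> at a bidder outside \<open>B\<close> it
    is worth at most \<open>y t + v0\<close>, and with \<open>j\<close> at some \<open>w\<close> in
    \<open>B\<close> at most \<open>y w + c w\<close>.\<close>
  have upper: "assigned_value (X y) E \<le> r"
    if E: "feasible n m C E" and y: "\<And>i. i < n \<Longrightarrow> 0 \<le> y i"
      and t: "t \<in> {..<n} - B" "y t + v0 \<le> r" "\<And>w. w \<in> {..<n} - B \<Longrightarrow> y w \<le> y t"
      and b: "\<And>w. w \<in> B \<Longrightarrow> y w + c w \<le> r" for E y t r
  proof (cases "j \<in> Range E")
    case False
    then show ?thesis using no_j[OF E False] X_no_j[OF False] y[of t] t by force
  next
    case True
    then obtain w where w: "(w, j) \<in> E" by auto
    then have "w < n" using E by (auto simp: feasible_def)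
    then show ?thesis
      using X_j[OF E w, of y] c[OF E w] no_j[OF feasible_subset[OF E] j_removed[OF E w]]
        b[of w] t(2) t(3)[of w]
      by (cases "w \<in> B") force+
  qed
  have "\<exists>G \<subseteq> {..<n} - B. k \<le> card G \<and>
      (\<forall>y. (\<forall>i<n. 0 \<le> y i) \<longrightarrow> (\<forall>i\<in>B. y i = u i) \<longrightarrow> second_highest G y \<le> item_price n m C (X y) j)"
    for u
  proof -
    \<comment> \<open>Here \<open>t\<close> joins \<open>E0\<close> and wins \<open>j\<close> alone.
      With \<open>j\<close> removed her bundle is empty, so nobody is needed to absorb a rest and
      every other member of \<open>G\<close> is an idle loser.\<close>
    have top_outside: "second_highest G y \<le> item_price n m C (X y) j"
      if G: "G \<subseteq> {..<n} - B" "G \<noteq> {}" and y: "\<And>i. i < n \<Longrightarrow> 0 \<le> y i"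
        and t: "t \<in> {..<n} - B" "\<And>w. w \<in> {..<n} - B \<Longrightarrow> y w \<le> y t"
        and b: "\<And>w. w \<in> B \<Longrightarrow> y w + c w \<le> y t + v0" for G y t
    proof -
      let ?E = "insert (t, j) E0"
      have feas: "feasible n m C ?E"
        using t j E0 by (intro feasible_insert) (auto simp: B_def)
      have "assigned_value (X y) ?E = y t + v0"
        using E0(1,2) t feasible_finite[OF E0(1)] X_no_j[of E0 y]
        by (subst assigned_value_insert) (auto simp: B_def v0_def X_def)
      then have opt: "optimal n m C (X y) ?E"
        using upper[OF _ y t(1) _ t(2) b] feas unfolding optimal_iff by auto
      have row: "?E `` {t} = {j}" using t by (auto simp: B_def)
      have "y l \<le> loser_price n m C (X y) ?E t j" if "l \<in> G" "l \<noteq> t" for l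
      proof -
        have "X y l j \<le> loser_price n m C (X y) ?E t j"
        proof (rule loser_price_ge[OF feas _ feasible_empty])
          show "assigned_value (X y) {}
              = best_value n m C (X y) ({..<n} - Domain ?E) (?E `` {t} - {j})"
            unfolding row by (simp add: best_value_empty)
        qed (use that G in \<open>auto simp: B_def\<close>)
        then show ?thesis by (simp add: X_def)
      qed
      then have "second_highest G y \<le> loser_price n m C (X y) ?E t j"
        using G finite_subset[OF G(1)] loser_price_nonneg by (intro second_highest_leI[of _ _ t]) auto
      also have "\<dots> \<le> item_price n m C (X y) j"
        by (rule item_price_ge[OF opt]) simp
      finally show ?thesis .
    qed
    have top: "\<exists>t\<in>{..<n} - B. \<forall>w\<in>{..<n} - B. y w \<le> y t" for y :: "nat \<Rightarrow> real"
    proof -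
      have "card ({..<n} - B) \<noteq> 0" using n_card k m_pos by linarith
      then have "{..<n} - B \<noteq> {}" by (metis card.empty)
      then have "Max (y ` ({..<n} - B)) \<in> y ` ({..<n} - B)" by (intro Max_in) auto
      then obtain t where "t \<in> {..<n} - B" "y t = Max (y ` ({..<n} - B))" by auto
      then show ?thesis by (intro bexI[of _ t]) auto
    qed
    show ?thesis
    \<comment> \<open>With \<open>B\<close> empty there is no rival \<open>b\<close>:
      \<open>t\<close> wins for every \<open>y\<close>, and all bidders are fresh.\<close>
    proof (cases "B = {}")
      case True
      show ?thesis
      proof (intro exI[of _ "{..<n} - B"] conjI allI impI)
        fix y :: "nat \<Rightarrow> real" assume y: "\<forall>i<n. 0 \<le> y i"
        obtain t where "t \<in> {..<n} - B" "\<And>w. w \<in> {..<n} - B \<Longrightarrow> y w \<le> y t" using top[of y] by blast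
        then show "second_highest ({..<n} - B) y \<le> item_price n m C (X y) j"
          using y True by (intro top_outside[of _ y t]) auto
      qed (use n_card m_pos in auto)
    next
      case False
      \<comment> \<open>On \<open>B\<close> the values \<open>y\<close> agree with \<open>u\<close>,
        so \<open>b\<close>, and with it \<open>Ew b\<close>, \<open>D\<close> and \<open>G\<close>
        below, is determined by \<open>u\<close>.\<close>
      define b where "b = arg_max_on (\<lambda>b. u b + c b) B"
      have b: "b \<in> B" "\<And>w. w \<in> B \<Longrightarrow> u w + c w \<le> u b + c b"
        using arg_max_on_finite[OF finB False, of "\<lambda>b. u b + c b"] finB by (auto simp: b_def)
      have bn: "b < n" using b B by auto
      let ?L = "{..<n} - Domain (Ew b)" and ?S = "Ew b `` {b}"
      obtain D where D: "feasible n m C D" "D \<subseteq> ?L \<times> (?S - {j})"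
          "assigned_value x D = best_value n m C x ?L (?S - {j})"
        by (rule best_value_attained)
      define G where "G = {..<n} - B - Domain (Ew b) - Domain D"
      have finS: "finite ?S" using feasible_finite[OF Ew(1)[OF bn]] by auto
      have S_sub: "?S \<subseteq> {..<m}" "j \<in> ?S" using Ew[OF bn] by (auto simp: feasible_def)
      \<comment> \<open>Bidders served besides \<open>b\<close> share the items outside
        \<open>?S\<close>, at most \<open>m - card ?S\<close> of them, while \<open>D\<close> serves
        at most \<open>card ?S - 1\<close>. So at most m - 1 of the k + m - 1 bidders outside
        \<open>B\<close> are excluded from \<open>G\<close>; \<open>b\<close> herself is in
        \<open>B\<close> already.\<close>
      have "card (Domain (Ew b) - {b}) \<le> card ({..<m} - ?S)"
      proof -
        have "Domain (Ew b) - {b} = Domain (Ew b - {b} \<times> UNIV)" by auto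
        moreover have "Range (Ew b - {b} \<times> UNIV) \<subseteq> {..<m} - ?S"
          using Ew(1)[OF bn] by (fastforce simp: feasible_def inj_on_def)
        ultimately show ?thesis
          using card_Domain_le[OF feasible_subset[OF Ew(1)[OF bn]], of "Ew b - {b} \<times> UNIV"] by simp
      qed
      then have c1: "card (Domain (Ew b) - {b}) \<le> m - card ?S"
        using S_sub finS by (simp add: card_Diff_subset)
      have c2: "card (Domain D) \<le> card ?S - 1"
        using card_Domain_le[OF D(1), of "?S - {j}"] D(2) finS S_sub by auto
      have c3: "card ?S \<le> m" "1 \<le> card ?S"
        using card_mono[OF _ S_sub(1)] card_gt_0_iff[of ?S] finS S_sub(2) by (auto simp: Suc_le_eq)
      have "card ({..<n} - B) - card ((Domain (Ew b) - {b}) \<union> Domain D)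
          \<le> card ({..<n} - B - ((Domain (Ew b) - {b}) \<union> Domain D))"
        using feasible_finite[OF Ew(1)[OF bn]] feasible_finite[OF D(1)]
        by (intro diff_card_le_card_Diff finite_UnI finite_Diff finite_Domain)
      also have "{..<n} - B - ((Domain (Ew b) - {b}) \<union> Domain D) = G"
        using b by (auto simp: G_def)
      finally have cardG: "k \<le> card G"
        using n_card c1 c2 c3 card_Un_le[of "Domain (Ew b) - {b}" "Domain D"] by linarith
      have Gne: "G \<noteq> {}" using cardG k by auto
      show ?thesis
      proof (intro exI[of _ G] conjI allI impI cardG)
        show "G \<subseteq> {..<n} - B" by (auto simp: G_def)
        fix y :: "nat \<Rightarrow> real" assume y: "\<forall>i<n. 0 \<le> y i" and yu: "\<forall>i\<in>B. y i = u i"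
        obtain t where t: "t \<in> {..<n} - B" "\<And>w. w \<in> {..<n} - B \<Longrightarrow> y w \<le> y t"
          using top[of y] by blast
        show "second_highest G y \<le> item_price n m C (X y) j"
        \<comment> \<open>The same \<open>G\<close> has to work in both cases, since which of them
          occurs depends on the fresh values.\<close>
        proof (cases "u b + c b \<le> y t + v0")
          case True
          then show ?thesis
            using y yu b t order_trans[OF b(2) True] Gne
            by (intro top_outside[of _ y t]) (auto simp: G_def)
        next
          case False
          have "assigned_value (X y) (Ew b) = u b + c b"
            using X_j[OF Ew[OF bn], of y] b yu by (simp add: c_def)
          have "assigned_value (X y) E' \<le> u b + c b" if "feasible n m C E'" for E'
            using that y yu b(2) t False by (intro upper[of E' y t]) auto
          then have opt: "optimal n m C (X y) (Ew b)"
            using Ew[OF bn] \<open>assigned_value (X y) (Ew b) = u b + c b\<close>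
            unfolding optimal_iff by simp
          have "y l \<le> loser_price n m C (X y) (Ew b) b j" if "l \<in> G" for l
          proof -
            \<comment> \<open>Item \<open>j\<close> is absent here, so \<open>D\<close>, chosen for
              \<open>x\<close> before \<open>y\<close> was fixed, stays optimal for
              \<open>X y\<close>.\<close>
            have "best_value n m C (X y) ?L (?S - {j}) = best_value n m C x ?L (?S - {j})"
              unfolding best_value_def
              by (intro arg_cong[where f = Max] image_cong refl X_no_j) auto
            then have "X y l j \<le> loser_price n m C (X y) (Ew b) b j"
              using D X_no_j[of D y] that
              by (intro loser_price_ge[OF Ew(1)[OF bn] Ew(2)[OF bn] D(1,2)]) (auto simp: G_def)
            then show ?thesis by (simp add: X_def)
          qed
          then have "second_highest G y \<le> loser_price n m C (X y) (Ew b) b j"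
            using Gne loser_price_nonneg
            by (intro second_highest_leI[of _ _ b]) (auto simp: G_def)
          also have "\<dots> \<le> item_price n m C (X y) j"
            by (rule item_price_ge[OF opt Ew(2)[OF bn]])
          finally show ?thesis .
        qed
      qed
    qed
  qed
  then show ?thesis
    using that[OF B] by (simp add: X_def)
qed

end

section \<open>Product measures and mixtures\<close>

text \<open>Applying \<open>f\<close> in every coordinate to independent draws from \<open>A\<close>
  and \<open>B\<close> gives independent draws from \<open>C\<close>: the indicator of a box is a
  product over the coordinates, so both integrals factor. It serves for drawing set systems on top
  of values and for redrawing one item.\<close>

lemma distr_PiM_pair:
  assumes I: "finite I"
    and A: "prob_space A" and B: "prob_space B"
    and f[measurable]: "f \<in> A \<Otimes>\<^sub>M B \<rightarrow>\<^sub>M C" and C: "distr (A \<Otimes>\<^sub>M B) C f = C"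
  shows "distr (PiM I (\<lambda>_. A) \<Otimes>\<^sub>M PiM I (\<lambda>_. B)) (PiM I (\<lambda>_. C)) (\<lambda>(a, b). \<lambda>i\<in>I. f (a i, b i))
    = PiM I (\<lambda>_. C)"
proof -
  interpret A: prob_space A by fact
  interpret B: prob_space B by fact
  interpret AB: pair_prob_space A B ..
  interpret C: prob_space C
    using AB.prob_space_distr[OF f] C by simp
  interpret PA: product_prob_space "\<lambda>_. A" I by unfold_locales
  interpret PB: product_prob_space "\<lambda>_. B" I by unfold_locales
  interpret PC: product_prob_space "\<lambda>_. C" I by unfold_locales
  interpret PAB: pair_prob_space "PiM I (\<lambda>_. A)" "PiM I (\<lambda>_. B)" ..
  have meas[measurable]: "(\<lambda>(a, b). \<lambda>i\<in>I. f (a i, b i))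
      \<in> PiM I (\<lambda>_. A) \<Otimes>\<^sub>M PiM I (\<lambda>_. B) \<rightarrow>\<^sub>M PiM I (\<lambda>_. C)"
    by measurable
  show ?thesis
  proof (rule PC.PiM_eqI[OF I])
    fix E assume E: "\<And>i. i \<in> I \<Longrightarrow> E i \<in> sets C"
    have [measurable]: "Pi\<^sub>E I E \<in> sets (PiM I (\<lambda>_. C))"
      using E I by (intro sets_PiM_I_finite) auto
    have comp: "(\<lambda>p. indicator (E i) (f p) :: ennreal) \<in> borel_measurable (A \<Otimes>\<^sub>M B)" if "i \<in> I" for i
      using E[OF that] by measurable
    have "emeasure (distr (PiM I (\<lambda>_. A) \<Otimes>\<^sub>M PiM I (\<lambda>_. B)) (PiM I (\<lambda>_. C))
        (\<lambda>(a, b). \<lambda>i\<in>I. f (a i, b i))) (Pi\<^sub>E I E)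
      = (\<integral>\<^sup>+p. indicator (Pi\<^sub>E I E) (case p of (a, b) \<Rightarrow> \<lambda>i\<in>I. f (a i, b i))
          \<partial>(PiM I (\<lambda>_. A) \<Otimes>\<^sub>M PiM I (\<lambda>_. B)))"
      by (subst nn_integral_indicator[symmetric], simp) (rule nn_integral_distr, measurable)
    also have "\<dots> = (\<integral>\<^sup>+a. \<integral>\<^sup>+b. indicator (Pi\<^sub>E I E) (\<lambda>i\<in>I. f (a i, b i))
        \<partial>PiM I (\<lambda>_. B) \<partial>PiM I (\<lambda>_. A))"
      by (subst PB.nn_integral_fst[symmetric]) simp_all
    also have "\<dots> = (\<integral>\<^sup>+a. \<integral>\<^sup>+b. (\<Prod>i\<in>I. indicator (E i) (f (a i, b i)))
        \<partial>PiM I (\<lambda>_. B) \<partial>PiM I (\<lambda>_. A))"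
    proof -
      have "indicator (Pi\<^sub>E I E) (\<lambda>i\<in>I. f (a i, b i)) = (\<Prod>i\<in>I. indicator (E i) (f (a i, b i)) :: ennreal)"
        for a b
        using I by (auto simp: indicator_def PiE_iff prod_zero_iff split: if_splits)
      then show ?thesis by simp
    qed
    also have "\<dots> = (\<integral>\<^sup>+a. (\<Prod>i\<in>I. \<integral>\<^sup>+b. indicator (E i) (f (a i, b)) \<partial>B) \<partial>PiM I (\<lambda>_. A))"
    proof (intro nn_integral_cong)
      fix a assume "a \<in> space (PiM I (\<lambda>_. A))"
      then have "a i \<in> space A" if "i \<in> I" for i
        using that by (auto simp: space_PiM)
      then have "(\<lambda>b. indicator (E i) (f (a i, b)) :: ennreal) \<in> borel_measurable B" if "i \<in> I" for i
        using measurable_compose[OF measurable_Pair1' comp] that by fastforce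
      then show "(\<integral>\<^sup>+b. (\<Prod>i\<in>I. indicator (E i) (f (a i, b i))) \<partial>PiM I (\<lambda>_. B))
          = (\<Prod>i\<in>I. \<integral>\<^sup>+b. indicator (E i) (f (a i, b)) \<partial>B)"
        by (rule PB.product_nn_integral_prod[OF I])
    qed
    also have "\<dots> = (\<Prod>i\<in>I. \<integral>\<^sup>+a. \<integral>\<^sup>+b. indicator (E i) (f (a, b)) \<partial>B \<partial>A)"
      using comp by (intro PA.product_nn_integral_prod[OF I] B.borel_measurable_nn_integral_fst) simp
    also have "\<dots> = (\<Prod>i\<in>I. emeasure C (E i))"
    proof (intro prod.cong refl)
      fix i assume i: "i \<in> I"
      have "(\<integral>\<^sup>+a. \<integral>\<^sup>+b. indicator (E i) (f (a, b)) \<partial>B \<partial>A) = (\<integral>\<^sup>+p. indicator (E i) (f p) \<partial>(A \<Otimes>\<^sub>M B))"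
        by (rule B.nn_integral_fst[OF comp[OF i]])
      also have "\<dots> = (\<integral>\<^sup>+c. indicator (E i) c \<partial>distr (A \<Otimes>\<^sub>M B) C f)"
        using E[OF i] by (intro nn_integral_distr[symmetric]) auto
      finally show "(\<integral>\<^sup>+a. \<integral>\<^sup>+b. indicator (E i) (f (a, b)) \<partial>B \<partial>A) = emeasure C (E i)"
        using E[OF i] by (simp add: C)
    qed
    finally show "emeasure (distr (PiM I (\<lambda>_. A) \<Otimes>\<^sub>M PiM I (\<lambda>_. B)) (PiM I (\<lambda>_. C))
        (\<lambda>(a, b). \<lambda>i\<in>I. f (a i, b i))) (Pi\<^sub>E I E) = (\<Prod>i\<in>I. emeasure C (E i))" .
  qed simp
qed

lemma nn_integral_PiM_pair:
  assumes I: "finite I"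
    and A: "prob_space A" and B: "prob_space B"
    and f[measurable]: "f \<in> A \<Otimes>\<^sub>M B \<rightarrow>\<^sub>M C" and C: "distr (A \<Otimes>\<^sub>M B) C f = C"
    and h[measurable]: "h \<in> borel_measurable (PiM I (\<lambda>_. C))"
  shows "(\<integral>\<^sup>+c. h c \<partial>PiM I (\<lambda>_. C))
    = (\<integral>\<^sup>+a. \<integral>\<^sup>+b. h (\<lambda>i\<in>I. f (a i, b i)) \<partial>PiM I (\<lambda>_. B) \<partial>PiM I (\<lambda>_. A))"
proof -
  interpret B: prob_space B by fact
  interpret PB: product_prob_space "\<lambda>_. B" I by unfold_locales
  have "(\<integral>\<^sup>+c. h c \<partial>PiM I (\<lambda>_. C)) = (\<integral>\<^sup>+p. h (case p of (a, b) \<Rightarrow> \<lambda>i\<in>I. f (a i, b i))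
          \<partial>(PiM I (\<lambda>_. A) \<Otimes>\<^sub>M PiM I (\<lambda>_. B)))"
    by (subst distr_PiM_pair[OF I A B f C, symmetric], rule nn_integral_distr) measurable
  also have "\<dots> = (\<integral>\<^sup>+a. \<integral>\<^sup>+b. h (\<lambda>i\<in>I. f (a i, b i)) \<partial>PiM I (\<lambda>_. B) \<partial>PiM I (\<lambda>_. A))"
    by (subst PB.nn_integral_fst[symmetric]) simp_all
  finally show ?thesis .
qed

lemma nn_integral_PiM_distr:
  assumes "finite I" "prob_space A" and f[measurable]: "f \<in> A \<rightarrow>\<^sub>M C"
    and h[measurable]: "h \<in> borel_measurable (PiM I (\<lambda>_. C))"
  shows "(\<integral>\<^sup>+c. h c \<partial>PiM I (\<lambda>_. distr A C f)) = (\<integral>\<^sup>+a. h (\<lambda>i\<in>I. f (a i)) \<partial>PiM I (\<lambda>_. A))"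
proof -
  have f': "f \<in> A \<rightarrow>\<^sub>M distr A C f" by simp
  have "PiM I (\<lambda>_. distr A C f) = distr (PiM I (\<lambda>_. A)) (PiM I (\<lambda>_. distr A C f)) (compose I f)"
    using assms
    by (subst distr_PiM_finite_prob_space')
       (auto intro!: prob_space.prob_space_distr PiM_cong distr_cong)
  then have "(\<integral>\<^sup>+c. h c \<partial>PiM I (\<lambda>_. distr A C f))
      = (\<integral>\<^sup>+c. h c \<partial>distr (PiM I (\<lambda>_. A)) (PiM I (\<lambda>_. distr A C f)) (compose I f))"
    by simp
  also have "\<dots> = (\<integral>\<^sup>+a. h (compose I f a) \<partial>PiM I (\<lambda>_. A))"
  proof (rule nn_integral_distr)
    show "compose I f \<in> PiM I (\<lambda>_. A) \<rightarrow>\<^sub>M PiM I (\<lambda>_. distr A C f)"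
      unfolding compose_def using f' by measurable
    have "sets (PiM I (\<lambda>_. distr A C f)) = sets (PiM I (\<lambda>_. C))"
      by (intro sets_PiM_cong) auto
    then show "h \<in> borel_measurable (distr (PiM I (\<lambda>_. A)) (PiM I (\<lambda>_. distr A C f)) (compose I f))"
      using h by (simp cong: measurable_cong_sets)
  qed
  finally show ?thesis by (simp add: compose_def)
qed

text \<open>Overwriting one coordinate by an independent draw from its marginal does not change a
  product measure; it suffices to check boxes.\<close>

lemma distr_PiM_fun_upd:
  assumes I: "finite I" "j \<in> I" and D: "\<And>i. prob_space (D i)"
  shows "(\<lambda>(x, y). x(j := y)) \<in> PiM I D \<Otimes>\<^sub>M D j \<rightarrow>\<^sub>M PiM I D"
    and "distr (PiM I D \<Otimes>\<^sub>M D j) (PiM I D) (\<lambda>(x, y). x(j := y)) = PiM I D"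
proof -
  interpret D: product_prob_space D I
    by (intro product_prob_spaceI D)
  interpret Dj: prob_space "D j" by (rule D)
  interpret J: pair_prob_space "PiM I D" "D j" ..
  show meas: "(\<lambda>(x, y). x(j := y)) \<in> PiM I D \<Otimes>\<^sub>M D j \<rightarrow>\<^sub>M PiM I D"
    using I unfolding split_beta' by (intro measurable_fun_upd[where J = I]) auto
  show "distr (PiM I D \<Otimes>\<^sub>M D j) (PiM I D) (\<lambda>(x, y). x(j := y)) = PiM I D"
  proof (rule D.PiM_eqI[OF I(1)])
    fix E assume E: "\<And>i. i \<in> I \<Longrightarrow> E i \<in> sets (D i)"
    \<comment> \<open>The old value of coordinate \<open>j\<close> is forgotten, so it is
      unconstrained in the preimage of the box.\<close>
    define E' where "E' = E(j := space (D j))"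
    have E': "E' i \<in> sets (D i)" if "i \<in> I" for i using E that by (simp add: E'_def)
    have "(\<lambda>(x, y). x(j := y)) -` Pi\<^sub>E I E \<inter> space (PiM I D \<Otimes>\<^sub>M D j) = Pi\<^sub>E I E' \<times> E j"
    proof (intro set_eqI iffI)
      fix p assume "p \<in> (\<lambda>(x, y). x(j := y)) -` Pi\<^sub>E I E \<inter> space (PiM I D \<Otimes>\<^sub>M D j)"
      then show "p \<in> Pi\<^sub>E I E' \<times> E j"
        using I by (cases p) (fastforce simp: PiE_iff E'_def space_pair_measure space_PiM extensional_def split: if_splits)
    next
      fix p assume p: "p \<in> Pi\<^sub>E I E' \<times> E j"
      then show "p \<in> (\<lambda>(x, y). x(j := y)) -` Pi\<^sub>E I E \<inter> space (PiM I D \<Otimes>\<^sub>M D j)"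
        using I E[THEN sets.sets_into_space] E'[THEN sets.sets_into_space]
        by (cases p) (fastforce simp: PiE_iff E'_def space_pair_measure space_PiM extensional_def split: if_splits)
    qed
    then have "emeasure (distr (PiM I D \<Otimes>\<^sub>M D j) (PiM I D) (\<lambda>(x, y). x(j := y))) (Pi\<^sub>E I E)
        = emeasure (PiM I D \<Otimes>\<^sub>M D j) (Pi\<^sub>E I E' \<times> E j)"
      using E I by (subst emeasure_distr[OF meas]) (auto intro!: sets_PiM_I_finite)
    also have "\<dots> = (\<Prod>i\<in>I. emeasure (D i) (E' i)) * emeasure (D j) (E j)"
      using E E' I by (subst D.M.emeasure_pair_measure_Times) (auto intro!: sets_PiM_I_finite simp: D.emeasure_PiM)
    also have "(\<Prod>i\<in>I. emeasure (D i) (E' i)) = (\<Prod>i\<in>I - {j}. emeasure (D i) (E i))"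
      using I by (subst prod.remove[of _ j]) (auto simp: E'_def D.M.emeasure_space_1 intro!: prod.cong)
    also have "\<dots> * emeasure (D j) (E j) = (\<Prod>i\<in>I. emeasure (D i) (E i))"
      using I by (subst (2) prod.remove[of _ j]) (auto simp: mult.commute)
    finally show "emeasure (distr (PiM I D \<Otimes>\<^sub>M D j) (PiM I D) (\<lambda>(x, y). x(j := y))) (Pi\<^sub>E I E)
        = (\<Prod>i\<in>I. emeasure (D i) (E i))" .
  qed simp
qed

lemma nn_integral_PiM_resample:
  assumes "finite I" "j \<in> I" "\<And>i. prob_space (D i)" and h[measurable]: "h \<in> borel_measurable (PiM I D)"
  shows "(\<integral>\<^sup>+x. h x \<partial>PiM I D) = (\<integral>\<^sup>+x. \<integral>\<^sup>+y. h (x(j := y)) \<partial>D j \<partial>PiM I D)"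
proof -
  interpret Dj: prob_space "D j" by fact
  note upd = distr_PiM_fun_upd[of I j D, OF assms(1-3)]
  have meas: "(\<lambda>p. h (case p of (x, y) \<Rightarrow> x(j := y))) \<in> borel_measurable (PiM I D \<Otimes>\<^sub>M D j)"
    by (rule measurable_compose[OF upd(1) h])
  have "(\<integral>\<^sup>+x. h x \<partial>PiM I D)
      = (\<integral>\<^sup>+x. h x \<partial>distr (PiM I D \<Otimes>\<^sub>M D j) (PiM I D) (\<lambda>(x, y). x(j := y)))"
    by (simp add: upd(2))
  also have "\<dots> = (\<integral>\<^sup>+p. h (case p of (x, y) \<Rightarrow> x(j := y)) \<partial>(PiM I D \<Otimes>\<^sub>M D j))"
    by (rule nn_integral_distr[OF upd(1)]) (simp add: h)
  also have "\<dots> = (\<integral>\<^sup>+x. \<integral>\<^sup>+y. h (x(j := y)) \<partial>D j \<partial>PiM I D)"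
    by (subst Dj.nn_integral_fst[OF meas, symmetric]) simp
  finally show ?thesis .
qed

text \<open>Hypothesis \<open>eq\<close> says that the law of \<open>g\<close> is the mixture, with
  weights \<open>w\<close>, of the laws of the \<open>f a\<close>. It is stated for nonnegative test
  functions; utilities have both signs, so positive and negative parts are transferred
  separately.\<close>

lemma integral_mixture:
  fixes g :: "'a \<Rightarrow> real" and f :: "'b \<Rightarrow> 'c \<Rightarrow> real" and w :: "'b \<Rightarrow> real"
  assumes g: "g \<in> borel_measurable N"
    and w: "\<And>a. a \<in> A \<Longrightarrow> 0 \<le> w a" and f: "\<And>a. a \<in> A \<Longrightarrow> integrable (K a) (f a)"
    and eq: "\<And>k :: real \<Rightarrow> ennreal. k \<in> borel_measurable borel \<Longrightarrow>
      (\<integral>\<^sup>+x. k (g x) \<partial>N) = (\<Sum>a\<in>A. (\<integral>\<^sup>+x. k (f a x) \<partial>K a) * ennreal (w a))"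
  shows "integrable N g" "integral\<^sup>L N g = (\<Sum>a\<in>A. integral\<^sup>L (K a) (f a) * w a)"
proof -
  have fin: "(\<integral>\<^sup>+x. ennreal (norm (f a x)) \<partial>K a) < \<infinity>" if "a \<in> A" for a
    using f[OF that] unfolding integrable_iff_bounded by simp
  have le: "(\<integral>\<^sup>+x. ennreal (s * f a x) \<partial>K a) < \<infinity>" if "a \<in> A" "s \<in> {1, -1}" for a s
    by (rule order_le_less_trans[OF nn_integral_mono fin[OF that(1)]])
       (use that in \<open>auto intro!: ennreal_leI\<close>)
  have "(\<integral>\<^sup>+x. ennreal (norm (g x)) \<partial>N)
      = (\<Sum>a\<in>A. (\<integral>\<^sup>+x. ennreal (norm (f a x)) \<partial>K a) * ennreal (w a))"
    using eq[of "\<lambda>t. ennreal (norm t)"] by simp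
  also have "\<dots> < \<infinity>"
    using fin by (cases "finite A") (auto simp: ennreal_mult_less_top)
  finally show int: "integrable N g"
    using g by (simp add: integrable_iff_bounded)
  have part: "enn2real (\<integral>\<^sup>+x. ennreal (s * g x) \<partial>N)
      = (\<Sum>a\<in>A. enn2real (\<integral>\<^sup>+x. ennreal (s * f a x) \<partial>K a) * w a)" if s: "s \<in> {1, -1}" for s
  proof -
    have "(\<integral>\<^sup>+x. ennreal (s * g x) \<partial>N)
        = (\<Sum>a\<in>A. (\<integral>\<^sup>+x. ennreal (s * f a x) \<partial>K a) * ennreal (w a))"
      using eq[of "\<lambda>t. ennreal (s * t)"] by simp
    also have "enn2real \<dots>
        = (\<Sum>a\<in>A. enn2real ((\<integral>\<^sup>+x. ennreal (s * f a x) \<partial>K a) * ennreal (w a)))"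
      using le[OF _ s] by (subst enn2real_sum) (auto simp: ennreal_mult_less_top)
    also have "\<dots> = (\<Sum>a\<in>A. enn2real (\<integral>\<^sup>+x. ennreal (s * f a x) \<partial>K a) * w a)"
      using w by (intro sum.cong refl) (simp add: enn2real_mult)
    finally show ?thesis .
  qed
  have "integral\<^sup>L N g = enn2real (\<integral>\<^sup>+x. ennreal (1 * g x) \<partial>N) - enn2real (\<integral>\<^sup>+x. ennreal (-1 * g x) \<partial>N)"
    by (simp add: real_lebesgue_integral_def[OF int])
  also have "\<dots> = (\<Sum>a\<in>A. (enn2real (\<integral>\<^sup>+x. ennreal (1 * f a x) \<partial>K a)
      - enn2real (\<integral>\<^sup>+x. ennreal (-1 * f a x) \<partial>K a)) * w a)"
    by (simp only: part insert_iff simp_thms left_diff_distrib sum_subtractf)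
  also have "\<dots> = (\<Sum>a\<in>A. integral\<^sup>L (K a) (f a) * w a)"
    using f by (intro sum.cong refl) (simp add: real_lebesgue_integral_def)
  finally show "integral\<^sup>L N g = (\<Sum>a\<in>A. integral\<^sup>L (K a) (f a) * w a)" .
qed

lemma nn_integral_weighted_sum:
  fixes w :: "'b \<Rightarrow> ennreal"
  assumes "\<And>a. a \<in> A \<Longrightarrow> f a \<in> borel_measurable M"
  shows "(\<integral>\<^sup>+x. (\<Sum>a\<in>A. f a x * w a) \<partial>M) = (\<Sum>a\<in>A. (\<integral>\<^sup>+x. f a x \<partial>M) * w a)"
  using assms by (subst nn_integral_sum) (auto intro!: sum.cong nn_integral_multc)

section \<open>Measurability\<close>

lemma measurable_Max_insert_0:
  fixes f :: "'a \<Rightarrow> 'i \<Rightarrow> real"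
  assumes "finite A" "\<And>i. i \<in> A \<Longrightarrow> (\<lambda>w. f w i) \<in> borel_measurable M"
  shows "(\<lambda>w. Max (insert 0 (f w ` A))) \<in> borel_measurable M"
proof (cases "A = {}")
  case False
  have "(\<lambda>w. Max (insert 0 (f w ` A))) = (\<lambda>w. max 0 (Max ((\<lambda>i. f w i) ` A)))"
    using assms False by (intro ext Max_insert) auto
  then show ?thesis
    using assms borel_measurable_Max[of A "\<lambda>i w. f w i" M] by simp
qed simp

lemma measurable_second_highest:
  assumes "finite S" "\<And>i. i \<in> S \<Longrightarrow> (\<lambda>w. y w i) \<in> borel_measurable M"
  shows "(\<lambda>w. second_highest S (y w)) \<in> borel_measurable M"
  unfolding second_highest_def using assms
  by (intro borel_measurable_Min measurable_Max_insert_0) auto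

definition mean_second_highest :: "nat \<Rightarrow> real measure \<Rightarrow> ennreal" where
  "mean_second_highest k D = (\<integral>\<^sup>+y. ennreal (second_highest {..<k} y) \<partial>PiM {..<k} (\<lambda>_. D))"

text \<open>Any k members of \<open>G\<close> have i.i.d. values, and the second-highest value only
  grows with the set of bidders.\<close>

lemma mean_second_highest_le:
  assumes D: "prob_space D" "sets D = sets borel" and G: "finite J" "G \<subseteq> J" "k \<le> card G" "0 < k"
  shows "mean_second_highest k D \<le> (\<integral>\<^sup>+y. ennreal (second_highest G y) \<partial>PiM J (\<lambda>_. D))"
proof -
  obtain G0 where G0: "G0 \<subseteq> G" "card G0 = k" "finite G0"
    using G obtain_subset_with_card_n by blast
  then obtain h where h: "bij_betw h {..<k} G0"
    using ex_bij_betw_nat_finite[of G0] by (auto simp: atLeast0LessThan)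
  have inj: "inj_on h {..<k}" and im: "h ` {..<k} = G0"
    using h by (auto simp: bij_betw_def)
  have hJ: "h \<in> {..<k} \<rightarrow> J" using im G0 G by auto
  have finG: "finite G" using G finite_subset by auto
  have "PiM {..<k} (\<lambda>_. D)
      = distr (PiM J (\<lambda>_. D)) (PiM {..<k} (\<lambda>_. D)) (\<lambda>w. \<lambda>i\<in>{..<k}. w (h i))"
    using distr_PiM_reindex[OF _ inj hJ, of "\<lambda>_. D"] D by simp
  then have "mean_second_highest k D
      = (\<integral>\<^sup>+y. ennreal (second_highest {..<k} y)
          \<partial>distr (PiM J (\<lambda>_. D)) (PiM {..<k} (\<lambda>_. D)) (\<lambda>w. \<lambda>i\<in>{..<k}. w (h i)))"
    by (simp add: mean_second_highest_def)
  also have "\<dots> = (\<integral>\<^sup>+w. ennreal (second_highest {..<k} (\<lambda>i\<in>{..<k}. w (h i))) \<partial>PiM J (\<lambda>_. D))"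
  proof (rule nn_integral_distr)
    show "(\<lambda>w. \<lambda>i\<in>{..<k}. w (h i)) \<in> PiM J (\<lambda>_. D) \<rightarrow>\<^sub>M PiM {..<k} (\<lambda>_. D)"
      using hJ by (intro measurable_restrict measurable_component_singleton) auto
    have "(\<lambda>w. w i) \<in> borel_measurable (PiM {..<k} (\<lambda>_. D))" if "i < k" for i
      using measurable_component_singleton[of i "{..<k}" "\<lambda>_. D"] that D(2)
      by (simp cong: measurable_cong_sets)
    then show "(\<lambda>y. ennreal (second_highest {..<k} y))
        \<in> borel_measurable (distr (PiM J (\<lambda>_. D)) (PiM {..<k} (\<lambda>_. D)) (\<lambda>w. \<lambda>i\<in>{..<k}. w (h i)))"
      unfolding measurable_distr_eq1
      by (intro measurable_compose[OF _ measurable_ennreal] measurable_second_highest) auto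
  qed
  also have "\<dots> = (\<integral>\<^sup>+w. ennreal (second_highest G0 w) \<partial>PiM J (\<lambda>_. D))"
    unfolding im[symmetric] second_highest_reindex[OF inj]
    by (intro nn_integral_cong arg_cong[where f = ennreal] second_highest_cong) auto
  also have "\<dots> \<le> (\<integral>\<^sup>+y. ennreal (second_highest G y) \<partial>PiM J (\<lambda>_. D))"
    using G0 finG G by (intro nn_integral_mono ennreal_leI second_highest_mono) auto
  finally show ?thesis .
qed

text \<open>The maximizer is picked by the choice operator from the set \<open>Z w\<close> of all
  maximizers. \<open>Z\<close> takes values in the finite space \<open>Pow S\<close>, where every
  function is measurable, in particular the choice.\<close>

lemma measurable_arg_max_on:
  fixes f :: "'w \<Rightarrow> 'a \<Rightarrow> real"
  assumes S: "finite S" "S \<noteq> {}" and f: "\<And>s. s \<in> S \<Longrightarrow> (\<lambda>w. f w s) \<in> borel_measurable M"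
  shows "(\<lambda>w. arg_max_on (f w) S) \<in> M \<rightarrow>\<^sub>M count_space S"
proof -
  define Z where "Z w = {s \<in> S. \<forall>t\<in>S. f w t \<le> f w s}" for w
  have eq: "arg_max_on (f w) S = (SOME s. s \<in> Z w)" for w
    unfolding arg_max_on_def arg_max_def
    by (rule arg_cong[where f = Eps]) (auto simp: fun_eq_iff is_arg_max_linorder Z_def)
  have Z: "Z \<in> M \<rightarrow>\<^sub>M count_space (Pow S)"
  proof (subst measurable_count_space_eq2, use S in simp, intro conjI ballI)
    fix T assume "T \<in> Pow S"
    then have "Z w = T \<longleftrightarrow> (\<forall>s\<in>S. (\<forall>t\<in>S. f w t \<le> f w s) \<longleftrightarrow> s \<in> T)" for w
      unfolding Z_def by blast
    then have "Z -` {T} \<inter> space M = {w \<in> space M. \<forall>s\<in>S. (\<forall>t\<in>S. f w t \<le> f w s) \<longleftrightarrow> s \<in> T}"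
      by (simp add: vimage_def Collect_conj_eq Int_commute)
    also have "\<dots> \<in> sets M"
    proof (rule sets.sets_Collect_finite_All[OF _ S(1)])
      fix s assume "s \<in> S"
      then have max: "{w \<in> space M. \<forall>t\<in>S. f w t \<le> f w s} \<in> sets M"
        by - (rule sets.sets_Collect_finite_All[OF borel_measurable_le[OF f f] S(1)])
      then show "{w \<in> space M. (\<forall>t\<in>S. f w t \<le> f w s) \<longleftrightarrow> s \<in> T} \<in> sets M"
        using sets.sets_Collect_neg[OF max] by (cases "s \<in> T") auto
    qed
    finally show "Z -` {T} \<inter> space M \<in> sets M" .
  qed (auto simp: Z_def)
  have "(\<lambda>w. SOME s. s \<in> Z w) \<in> M \<rightarrow>\<^sub>M count_space UNIV"
    by (rule measurable_compose[OF Z]) simp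
  then have "(\<lambda>w. arg_max_on (f w) S) \<in> M \<rightarrow>\<^sub>M count_space UNIV"
    by (simp add: eq)
  then show ?thesis
    using arg_max_on_finite(1)[OF S] by (intro measurable_count_space_extend[of S UNIV]) auto
qed

section \<open>Measurability and revenue of VCG\<close>

lemma measurable_valuation_apply:
  assumes "S \<subseteq> {..<m}"
  shows "(\<lambda>v. v S) \<in> borel_measurable (valuations m)"
  unfolding valuations_def using assms by (intro measurable_component_singleton) auto

lemma measurable_bid_apply:
  assumes "i < n" "S \<subseteq> {..<m}"
  shows "(\<lambda>b. b i S) \<in> borel_measurable (PiM {..<n} (\<lambda>_. valuations m))"
  using measurable_compose[OF _ measurable_valuation_apply[OF assms(2)], of "\<lambda>b. b i"] assms(1)
  by (auto intro: measurable_component_singleton)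

lemma measurable_welfare:
  assumes "N \<subseteq> {..<n}" "A \<in> allocations n m"
  shows "(\<lambda>b. welfare N b A) \<in> borel_measurable (PiM {..<n} (\<lambda>_. valuations m))"
  unfolding welfare_def using assms
  by (intro borel_measurable_sum measurable_bid_apply) (auto simp: allocations_def)

lemma measurable_vcg_allocation:
  "vcg_allocation n m \<in> PiM {..<n} (\<lambda>_. valuations m) \<rightarrow>\<^sub>M count_space (allocations n m)"
  unfolding vcg_allocation_def
  by (intro measurable_arg_max_on finite_allocations allocations_nonempty measurable_welfare) auto

lemma measurable_vcg_payment:
  "vcg_payment n m \<in> PiM {..<n} (\<lambda>_. valuations m) \<rightarrow>\<^sub>M PiM {..<n} (\<lambda>_. borel)"
proof -
  have "(\<lambda>b. welfare N b (vcg_allocation n m b)) \<in> borel_measurable (PiM {..<n} (\<lambda>_. valuations m))"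
    if "N \<subseteq> {..<n}" for N
    using that
    by (intro measurable_compose_countable'[OF measurable_welfare measurable_vcg_allocation]
        countable_finite finite_allocations)
  moreover have "(\<lambda>b. Max (welfare N b ` allocations n m)) \<in> borel_measurable (PiM {..<n} (\<lambda>_. valuations m))"
    if "N \<subseteq> {..<n}" for N
    using that by (intro borel_measurable_Max finite_allocations measurable_welfare)
  ultimately show ?thesis
    unfolding vcg_payment_def by (intro measurable_restrict borel_measurable_diff) auto
qed

text \<open>VCG is deterministic, so binding with it is a pushforward, and its payments are
  nonnegative, so the negative part in \<open>Rev\<close> vanishes.\<close>

lemma Rev_VCG:
  assumes F: "prob_space F" "sets F = sets (valuations m)"
  shows "Rev (VCG n m) F n
    = enn2ereal (\<integral>\<^sup>+b. ennreal (\<Sum>i<n. vcg_payment n m b i) \<partial>PiM {..<n} (\<lambda>_. F))"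
proof -
  let ?P = "PiM {..<n} (\<lambda>_. F)" and ?g = "\<lambda>b. (vcg_allocation n m b, vcg_payment n m b)"
  interpret prob_space ?P by (intro prob_space_PiM F)
  have sets: "sets ?P = sets (PiM {..<n} (\<lambda>_. valuations m))"
    by (intro sets_PiM_cong) (auto simp: F)
  have g: "?g \<in> ?P \<rightarrow>\<^sub>M outcomes n m"
    using measurable_vcg_allocation measurable_vcg_payment sets
    unfolding outcomes_def measurable_cong_sets[OF sets refl] by (intro measurable_Pair)
  have VCG: "VCG n m = return (outcomes n m) \<circ> ?g"
    by (auto simp: VCG_def)
  have "truthful_outcome n F (VCG n m) = distr ?P (outcomes n m) ?g"
    unfolding truthful_outcome_def VCG by (rule bind_return_distr[OF not_empty g])
  moreover have "(\<integral>\<^sup>+(A, p). ennreal (s * (\<Sum>i<n. p i)) \<partial>distr ?P (outcomes n m) ?g)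
      = (\<integral>\<^sup>+b. ennreal (s * (\<Sum>i<n. vcg_payment n m b i)) \<partial>?P)" for s :: real
  proof (subst nn_integral_distr[OF g])
    show "(\<lambda>(A, p). ennreal (s * (\<Sum>i<n. p i))) \<in> borel_measurable (distr ?P (outcomes n m) ?g)"
      unfolding measurable_distr_eq1 outcomes_def split_beta' by measurable
  qed simp
  from this[of 1] this[of "-1"] have
    "(\<integral>\<^sup>+(A, p). ennreal (\<Sum>i<n. p i) \<partial>distr ?P (outcomes n m) ?g)
      = (\<integral>\<^sup>+b. ennreal (\<Sum>i<n. vcg_payment n m b i) \<partial>?P)"
    "(\<integral>\<^sup>+(A, p). ennreal (- (\<Sum>i<n. p i)) \<partial>distr ?P (outcomes n m) ?g)
      = (\<integral>\<^sup>+b. ennreal (- (\<Sum>i<n. vcg_payment n m b i)) \<partial>?P)"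
    by simp_all
  moreover have "(\<integral>\<^sup>+b. ennreal (- (\<Sum>i<n. vcg_payment n m b i)) \<partial>?P) = 0"
  proof -
    have "ennreal (- (\<Sum>i<n. vcg_payment n m b i)) = 0" for b
      using sum_nonneg[of "{..<n}" "vcg_payment n m b"] vcg_payment_nonneg
      by (intro ennreal_neg) simp
    then show ?thesis by simp
  qed
  ultimately show ?thesis by (simp add: Rev_def zero_ennreal.rep_eq)
qed

text \<open>Nonnegativity holds because the density vanishes outside \<open>J\<close>, a set of
  nonnegative reals. A law with a density has no atoms, which will make the optimal assignment
  almost surely unique.\<close>

lemma regular_properties:
  assumes "regular D"
  shows "prob_space D" "sets D = sets borel" "AE x in D. 0 \<le> x" "emeasure D {t} = 0"
proof -
  obtain f J where f: "f \<in> borel_measurable borel" "D = density lborel (\<lambda>x. ennreal (f x))"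
      "J \<subseteq> {0..}" "\<And>x. x \<notin> J \<Longrightarrow> f x = 0"
    using assms unfolding regular_def by blast
  show "prob_space D" using assms by (simp add: regular_def)
  show "sets D = sets borel" by (simp add: f(2))
  have [measurable]: "f \<in> borel_measurable lborel" using f(1) by simp
  have "0 \<le> x" if "0 < ennreal (f x)" for x
    using f(3,4) that by (cases "x \<in> J") auto
  then show "AE x in D. 0 \<le> x"
    unfolding f(2) by (subst AE_density) auto
  have "AE x in lborel. ennreal (f x) * indicator {t} x = 0"
    using AE_lborel_singleton[of t] by (auto simp: indicator_def)
  then show "emeasure D {t} = 0"
    unfolding f(2) by (subst emeasure_density) (simp_all add: nn_integral_0_iff_AE)
qed

lemma measurable_additive_valuation:
  assumes "\<And>j. j < m \<Longrightarrow> sets (D j) = sets borel"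
  shows "additive_valuation m \<in> PiM {..<m} D \<rightarrow>\<^sub>M valuations m"
proof -
  have "(\<lambda>x. x j) \<in> borel_measurable (PiM {..<m} D)" if "j < m" for j
    using measurable_component_singleton[of j "{..<m}" D] that assms
    by (simp cong: measurable_cong_sets)
  then show ?thesis
    unfolding additive_valuation_def valuations_def
    by (intro measurable_restrict borel_measurable_sum) auto
qed

text \<open>The family over which the maximum is taken varies with the set system, but ranges over
  the finite set \<open>Pow (Pow S)\<close>; for each fixed family the maximum is measurable in the
  values.\<close>

lemma measurable_constrained_valuation:
  assumes "\<And>j. j < m \<Longrightarrow> sets (D j) = sets borel"
  shows "(\<lambda>(\<I>, x). constrained_valuation m \<I> x)
    \<in> count_space UNIV \<Otimes>\<^sub>M PiM {..<m} D \<rightarrow>\<^sub>M valuations m"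
proof -
  let ?M = "count_space UNIV \<Otimes>\<^sub>M PiM {..<m} D :: (nat set set \<times> (nat \<Rightarrow> real)) measure"
  have comp: "(\<lambda>x. x j) \<in> borel_measurable (PiM {..<m} D)" if "j < m" for j
    using measurable_component_singleton[of j "{..<m}" D] that assms
    by (simp cong: measurable_cong_sets)
  have "(\<lambda>p. Max ((\<lambda>T. \<Sum>j\<in>T. snd p j) ` {T. T \<subseteq> S \<and> T \<in> fst p})) \<in> borel_measurable ?M"
    if S: "S \<subseteq> {..<m}" for S
  proof (rule measurable_compose_countable'[where
        f = "\<lambda>R p. Max ((\<lambda>T. \<Sum>j\<in>T. snd p j) ` R)" and
        g = "\<lambda>p. {T. T \<subseteq> S \<and> T \<in> fst p}" and I = "Pow (Pow S)"])
    have finS: "finite S" using S finite_subset by auto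
    show "(\<lambda>p. Max ((\<lambda>T. \<Sum>j\<in>T. snd p j) ` R)) \<in> borel_measurable ?M" if "R \<in> Pow (Pow S)" for R
      using that S finS
      by (intro borel_measurable_Max borel_measurable_sum measurable_compose[OF measurable_snd comp])
        (auto intro: finite_subset)
    show "(\<lambda>p. {T. T \<subseteq> S \<and> T \<in> fst p}) \<in> ?M \<rightarrow>\<^sub>M count_space (Pow (Pow S))"
      by (rule measurable_compose[OF measurable_fst]) auto
    show "countable (Pow (Pow S))" using finS by (intro countable_finite) auto
  qed
  then show ?thesis
    unfolding constrained_valuation_def valuations_def split_beta'
    by (intro measurable_restrict) auto
qed

section \<open>Expected revenue of VCG\<close>

lemma best_value_cong:
  assumes "\<And>i. i < n \<Longrightarrow> x i = x' i"
  shows "best_value n m C x N Q = best_value n m C x' N Q"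
  unfolding best_value_def using assms
  by (intro arg_cong[where f = Max] image_cong refl assigned_value_cong) (auto simp: feasible_def)

lemma item_price_cong:
  assumes "\<And>i. i < n \<Longrightarrow> x i = x' i"
  shows "item_price n m C x j = item_price n m C x' j"
proof -
  have best: "best_value n m C x N Q = best_value n m C x' N Q" for N Q
    by (intro best_value_cong assms)
  have "assigned_value x E = assigned_value x' E" if "feasible n m C E" for E
    using that assms by (intro assigned_value_cong) (auto simp: feasible_def)
  then have opt: "optimal n m C x = optimal n m C x'"
    unfolding optimal_def best by (intro ext) metis
  show ?thesis
    unfolding item_price_def loser_price_def best opt ..
qed

lemma measurable_value:
  assumes "\<And>j. j < m \<Longrightarrow> sets (D j) = sets borel" "i < n" "j < m"
  shows "(\<lambda>x. x i j) \<in> borel_measurable (PiM {..<n} (\<lambda>_. PiM {..<m} D))"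
proof -
  have "(\<lambda>x. x j) \<in> borel_measurable (PiM {..<m} D)"
    using measurable_component_singleton[of j "{..<m}" D] assms(1,3)
    by (simp cong: measurable_cong_sets)
  from measurable_compose[OF _ this, of "\<lambda>x. x i"] show ?thesis
    using assms(2) by (auto intro: measurable_component_singleton)
qed

lemma measurable_assigned_value:
  assumes "\<And>j. j < m \<Longrightarrow> sets (D j) = sets borel" "E \<subseteq> {..<n} \<times> {..<m}"
  shows "(\<lambda>x. assigned_value x E) \<in> borel_measurable (PiM {..<n} (\<lambda>_. PiM {..<m} D))"
  unfolding assigned_value_def split_beta' using assms(2)
  by (intro borel_measurable_sum measurable_value assms(1)) auto

lemma measurable_best_value:
  assumes "\<And>j. j < m \<Longrightarrow> sets (D j) = sets borel"
  shows "(\<lambda>x. best_value n m C x N Q) \<in> borel_measurable (PiM {..<n} (\<lambda>_. PiM {..<m} D))"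
  unfolding best_value_def
  by (intro borel_measurable_Max finite_feasible measurable_assigned_value assms)
     (auto simp: feasible_def)

text \<open>The sum over the varying set of optimal assignments is rewritten as a sum over all
  feasible ones, each guarded by a measurable equation between real functions.\<close>

lemma measurable_item_price:
  assumes "\<And>j. j < m \<Longrightarrow> sets (D j) = sets borel"
  shows "(\<lambda>x. item_price n m C x j) \<in> borel_measurable (PiM {..<n} (\<lambda>_. PiM {..<m} D))"
proof -
  let ?M = "PiM {..<n} (\<lambda>_. PiM {..<m} D)" and ?S = "{E. feasible n m C E \<and> True}"
  have fin: "finite ?S" by (rule finite_feasible)
  have "item_price n m C x j = (\<Sum>E\<in>?S. if assigned_value x E = best_value n m C x {..<n} {..<m}
      then \<Sum>i | (i, j) \<in> E. loser_price n m C x E i j else 0)" for x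
  proof -
    have "{E. optimal n m C x E} = {E \<in> ?S. assigned_value x E = best_value n m C x {..<n} {..<m}}"
      by (auto simp: optimal_def)
    then show ?thesis unfolding item_price_def using fin by (simp only: sum.inter_filter)
  qed
  moreover have "(\<lambda>x. \<Sum>E\<in>?S. if assigned_value x E = best_value n m C x {..<n} {..<m}
      then \<Sum>i | (i, j) \<in> E. loser_price n m C x E i j else 0) \<in> borel_measurable ?M"
  proof (rule borel_measurable_sum)
    fix E assume "E \<in> ?S"
    then have [measurable]: "(\<lambda>x. assigned_value x E) \<in> borel_measurable ?M"
      by (intro measurable_assigned_value assms) (auto simp: feasible_def)
    have [measurable]: "(\<lambda>x. best_value n m C x N Q) \<in> borel_measurable ?M" for N Q
      by (intro measurable_best_value assms)
    show "(\<lambda>x. if assigned_value x E = best_value n m C x {..<n} {..<m}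
      then \<Sum>i | (i, j) \<in> E. loser_price n m C x E i j else 0) \<in> borel_measurable ?M"
      unfolding loser_price_def by measurable
  qed
  ultimately show ?thesis by (simp cong: measurable_cong)
qed

section \<open>Integration over the values for a single item\<close>

locale value_distributions =
  fixes m :: nat and D :: "nat \<Rightarrow> real measure"
  assumes prob: "prob_space (D j)"
    and borel: "sets (D j) = sets borel"
    and nonneg: "AE x in D j. 0 \<le> x"
    and atomless: "emeasure (D j) {t} = 0"
begin

text \<open>The rigorous form of fixing all values for the other items: redrawing column
  \<open>j\<close> leaves the law of the value matrix unchanged, and in the inner integral only
  column \<open>j\<close> is random.\<close>

lemma nn_integral_resample_column:
  fixes n :: nat
  assumes j: "j < m" and h: "h \<in> borel_measurable (PiM {..<n} (\<lambda>_. PiM {..<m} D))"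
  shows "(\<integral>\<^sup>+x. h x \<partial>PiM {..<n} (\<lambda>_. PiM {..<m} D))
    = (\<integral>\<^sup>+x. \<integral>\<^sup>+y. h (\<lambda>i\<in>{..<n}. (x i)(j := y i)) \<partial>PiM {..<n} (\<lambda>_. D j)
        \<partial>PiM {..<n} (\<lambda>_. PiM {..<m} D))"
proof -
  have j': "j \<in> {..<m}" using j by simp
  show ?thesis
    using nn_integral_PiM_pair[where f = "\<lambda>(x, y). x(j := y)" and A = "PiM {..<m} D" and B = "D j"
        and C = "PiM {..<m} D" and I = "{..<n}" and h = h, OF finite_lessThan _ prob _ _ h]
      distr_PiM_fun_upd[OF finite_lessThan j', of D] prob prob_space_PiM[of "{..<m}" D]
    unfolding prod.case by blast
qed

lemma measurable_replace_column:
  fixes n :: nat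
  assumes "x \<in> space (PiM {..<n} (\<lambda>_. PiM {..<m} D))" and j: "j < m"
  shows "(\<lambda>y. \<lambda>i\<in>{..<n}. (x i)(j := y i)) \<in> PiM {..<n} (\<lambda>_. D j) \<rightarrow>\<^sub>M PiM {..<n} (\<lambda>_. PiM {..<m} D)"
proof (rule measurable_restrict)
  fix i assume i: "i \<in> {..<n}"
  then have "x i \<in> space (PiM {..<m} D)" using assms by (auto simp: space_PiM)
  then show "(\<lambda>y. (x i)(j := y i)) \<in> PiM {..<n} (\<lambda>_. D j) \<rightarrow>\<^sub>M PiM {..<m} D"
    using i j by (intro measurable_fun_upd[where J = "{..<m}"] measurable_component_singleton) auto
qed

text \<open>With all other values fixed, equality of the two sums forces the value of the edge
  \<open>(i, j)\<close>, which occurs in only one of them, to be one particular number. Without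
  atoms this has probability 0.\<close>

lemma AE_distinct_assigned_values:
  assumes E: "E \<subseteq> {..<n} \<times> {..<m}" "E' \<subseteq> {..<n} \<times> {..<m}" "(i, j) \<in> E" "(i, j) \<notin> E'"
  shows "AE x in PiM {..<n} (\<lambda>_. PiM {..<m} D). assigned_value x E \<noteq> assigned_value x E'"
proof -
  let ?M = "PiM {..<n} (\<lambda>_. PiM {..<m} D)"
  let ?h = "\<lambda>x. if assigned_value x E = assigned_value x E' then 1 else 0 :: ennreal"
  interpret Dj: product_prob_space "\<lambda>_. D j" "{..<n}"
    using prob by (intro product_prob_spaceI)
  have i: "i < n" and j: "j < m" using E by auto
  have fin: "finite E" "finite E'" using E finite_subset by blast+
  have h: "?h \<in> borel_measurable ?M"
    by (intro measurable_If measurable_const borel_measurable_eq measurable_assigned_value borel E)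
       simp_all
  have "(\<integral>\<^sup>+x. ?h x \<partial>?M) = (\<integral>\<^sup>+x. \<integral>\<^sup>+y. ?h (\<lambda>i\<in>{..<n}. (x i)(j := y i)) \<partial>PiM {..<n} (\<lambda>_. D j) \<partial>?M)"
    by (rule nn_integral_resample_column[OF j h])
  also have "\<dots> = (\<integral>\<^sup>+x. 0 \<partial>?M)"
  proof (rule nn_integral_cong)
    fix x assume x: "x \<in> space ?M"
    define X where "X y = (\<lambda>i\<in>{..<n}. (x i)(j := y i))" for y
    have X: "X \<in> PiM {..<n} (\<lambda>_. D j) \<rightarrow>\<^sub>M ?M"
      unfolding X_def by (rule measurable_replace_column[OF x j])
    \<comment> \<open>Within the redrawn column, the coordinate of bidder \<open>i\<close> is
      integrated innermost.\<close>
    have ins: "insert i ({..<n} - {i}) = {..<n}" using i by auto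
    have "(\<integral>\<^sup>+y. ?h (X y) \<partial>PiM (insert i ({..<n} - {i})) (\<lambda>_. D j))
        = (\<integral>\<^sup>+u. \<integral>\<^sup>+t. ?h (X (u(i := t))) \<partial>D j \<partial>PiM ({..<n} - {i}) (\<lambda>_. D j))"
      by (rule Dj.product_nn_integral_insert)
         (simp_all only: ins measurable_compose[OF X h], auto)
    also have "\<dots> = 0"
    proof (rule nn_integral_zero')
      show "AE u in PiM ({..<n} - {i}) (\<lambda>_. D j). (\<integral>\<^sup>+t. ?h (X (u(i := t))) \<partial>D j) = 0"
      proof (rule AE_I2)
      fix u :: "nat \<Rightarrow> real"
      let ?a = "assigned_value (X (u(i := 0))) (E - {(i, j)})"
      let ?a' = "assigned_value (X (u(i := 0))) E'"
      have "assigned_value (X (u(i := t))) E = t + ?a" for t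
      proof -
        have "assigned_value (X (u(i := t))) (E - {(i, j)}) = ?a"
          by (intro assigned_value_cong) (auto simp: X_def restrict_def)
        then show ?thesis
          using assigned_value_remove[OF fin(1) E(3), of "X (u(i := t))"] i by (simp add: X_def)
      qed
      moreover have "assigned_value (X (u(i := t))) E' = ?a'" for t
        using E(4) by (intro assigned_value_cong) (auto simp: X_def restrict_def)
      ultimately have "assigned_value (X (u(i := t))) E = assigned_value (X (u(i := t))) E'
          \<longleftrightarrow> t = ?a' - ?a" for t
        by (metis add_diff_cancel_right' diff_add_cancel)
      then have "?h (X (u(i := t))) = indicator {?a' - ?a} t" for t
        by (simp add: indicator_def)
      then show "(\<integral>\<^sup>+t. ?h (X (u(i := t))) \<partial>D j) = 0"
        using atomless borel by simp
      qed
    qed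
    finally show "(\<integral>\<^sup>+y. ?h (\<lambda>i\<in>{..<n}. (x i)(j := y i)) \<partial>PiM {..<n} (\<lambda>_. D j)) = 0"
      by (simp only: ins X_def)
  qed
  finally have "AE x in ?M. ?h x = 0"
    using nn_integral_0_iff_AE[OF h] by simp
  then show ?thesis by eventually_elim (auto split: if_splits)
qed

lemma AE_inj_assigned_value:
  "AE x in PiM {..<n} (\<lambda>_. PiM {..<m} D). inj_on (assigned_value x) (Pow ({..<n} \<times> {..<m}))"
proof -
  let ?M = "PiM {..<n} (\<lambda>_. PiM {..<m} D)" and ?P = "Pow ({..<n} \<times> {..<m})"
  have "AE x in ?M. \<forall>p\<in>?P \<times> ?P. fst p \<noteq> snd p \<longrightarrow> assigned_value x (fst p) \<noteq> assigned_value x (snd p)"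
  proof (subst AE_finite_all, simp, rule ballI)
    fix p assume p: "p \<in> ?P \<times> ?P"
    obtain E E' where [simp]: "p = (E, E')" by (cases p)
    have "\<exists>i j. (i, j) \<in> E \<and> (i, j) \<notin> E' \<or> (i, j) \<in> E' \<and> (i, j) \<notin> E" if "E \<noteq> E'"
      using that by auto
    then have "AE x in ?M. assigned_value x E \<noteq> assigned_value x E'" if "E \<noteq> E'"
      using that p AE_distinct_assigned_values[of E n E'] AE_distinct_assigned_values[of E' n E]
      by (auto simp: eq_commute)
    then show "AE x in ?M. fst p \<noteq> snd p \<longrightarrow> assigned_value x (fst p) \<noteq> assigned_value x (snd p)"
      by (cases "E = E'") auto
  qed
  then show ?thesis
    by eventually_elim (auto simp: inj_on_def)
qed

text \<open>Column \<open>j\<close> is redrawn and then split into the part \<open>u\<close> on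
  \<open>B\<close> and the part \<open>z\<close> outside. The set \<open>G\<close> may depend on
  \<open>u\<close> but not on \<open>z\<close>, so in the inner integral the values on
  \<open>G\<close> are still i.i.d. from \<open>D j\<close>.\<close>

lemma mean_second_highest_le_item_price:
  assumes C: "constrained_bidders n m C" and j: "j < m" and k: "0 < k" "k + 2 * (m - 1) \<le> n"
  shows "mean_second_highest k (D j)
    \<le> (\<integral>\<^sup>+x. ennreal (item_price n m C x j) \<partial>PiM {..<n} (\<lambda>_. PiM {..<m} D))"
proof -
  interpret constrained_bidders n m C by fact
  let ?M = "PiM {..<n} (\<lambda>_. PiM {..<m} D)"
  interpret Dj: product_prob_space "\<lambda>_. D j" "{..<n}"
    using prob by (intro product_prob_spaceI)
  interpret M: prob_space ?M using prob by (intro prob_space_PiM)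
  have AE_nonneg: "AE u in PiM I (\<lambda>_. D j). \<forall>i\<in>I. 0 \<le> u i" if "finite I" for I :: "nat set"
    using that prob nonneg by (subst AE_finite_all) (auto intro!: AE_PiM_component)
  have meas: "(\<lambda>x. ennreal (item_price n m C x j)) \<in> borel_measurable ?M"
    using measurable_item_price[OF borel] by simp
  have "mean_second_highest k (D j) = (\<integral>\<^sup>+x. mean_second_highest k (D j) \<partial>?M)"
    by (simp add: M.emeasure_space_1)
  also have "\<dots> \<le> (\<integral>\<^sup>+x. \<integral>\<^sup>+y. ennreal (item_price n m C (\<lambda>i\<in>{..<n}. (x i)(j := y i)) j)
      \<partial>PiM {..<n} (\<lambda>_. D j) \<partial>?M)"
  proof (rule nn_integral_mono)
    fix x assume x: "x \<in> space ?M"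
    define p where "p y = ennreal (item_price n m C (\<lambda>i\<in>{..<n}. (x i)(j := y i)) j)" for y
    have p: "p \<in> borel_measurable (PiM {..<n} (\<lambda>_. D j))"
      unfolding p_def by (rule measurable_compose[OF measurable_replace_column[OF x j] meas])
    have p_eq: "p y = ennreal (item_price n m C (\<lambda>i. (x i)(j := y i)) j)" for y
      unfolding p_def by (intro arg_cong[where f = ennreal] item_price_cong) auto
    obtain B where B: "B \<subseteq> {..<n}"
      and G: "\<forall>u. \<exists>G \<subseteq> {..<n} - B. k \<le> card G \<and>
        (\<forall>y. (\<forall>i<n. 0 \<le> y i) \<longrightarrow> (\<forall>i\<in>B. y i = u i) \<longrightarrow>
          second_highest G y \<le> item_price n m C (\<lambda>i. (x i)(j := y i)) j)"
      using item_price_ge_second_highest[OF j k, of x] by blast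
    let ?J = "{..<n} - B"
    have un: "B \<union> ?J = {..<n}" and fin: "finite B" "finite ?J"
      using B finite_subset by auto
    interpret PB: prob_space "PiM B (\<lambda>_. D j)" using prob by (intro prob_space_PiM)
    have "mean_second_highest k (D j) = (\<integral>\<^sup>+u. mean_second_highest k (D j) \<partial>PiM B (\<lambda>_. D j))"
      by (simp add: PB.emeasure_space_1)
    also have "\<dots> \<le> (\<integral>\<^sup>+u. \<integral>\<^sup>+z. p (merge B ?J (u, z)) \<partial>PiM ?J (\<lambda>_. D j) \<partial>PiM B (\<lambda>_. D j))"
    proof (rule nn_integral_mono_AE)
      show "AE u in PiM B (\<lambda>_. D j). mean_second_highest k (D j)
          \<le> (\<integral>\<^sup>+z. p (merge B ?J (u, z)) \<partial>PiM ?J (\<lambda>_. D j))"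
        using AE_nonneg[OF fin(1)]
      proof eventually_elim
        fix u :: "nat \<Rightarrow> real" assume u: "\<forall>i\<in>B. 0 \<le> u i"
        obtain G where G: "G \<subseteq> ?J" "k \<le> card G"
          "\<And>y :: nat \<Rightarrow> real. (\<forall>i<n. 0 \<le> y i) \<Longrightarrow> (\<forall>i\<in>B. y i = u i) \<Longrightarrow>
            second_highest G y \<le> item_price n m C (\<lambda>i. (x i)(j := y i)) j"
          using G[rule_format, of u] by blast
        have "mean_second_highest k (D j) \<le> (\<integral>\<^sup>+z. ennreal (second_highest G z) \<partial>PiM ?J (\<lambda>_. D j))"
          by (rule mean_second_highest_le[OF prob borel fin(2) G(1,2) k(1)])
        also have "\<dots> \<le> (\<integral>\<^sup>+z. p (merge B ?J (u, z)) \<partial>PiM ?J (\<lambda>_. D j))"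
        proof (rule nn_integral_mono_AE)
          show "AE z in PiM ?J (\<lambda>_. D j). ennreal (second_highest G z) \<le> p (merge B ?J (u, z))"
            using AE_nonneg[OF fin(2)]
          proof eventually_elim
            fix z :: "nat \<Rightarrow> real" assume z: "\<forall>i\<in>?J. 0 \<le> z i"
            have "second_highest G z = second_highest G (merge B ?J (u, z))"
              using G(1) by (intro second_highest_cong) (auto simp: merge_def)
            also have "\<dots> \<le> item_price n m C (\<lambda>i. (x i)(j := merge B ?J (u, z) i)) j"
              using u z B by (intro G(3)) (auto simp: merge_def)
            finally show "ennreal (second_highest G z) \<le> p (merge B ?J (u, z))"
              unfolding p_eq by (rule ennreal_leI)
          qed
        qed
        finally show "mean_second_highest k (D j)
          \<le> (\<integral>\<^sup>+z. p (merge B ?J (u, z)) \<partial>PiM ?J (\<lambda>_. D j))" .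
      qed
    qed
    also have "\<dots> = (\<integral>\<^sup>+y. p y \<partial>PiM (B \<union> ?J) (\<lambda>_. D j))"
      by (rule Dj.product_nn_integral_fold[symmetric]) (simp_all only: un p fin Diff_disjoint)
    finally show "mean_second_highest k (D j)
        \<le> (\<integral>\<^sup>+y. ennreal (item_price n m C (\<lambda>i\<in>{..<n}. (x i)(j := y i)) j) \<partial>PiM {..<n} (\<lambda>_. D j))"
      by (simp only: un p_def)
  qed
  also have "\<dots> = (\<integral>\<^sup>+x. ennreal (item_price n m C x j) \<partial>?M)"
    by (rule nn_integral_resample_column[OF j meas, symmetric])
  finally show ?thesis .
qed

lemma sum_mean_second_highest_le_vcg:
  assumes C: "constrained_bidders n m C" and k: "0 < k" "k + 2 * (m - 1) \<le> n"
  shows "(\<Sum>j<m. mean_second_highest k (D j)) \<le>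
    (\<integral>\<^sup>+x. ennreal (\<Sum>i<n. vcg_payment n m (\<lambda>i\<in>{..<n}. constrained_valuation m (C i) (x i)) i)
      \<partial>PiM {..<n} (\<lambda>_. PiM {..<m} D))"
proof -
  interpret constrained_bidders n m C by fact
  let ?M = "PiM {..<n} (\<lambda>_. PiM {..<m} D)"
  have "(\<Sum>j<m. mean_second_highest k (D j)) \<le> (\<Sum>j<m. \<integral>\<^sup>+x. ennreal (item_price n m C x j) \<partial>?M)"
    using mean_second_highest_le_item_price[OF C _ k] by (intro sum_mono) auto
  also have "\<dots> = (\<integral>\<^sup>+x. (\<Sum>j<m. ennreal (item_price n m C x j)) \<partial>?M)"
    using measurable_item_price[OF borel] by (intro nn_integral_sum[symmetric]) simp
  also have "\<dots> \<le> (\<integral>\<^sup>+x. ennreal (\<Sum>i<n. vcg_payment n m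
      (\<lambda>i\<in>{..<n}. constrained_valuation m (C i) (x i)) i) \<partial>?M)"
  proof (rule nn_integral_mono_AE)
    show "AE x in ?M. (\<Sum>j<m. ennreal (item_price n m C x j)) \<le> ennreal (\<Sum>i<n. vcg_payment n m
        (\<lambda>i\<in>{..<n}. constrained_valuation m (C i) (x i)) i)"
      using AE_inj_assigned_value
    proof eventually_elim
      fix x assume "inj_on (assigned_value x) (Pow ({..<n} \<times> {..<m}))"
      then have "(\<Sum>j<m. item_price n m C x j) \<le> (\<Sum>i<n. vcg_payment n m
          (\<lambda>i\<in>{..<n}. constrained_valuation m (C i) (x i)) i)"
        by (intro vcg_revenue_ge_item_prices) auto
      then show "(\<Sum>j<m. ennreal (item_price n m C x j)) \<le> ennreal (\<Sum>i<n. vcg_payment n m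
          (\<lambda>i\<in>{..<n}. constrained_valuation m (C i) (x i)) i)"
        by (subst sum_ennreal) (auto simp: item_price_nonneg intro!: ennreal_leI)
    qed
  qed
  finally show ?thesis .
qed

end

section \<open>Imposing random constraints on additive bidders\<close>

text \<open>The values of a bid on singletons are the item values of an additive bidder. They are
  read off from any bid, as a mechanism must be defined and measurable on all of
  \<open>valuations m\<close>.\<close>

definition constrain :: "nat \<Rightarrow> nat \<Rightarrow> (nat \<Rightarrow> nat set set) \<Rightarrow> (nat \<Rightarrow> valuation) \<Rightarrow> nat \<Rightarrow> valuation" where
  "constrain n m C b = (\<lambda>i\<in>{..<n}. constrained_valuation m (C i) (\<lambda>j. b i {j}))"

text \<open>The inserted \<open>{}\<close> guarantees a candidate for every \<open>J\<close>, so
  that \<open>trim\<close> maps allocations to allocations whatever the set systems are.\<close>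

definition best_part :: "nat set set \<Rightarrow> valuation \<Rightarrow> nat set \<Rightarrow> nat set" where
  "best_part J v S = arg_max_on (\<lambda>T. \<Sum>j\<in>T. v {j}) (insert {} {T. T \<subseteq> S \<and> T \<in> J})"

definition trim :: "nat \<Rightarrow> (nat \<Rightarrow> nat set set) \<Rightarrow> (nat \<Rightarrow> valuation) \<Rightarrow> outcome \<Rightarrow> outcome" where
  "trim n C b a = ((\<lambda>i\<in>{..<n}. best_part (C i) (b i) (fst a i)), snd a)"

lemma constrained_valuation_cong:
  assumes "\<And>j. j < m \<Longrightarrow> x j = y j"
  shows "constrained_valuation m J x = constrained_valuation m J y"
  unfolding constrained_valuation_def
proof (intro restrict_ext arg_cong[where f = Max] image_cong refl sum.cong)
  fix S T j assume "S \<in> Pow {..<m}" "T \<in> {T. T \<subseteq> S \<and> T \<in> J}" "j \<in> T"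
  then have "j < m" by auto
  then show "x j = y j" by (rule assms)
qed

lemma additive_valuation_single: "j < m \<Longrightarrow> additive_valuation m x {j} = x j"
  by (simp add: additive_valuation_def)

lemma constrain_additive:
  "constrain n m C (\<lambda>i\<in>{..<n}. additive_valuation m (x i))
    = (\<lambda>i\<in>{..<n}. constrained_valuation m (C i) (x i))"
  unfolding constrain_def
  by (intro restrict_ext constrained_valuation_cong) (simp add: additive_valuation_single)

lemma best_part:
  assumes "S \<subseteq> {..<m}" "{} \<in> J"
  shows "best_part J v S \<subseteq> S" "best_part J v S \<in> J"
    and "(\<Sum>j\<in>best_part J v S. v {j}) = constrained_valuation m J (\<lambda>j. v {j}) S"
proof -
  let ?R = "{T. T \<subseteq> S \<and> T \<in> J}"
  have R: "insert {} ?R = ?R" using assms(2) by auto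
  have fin: "finite ?R" by (rule finite_subset[of _ "Pow {..<m}"]) (use assms in auto)
  have ne: "?R \<noteq> {}" using assms(2) by auto
  show "best_part J v S \<subseteq> S" "best_part J v S \<in> J"
    using arg_max_on_finite(1)[OF fin ne] unfolding best_part_def R by blast+
  show "(\<Sum>j\<in>best_part J v S. v {j}) = constrained_valuation m J (\<lambda>j. v {j}) S"
    using arg_max_on_finite(2)[OF fin ne, of "\<lambda>T. \<Sum>j\<in>T. v {j}"] assms(1)
    by (simp add: best_part_def R constrained_valuation_def)
qed

lemma best_part_subset:
  assumes "S \<subseteq> {..<m}"
  shows "best_part J v S \<subseteq> S"
proof -
  have "finite (insert {} {T. T \<subseteq> S \<and> T \<in> J})"
    by (rule finite_subset[of _ "Pow {..<m}"]) (use assms in auto)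
  from arg_max_on_finite(1)[OF this] show ?thesis
    unfolding best_part_def by blast
qed

lemma sum_le_constrained_valuation:
  assumes "S \<subseteq> {..<m}" "T \<subseteq> S" "T \<in> J"
  shows "(\<Sum>j\<in>T. x j) \<le> constrained_valuation m J x S"
proof -
  have "finite {T. T \<subseteq> S \<and> T \<in> J}"
    by (rule finite_subset[of _ "Pow {..<m}"]) (use assms in auto)
  then show ?thesis
    using assms unfolding constrained_valuation_def by (auto intro!: Max_ge)
qed

lemma trim_in_allocations:
  assumes "A \<in> allocations n m"
  shows "(\<lambda>i\<in>{..<n}. best_part (C i) (b i) (A i)) \<in> allocations n m"
proof -
  have "best_part (C i) (b i) (A i) \<subseteq> A i" if "i < n" for i
    using assms that by (intro best_part_subset[of _ m]) (auto simp: allocations_def)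
  moreover have "A i \<subseteq> {..<m}" if "i < n" for i
    using assms that by (auto simp: allocations_def)
  moreover have "A i \<inter> A i' = {}" if "i < n" "i' < n" "i \<noteq> i'" for i i'
    using assms that unfolding allocations_def disjoint_family_on_def by blast
  ultimately show ?thesis
    unfolding allocations_def disjoint_family_on_def by (auto; blast)
qed

lemma measurable_best_part:
  assumes "S \<subseteq> {..<m}"
  shows "(\<lambda>v. best_part J v S) \<in> valuations m \<rightarrow>\<^sub>M count_space (Pow {..<m})"
proof -
  let ?R = "insert {} {T. T \<subseteq> S \<and> T \<in> J}"
  have R: "finite ?R" "?R \<subseteq> Pow {..<m}"
    using assms by (auto intro!: finite_subset[of _ "Pow {..<m}"])
  have "(\<lambda>v. best_part J v S) \<in> valuations m \<rightarrow>\<^sub>M count_space ?R"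
    unfolding best_part_def using R
    by (intro measurable_arg_max_on borel_measurable_sum measurable_valuation_apply) auto
  from measurable_compose[OF this, of "\<lambda>T. T" "count_space (Pow {..<m})"] show ?thesis
    using R by auto
qed

text \<open>There are only finitely many allocations, so the dependence on the bids may be examined
  for one fixed allocation at a time.\<close>

lemma measurable_trim:
  "(\<lambda>(b, a). trim n C b a) \<in> PiM {..<n} (\<lambda>_. valuations m) \<Otimes>\<^sub>M outcomes n m \<rightarrow>\<^sub>M outcomes n m"
proof -
  let ?V = "PiM {..<n} (\<lambda>_. valuations m)"
  have trimA: "(\<lambda>b. \<lambda>i\<in>{..<n}. best_part (C i) (b i) (A i)) \<in> ?V \<rightarrow>\<^sub>M count_space (allocations n m)"
    if A: "A \<in> allocations n m" for A
  proof (rule measurable_count_space_extend)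
    show "allocations n m \<subseteq> {..<n} \<rightarrow>\<^sub>E Pow {..<m}" by (auto simp: allocations_def)
    show "(\<lambda>b. \<lambda>i\<in>{..<n}. best_part (C i) (b i) (A i)) \<in> space ?V \<rightarrow> allocations n m"
      using trim_in_allocations[OF A] by auto
    have "(\<lambda>b. best_part (C i) (b i) (A i)) \<in> ?V \<rightarrow>\<^sub>M count_space (Pow {..<m})" if "i < n" for i
      using A that measurable_best_part[of "A i" m "C i"]
      by (intro measurable_compose[OF measurable_component_singleton[of i]]) (auto simp: allocations_def)
    then have "(\<lambda>b. \<lambda>i\<in>{..<n}. best_part (C i) (b i) (A i))
        \<in> ?V \<rightarrow>\<^sub>M PiM {..<n} (\<lambda>_. count_space (Pow {..<m}))"
      by (intro measurable_restrict) auto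
    also have "PiM {..<n} (\<lambda>_. count_space (Pow {..<m})) = count_space ({..<n} \<rightarrow>\<^sub>E Pow {..<m})"
      by (rule count_space_PiM_finite) (auto intro: countable_finite)
    finally show "(\<lambda>b. \<lambda>i\<in>{..<n}. best_part (C i) (b i) (A i))
        \<in> ?V \<rightarrow>\<^sub>M count_space ({..<n} \<rightarrow>\<^sub>E Pow {..<m})" .
  qed
  have fst_out: "(\<lambda>p. fst (snd p)) \<in> ?V \<Otimes>\<^sub>M outcomes n m \<rightarrow>\<^sub>M count_space (allocations n m)"
    unfolding outcomes_def by (intro measurable_compose[OF measurable_snd measurable_fst])
  have snd_out: "(\<lambda>p. snd (snd p)) \<in> ?V \<Otimes>\<^sub>M outcomes n m \<rightarrow>\<^sub>M PiM {..<n} (\<lambda>_. borel)"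
    unfolding outcomes_def by (intro measurable_compose[OF measurable_snd measurable_snd])
  have "(\<lambda>p. \<lambda>i\<in>{..<n}. best_part (C i) (fst p i) (fst (snd p) i))
      \<in> ?V \<Otimes>\<^sub>M outcomes n m \<rightarrow>\<^sub>M count_space (allocations n m)"
    by (rule measurable_compose_countable'[where I = "allocations n m" and g = "\<lambda>p. fst (snd p)" and
          f = "\<lambda>A p. \<lambda>i\<in>{..<n}. best_part (C i) (fst p i) (A i)"])
       (auto intro: measurable_compose[OF measurable_fst trimA] fst_out countable_finite finite_allocations)
  then have "(\<lambda>p. ((\<lambda>i\<in>{..<n}. best_part (C i) (fst p i) (fst (snd p) i)), snd (snd p)))
      \<in> ?V \<Otimes>\<^sub>M outcomes n m \<rightarrow>\<^sub>M outcomes n m"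
    using snd_out by (subst (2) outcomes_def) (rule measurable_Pair)
  then show ?thesis
    unfolding trim_def split_beta' .
qed

lemma measurable_constrain:
  "constrain n m C \<in> PiM {..<n} (\<lambda>_. valuations m) \<rightarrow>\<^sub>M PiM {..<n} (\<lambda>_. valuations m)"
  unfolding constrain_def
proof (rule measurable_restrict)
  fix i assume i: "i \<in> {..<n}"
  have "(\<lambda>v. \<lambda>j\<in>{..<m}. v {j}) \<in> valuations m \<rightarrow>\<^sub>M PiM {..<m} (\<lambda>_. borel)"
    by (intro measurable_restrict measurable_valuation_apply) auto
  then have "(\<lambda>v. (C i, \<lambda>j\<in>{..<m}. v {j}))
      \<in> valuations m \<rightarrow>\<^sub>M count_space UNIV \<Otimes>\<^sub>M PiM {..<m} (\<lambda>_. borel :: real measure)"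
    by (intro measurable_Pair) auto
  from measurable_compose[OF this measurable_constrained_valuation]
  have "(\<lambda>v. constrained_valuation m (C i) (\<lambda>j\<in>{..<m}. v {j})) \<in> valuations m \<rightarrow>\<^sub>M valuations m"
    by simp
  also have "(\<lambda>v. constrained_valuation m (C i) (\<lambda>j\<in>{..<m}. v {j}))
      = (\<lambda>v. constrained_valuation m (C i) (\<lambda>j. v {j}))"
    by (intro ext constrained_valuation_cong) simp
  finally show "(\<lambda>b. constrained_valuation m (C i) (\<lambda>j. b i {j}))
      \<in> PiM {..<n} (\<lambda>_. valuations m) \<rightarrow>\<^sub>M valuations m"
    using i by (intro measurable_compose[OF measurable_component_singleton[of i]]) auto
qed

section \<open>The additive and the constrained law over the same item values\<close>

locale auction = value_distributions +
  fixes D0 :: "nat set set pmf"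
  assumes m_pos: "0 < m"
    and closed: "J \<in> set_pmf D0 \<Longrightarrow> downward_closed m J"
    and singletons: "J \<in> set_pmf D0 \<Longrightarrow> j < m \<Longrightarrow> {j} \<in> J"
begin

text \<open>Restricted to the finite support, so that measurability in the constraints is trivial.\<close>

definition systems :: "nat set set measure" where
  "systems = restrict_space (measure_pmf D0) (set_pmf D0)"

definition additive_law :: "valuation measure" where
  "additive_law = distr (PiM {..<m} D) (valuations m) (additive_valuation m)"

definition constrained_law :: "valuation measure" where
  "constrained_law = distr (measure_pmf D0 \<Otimes>\<^sub>M PiM {..<m} D) (valuations m)
     (\<lambda>(\<I>, x). constrained_valuation m \<I> x)"

lemma finite_systems: "finite (set_pmf D0)"
  by (rule finite_subset[of _ "Pow (Pow {..<m})"]) (use closed in \<open>auto simp: downward_closed_def\<close>)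

lemma empty_in_system: "J \<in> set_pmf D0 \<Longrightarrow> {} \<in> J"
  using closed singletons[OF _ m_pos] unfolding downward_closed_def by blast

lemma space_systems: "space systems = set_pmf D0"
  by (simp add: systems_def space_restrict_space)

lemma sets_systems: "sets systems = sets (count_space (set_pmf D0))"
  unfolding systems_def by (auto simp: sets_restrict_space)

lemma prob_space_systems: "prob_space systems"
  unfolding systems_def
  by (intro prob_space_restrict_space) (auto simp: measure_pmf.emeasure_eq_1_AE AE_measure_pmf_iff)

lemma prob_space_values: "prob_space (PiM {..<m} D)"
  by (intro prob_space_PiM prob)

lemma nn_integral_systems:
  fixes f :: "nat set set \<Rightarrow> ennreal"
  shows "(\<integral>\<^sup>+J. f J \<partial>systems) = (\<Sum>J\<in>set_pmf D0. f J * pmf D0 J)"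
proof -
  have "(\<integral>\<^sup>+J. f J \<partial>systems) = (\<integral>\<^sup>+J. f J * indicator (set_pmf D0) J \<partial>measure_pmf D0)"
    unfolding systems_def by (rule nn_integral_restrict_space) simp
  also have "\<dots> = (\<Sum>J\<in>set_pmf D0. f J * indicator (set_pmf D0) J * pmf D0 J)"
    by (rule nn_integral_measure_pmf_finite[OF finite_systems]) simp
  finally show ?thesis by simp
qed

lemma sets_PiM_systems:
  fixes n :: nat
  shows "sets (PiM {..<n} (\<lambda>_. systems)) = sets (count_space ({..<n} \<rightarrow>\<^sub>E set_pmf D0))"
proof -
  have "sets (PiM {..<n} (\<lambda>_. systems)) = sets (PiM {..<n} (\<lambda>_. count_space (set_pmf D0)))"
    by (intro sets_PiM_cong refl sets_systems)
  also have "PiM {..<n} (\<lambda>_. count_space (set_pmf D0)) = count_space ({..<n} \<rightarrow>\<^sub>E set_pmf D0)"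
    by (rule count_space_PiM_finite) (auto intro: countable_finite finite_systems)
  finally show ?thesis .
qed

lemma finite_system_profiles: "finite ({..<n} \<rightarrow>\<^sub>E set_pmf D0 :: (nat \<Rightarrow> nat set set) set)"
  by (intro finite_PiE finite_systems) auto

lemma space_PiM_systems:
  fixes n :: nat
  shows "space (PiM {..<n} (\<lambda>_. systems)) = {..<n} \<rightarrow>\<^sub>E set_pmf D0"
  by (simp add: space_PiM space_systems)

lemma borel_measurable_PiM_systems:
  fixes h :: "(nat \<Rightarrow> nat set set) \<Rightarrow> ennreal"
  shows "h \<in> borel_measurable (PiM {..<n} (\<lambda>_. systems))"
  unfolding measurable_cong_sets[OF sets_PiM_systems refl] by simp

lemma measurable_system_valuation:
  "(\<lambda>(x, J). constrained_valuation m J x) \<in> PiM {..<m} D \<Otimes>\<^sub>M systems \<rightarrow>\<^sub>M valuations m"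
proof -
  have "(\<lambda>J. J) \<in> systems \<rightarrow>\<^sub>M count_space UNIV"
    unfolding measurable_cong_sets[OF sets_systems refl] by simp
  then have "(\<lambda>p. (snd p, fst p)) \<in> PiM {..<m} D \<Otimes>\<^sub>M systems \<rightarrow>\<^sub>M count_space UNIV \<Otimes>\<^sub>M PiM {..<m} D"
    by (intro measurable_Pair measurable_fst measurable_compose[OF measurable_snd])
  from measurable_compose[OF this measurable_constrained_valuation[OF borel]]
  show ?thesis by (simp add: split_beta')
qed

lemma constrained_law_props:
  shows "sets constrained_law = sets (valuations m)" "prob_space constrained_law"
    and "\<And>h. h \<in> borel_measurable (valuations m) \<Longrightarrow> (\<integral>\<^sup>+v. h v \<partial>constrained_law)
      = (\<Sum>J\<in>set_pmf D0. (\<integral>\<^sup>+x. h (constrained_valuation m J x) \<partial>PiM {..<m} D) * pmf D0 J)"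
proof -
  interpret V: prob_space "PiM {..<m} D" by (rule prob_space_values)
  interpret pair_prob_space "measure_pmf D0" "PiM {..<m} D" ..
  have sets: "sets (measure_pmf D0 \<Otimes>\<^sub>M PiM {..<m} D) = sets (count_space UNIV \<Otimes>\<^sub>M PiM {..<m} D)"
    by (intro sets_pair_measure_cong) auto
  have meas: "(\<lambda>(\<I>, x). constrained_valuation m \<I> x)
      \<in> measure_pmf D0 \<Otimes>\<^sub>M PiM {..<m} D \<rightarrow>\<^sub>M valuations m"
    unfolding measurable_cong_sets[OF sets refl] by (rule measurable_constrained_valuation[OF borel])
  show "sets constrained_law = sets (valuations m)" by (simp add: constrained_law_def)
  show "prob_space constrained_law"
    unfolding constrained_law_def by (rule prob_space_distr[OF meas])
  fix h :: "valuation \<Rightarrow> ennreal" assume h: "h \<in> borel_measurable (valuations m)"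
  have "(\<integral>\<^sup>+v. h v \<partial>constrained_law) = (\<integral>\<^sup>+p. h (case p of (\<I>, x) \<Rightarrow> constrained_valuation m \<I> x)
      \<partial>(measure_pmf D0 \<Otimes>\<^sub>M PiM {..<m} D))"
    unfolding constrained_law_def by (rule nn_integral_distr[OF meas]) (simp add: h)
  also have "\<dots> = (\<integral>\<^sup>+J. \<integral>\<^sup>+x. h (constrained_valuation m J x) \<partial>PiM {..<m} D \<partial>measure_pmf D0)"
    by (subst V.nn_integral_fst[OF measurable_compose[OF meas h], symmetric]) simp
  also have "\<dots> = (\<Sum>J\<in>set_pmf D0. (\<integral>\<^sup>+x. h (constrained_valuation m J x) \<partial>PiM {..<m} D) * pmf D0 J)"
    by (rule nn_integral_measure_pmf_finite[OF finite_systems]) simp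
  finally show "(\<integral>\<^sup>+v. h v \<partial>constrained_law)
      = (\<Sum>J\<in>set_pmf D0. (\<integral>\<^sup>+x. h (constrained_valuation m J x) \<partial>PiM {..<m} D) * pmf D0 J)" .
qed

lemma additive_law_props:
  shows "sets additive_law = sets (valuations m)" "prob_space additive_law"
    and "additive_valuation m \<in> PiM {..<m} D \<rightarrow>\<^sub>M valuations m"
proof -
  interpret V: prob_space "PiM {..<m} D" by (rule prob_space_values)
  show meas: "additive_valuation m \<in> PiM {..<m} D \<rightarrow>\<^sub>M valuations m"
    by (rule measurable_additive_valuation[OF borel])
  show "sets additive_law = sets (valuations m)" by (simp add: additive_law_def)
  show "prob_space additive_law"
    unfolding additive_law_def by (rule V.prob_space_distr[OF meas])
qed

text \<open>Presents a constrained type as item values followed by an independent set system, in the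
  form that \<open>nn_integral_PiM_pair\<close> requires.\<close>

lemma distr_system_valuation:
  "distr (PiM {..<m} D \<Otimes>\<^sub>M systems) constrained_law (\<lambda>(x, J). constrained_valuation m J x) = constrained_law"
proof (rule measure_eqI)
  interpret V: prob_space "PiM {..<m} D" by (rule prob_space_values)
  interpret S: prob_space systems by (rule prob_space_systems)
  let ?f = "\<lambda>(x, J). constrained_valuation m J x"
  have f: "?f \<in> PiM {..<m} D \<Otimes>\<^sub>M systems \<rightarrow>\<^sub>M constrained_law"
    unfolding measurable_cong_sets[OF refl constrained_law_props(1)] by (rule measurable_system_valuation)
  fix X assume "X \<in> sets (distr (PiM {..<m} D \<Otimes>\<^sub>M systems) constrained_law ?f)"
  then have X: "X \<in> sets (valuations m)" "X \<in> sets constrained_law"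
    using constrained_law_props(1) by simp_all
  have ind: "indicator X \<in> borel_measurable (valuations m)" using X by simp
  have fJ: "(\<lambda>x. constrained_valuation m J x) \<in> PiM {..<m} D \<rightarrow>\<^sub>M valuations m"
    if "J \<in> set_pmf D0" for J
    using measurable_compose[OF measurable_Pair2' measurable_system_valuation, of J] that
    by (simp add: space_systems)
  have "emeasure (distr (PiM {..<m} D \<Otimes>\<^sub>M systems) constrained_law ?f) X
      = (\<integral>\<^sup>+v. indicator X v \<partial>distr (PiM {..<m} D \<Otimes>\<^sub>M systems) constrained_law ?f)"
    using X by simp
  also have "\<dots> = (\<integral>\<^sup>+p. indicator X (?f p) \<partial>(PiM {..<m} D \<Otimes>\<^sub>M systems))"
    using X by (intro nn_integral_distr[OF f]) simp
  also have "\<dots> = (\<integral>\<^sup>+x. \<integral>\<^sup>+J. indicator X (constrained_valuation m J x) \<partial>systems \<partial>PiM {..<m} D)"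
    by (subst S.nn_integral_fst[OF measurable_compose[OF measurable_system_valuation ind], symmetric]) simp
  also have "\<dots> = (\<integral>\<^sup>+x. (\<Sum>J\<in>set_pmf D0. indicator X (constrained_valuation m J x) * ennreal (pmf D0 J)) \<partial>PiM {..<m} D)"
    by (simp only: nn_integral_systems)
  also have "\<dots> = (\<Sum>J\<in>set_pmf D0. (\<integral>\<^sup>+x. indicator X (constrained_valuation m J x) \<partial>PiM {..<m} D) * pmf D0 J)"
    by (rule nn_integral_weighted_sum[OF measurable_compose[OF fJ ind]])
  also have "\<dots> = (\<integral>\<^sup>+v. indicator X v \<partial>constrained_law)"
    by (rule constrained_law_props(3)[OF ind, symmetric])
  finally show "emeasure (distr (PiM {..<m} D \<Otimes>\<^sub>M systems) constrained_law ?f) X = emeasure constrained_law X"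
    using X by simp
qed simp

lemma sets_PiM_laws:
  fixes n :: nat
  shows "sets (PiM {..<n} (\<lambda>_. constrained_law)) = sets (PiM {..<n} (\<lambda>_. valuations m))"
  "sets (PiM {..<n} (\<lambda>_. additive_law)) = sets (PiM {..<n} (\<lambda>_. valuations m))"
  by (intro sets_PiM_cong refl constrained_law_props additive_law_props)+

text \<open>Together with \<open>nn_integral_additive_profile\<close> this couples the two laws:
  both profiles are functions of one value matrix, and the constrained one draws set systems
  independently of it.\<close>

lemma nn_integral_constrained_profile:
  fixes n :: nat
  assumes "h \<in> borel_measurable (PiM {..<n} (\<lambda>_. valuations m))"
  shows "(\<integral>\<^sup>+b. h b \<partial>PiM {..<n} (\<lambda>_. constrained_law))
    = (\<integral>\<^sup>+x. \<integral>\<^sup>+C. h (\<lambda>i\<in>{..<n}. constrained_valuation m (C i) (x i))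
        \<partial>PiM {..<n} (\<lambda>_. systems) \<partial>PiM {..<n} (\<lambda>_. PiM {..<m} D))"
proof -
  have f: "(\<lambda>(x, J). constrained_valuation m J x) \<in> PiM {..<m} D \<Otimes>\<^sub>M systems \<rightarrow>\<^sub>M constrained_law"
    unfolding measurable_cong_sets[OF refl constrained_law_props(1)] by (rule measurable_system_valuation)
  have h: "h \<in> borel_measurable (PiM {..<n} (\<lambda>_. constrained_law))"
    using assms unfolding measurable_cong_sets[OF sets_PiM_laws(1) refl] .
  from nn_integral_PiM_pair[OF finite_lessThan prob_space_values prob_space_systems f distr_system_valuation h]
  show ?thesis by simp
qed

lemma nn_integral_additive_profile:
  fixes n :: nat
  assumes "h \<in> borel_measurable (PiM {..<n} (\<lambda>_. valuations m))"
  shows "(\<integral>\<^sup>+b. h b \<partial>PiM {..<n} (\<lambda>_. additive_law))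
    = (\<integral>\<^sup>+x. h (\<lambda>i\<in>{..<n}. additive_valuation m (x i)) \<partial>PiM {..<n} (\<lambda>_. PiM {..<m} D))"
  unfolding additive_law_def
  by (rule nn_integral_PiM_distr[OF finite_lessThan prob_space_values additive_law_props(3) assms])

lemma measurable_profile:
  "(\<lambda>(x, C). \<lambda>i\<in>{..<n}. constrained_valuation m (C i) (x i))
    \<in> PiM {..<n} (\<lambda>_. PiM {..<m} D) \<Otimes>\<^sub>M PiM {..<n} (\<lambda>_. systems) \<rightarrow>\<^sub>M PiM {..<n} (\<lambda>_. valuations m)"
  unfolding split_beta'
proof (rule measurable_restrict)
  fix i assume i: "i \<in> {..<n}"
  have "(\<lambda>p. (fst p i, snd p i))
      \<in> PiM {..<n} (\<lambda>_. PiM {..<m} D) \<Otimes>\<^sub>M PiM {..<n} (\<lambda>_. systems) \<rightarrow>\<^sub>M PiM {..<m} D \<Otimes>\<^sub>M systems"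
    using i by (intro measurable_Pair measurable_compose[OF measurable_fst measurable_component_singleton]
        measurable_compose[OF measurable_snd measurable_component_singleton]) auto
  from measurable_compose[OF this measurable_system_valuation]
  show "(\<lambda>p. constrained_valuation m (snd p i) (fst p i))
      \<in> PiM {..<n} (\<lambda>_. PiM {..<m} D) \<Otimes>\<^sub>M PiM {..<n} (\<lambda>_. systems) \<rightarrow>\<^sub>M valuations m"
    by simp
qed

lemma measurable_vcg_revenue:
  "(\<lambda>b. ennreal (\<Sum>i<n. vcg_payment n m b i)) \<in> borel_measurable (PiM {..<n} (\<lambda>_. valuations m))"
proof -
  have "(\<lambda>b. vcg_payment n m b i) \<in> borel_measurable (PiM {..<n} (\<lambda>_. valuations m))" if "i < n" for i
    using that by (intro measurable_compose[OF measurable_vcg_payment measurable_component_singleton]) auto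
  then show ?thesis
    by (intro measurable_compose[OF borel_measurable_sum measurable_ennreal]) auto
qed

lemma Rev_VCG_additive_law:
  assumes k: "0 < k"
  shows "Rev (VCG k m) additive_law k = enn2ereal (\<Sum>j<m. mean_second_highest k (D j))"
proof -
  let ?M = "PiM {..<k} (\<lambda>_. PiM {..<m} D)"
  have "(\<integral>\<^sup>+b. ennreal (\<Sum>i<k. vcg_payment k m b i) \<partial>PiM {..<k} (\<lambda>_. additive_law))
      = (\<integral>\<^sup>+x. ennreal (\<Sum>j<m. second_highest {..<k} (\<lambda>i. x i j)) \<partial>?M)"
    unfolding nn_integral_additive_profile[OF measurable_vcg_revenue]
    by (intro nn_integral_cong arg_cong[where f = ennreal] vcg_revenue_additive k) simp
  also have "\<dots> = (\<integral>\<^sup>+x. (\<Sum>j<m. ennreal (second_highest {..<k} (\<lambda>i. x i j))) \<partial>?M)"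
    using k by (intro nn_integral_cong sum_ennreal[symmetric] second_highest_nonneg) auto
  also have "\<dots> = (\<Sum>j<m. \<integral>\<^sup>+x. ennreal (second_highest {..<k} (\<lambda>i. x i j)) \<partial>?M)"
    using measurable_value[OF borel]
    by (intro nn_integral_sum measurable_compose[OF measurable_second_highest measurable_ennreal]) auto
  also have "\<dots> = (\<Sum>j<m. mean_second_highest k (D j))"
  proof (intro sum.cong refl)
    fix j assume j: "j \<in> {..<m}"
    \<comment> \<open>The values of the \<open>k\<close> bidders for \<open>j\<close> form one
      column of the value matrix, whose entries are i.i.d. from the marginal
      \<open>D j\<close>.\<close>
    have Dj: "distr (PiM {..<m} D) (D j) (\<lambda>x. x j) = D j"
      by (rule distr_PiM_component) (use prob j in auto)
    have "(\<lambda>w. w i) \<in> borel_measurable (PiM {..<k} (\<lambda>_. D j))" if "i < k" for i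
      using measurable_component_singleton[of i "{..<k}" "\<lambda>_. D j"] that borel
      by (simp cong: measurable_cong_sets)
    then have h: "(\<lambda>y. ennreal (second_highest {..<k} y)) \<in> borel_measurable (PiM {..<k} (\<lambda>_. D j))"
      by (intro measurable_compose[OF measurable_second_highest measurable_ennreal]) auto
    have "mean_second_highest k (D j)
        = (\<integral>\<^sup>+y. ennreal (second_highest {..<k} y) \<partial>PiM {..<k} (\<lambda>_. distr (PiM {..<m} D) (D j) (\<lambda>x. x j)))"
      by (simp add: Dj mean_second_highest_def)
    also have "\<dots> = (\<integral>\<^sup>+x. ennreal (second_highest {..<k} (\<lambda>i\<in>{..<k}. x i j)) \<partial>?M)"
      using j by (intro nn_integral_PiM_distr[OF finite_lessThan prob_space_values _ h]) auto
    also have "\<dots> = (\<integral>\<^sup>+x. ennreal (second_highest {..<k} (\<lambda>i. x i j)) \<partial>?M)"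
      by (intro nn_integral_cong arg_cong[where f = ennreal] second_highest_cong) simp
    finally show "(\<integral>\<^sup>+x. ennreal (second_highest {..<k} (\<lambda>i. x i j)) \<partial>?M) = mean_second_highest k (D j)"
      by simp
  qed
  finally show ?thesis
    by (simp add: Rev_VCG[OF additive_law_props(2,1)])
qed

text \<open>The lower bound holds for every fixed profile of set systems in the support, so it
  survives averaging. Fubini moves the systems to the outer integral.\<close>

lemma Rev_VCG_constrained_law_ge:
  assumes k: "0 < k" "k + 2 * (m - 1) \<le> n"
  shows "enn2ereal (\<Sum>j<m. mean_second_highest k (D j)) \<le> Rev (VCG n m) constrained_law n"
proof -
  let ?M = "PiM {..<n} (\<lambda>_. PiM {..<m} D)" and ?S = "PiM {..<n} (\<lambda>_. systems)"
  interpret M: prob_space ?M by (intro prob_space_PiM prob_space_values)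
  interpret S: prob_space ?S by (intro prob_space_PiM prob_space_systems)
  interpret MS: pair_prob_space ?M ?S ..
  let ?r = "\<lambda>x C. ennreal (\<Sum>i<n. vcg_payment n m (\<lambda>i\<in>{..<n}. constrained_valuation m (C i) (x i)) i)"
  have meas: "case_prod ?r \<in> borel_measurable (?M \<Otimes>\<^sub>M ?S)"
    using measurable_compose[OF measurable_profile measurable_vcg_revenue] by (simp add: split_beta')
  have "(\<Sum>j<m. mean_second_highest k (D j)) = (\<integral>\<^sup>+C. (\<Sum>j<m. mean_second_highest k (D j)) \<partial>?S)"
    by (simp add: S.emeasure_space_1)
  also have "\<dots> \<le> (\<integral>\<^sup>+C. \<integral>\<^sup>+x. ?r x C \<partial>?M \<partial>?S)"
  proof (rule nn_integral_mono)
    fix C assume "C \<in> space ?S"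
    then have C: "C i \<in> set_pmf D0" if "i < n" for i
      using that by (auto simp: space_PiM_systems)
    have "constrained_bidders n m C"
      by unfold_locales (use m_pos closed singletons C in auto)
    then show "(\<Sum>j<m. mean_second_highest k (D j)) \<le> (\<integral>\<^sup>+x. ?r x C \<partial>?M)"
      by (rule sum_mean_second_highest_le_vcg[OF _ k])
  qed
  also have "\<dots> = (\<integral>\<^sup>+x. \<integral>\<^sup>+C. ?r x C \<partial>?S \<partial>?M)"
    by (rule MS.Fubini'[OF meas])
  also have "\<dots> = (\<integral>\<^sup>+b. ennreal (\<Sum>i<n. vcg_payment n m b i) \<partial>PiM {..<n} (\<lambda>_. constrained_law))"
    by (rule nn_integral_constrained_profile[OF measurable_vcg_revenue, symmetric])
  finally show ?thesis
    by (simp add: Rev_VCG[OF constrained_law_props(2,1)] less_eq_ennreal.rep_eq)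
qed

text \<open>Additivity is a closed condition: a neighbourhood of positive mass contains an additive
  valuation, so a support point is a limit of additive ones. Hence a report from the support is
  determined by its values on singletons.\<close>

lemma additive_law_support:
  assumes r: "r \<in> support m additive_law"
  shows "r = additive_valuation m (\<lambda>j. r {j})"
proof
  fix S
  show "r S = additive_valuation m (\<lambda>j. r {j}) S"
  proof (cases "S \<subseteq> {..<m}")
    case False
    then show ?thesis
      using r by (auto simp: support_def valuations_def space_PiM PiE_iff extensional_def additive_valuation_def)
  next
    case True
    have "\<bar>r S - (\<Sum>j\<in>S. r {j})\<bar> \<le> e" if e: "0 < e" for e
    proof -
      \<comment> \<open>One error \<open>d\<close> for the bundle \<open>S\<close> and one for each
        of its items add up to \<open>e\<close>.\<close>
      define d where "d = e / (1 + real (card S))"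
      have d: "0 < d" using e by (simp add: d_def)
      let ?U = "{w \<in> space (valuations m). \<forall>T\<in>Pow {..<m}. \<bar>w T - r T\<bar> < d}"
      have "0 < measure additive_law ?U" using r d by (simp add: support_def)
      then have "additive_valuation m -` ?U \<inter> space (PiM {..<m} D) \<noteq> {}"
        unfolding additive_law_def measure_def
        by (metis (no_types, lifting) additive_law_props(3) emeasure_distr emeasure_empty emeasure_notin_sets
            enn2real_0 less_irrefl sets_distr)
      then obtain x where x: "additive_valuation m x \<in> ?U" by auto
      have near: "\<bar>additive_valuation m x T - r T\<bar> < d" if "T \<subseteq> {..<m}" for T
        using x that by auto
      have "\<bar>(\<Sum>j\<in>S. x j) - (\<Sum>j\<in>S. r {j})\<bar> \<le> (\<Sum>j\<in>S. d)"
        unfolding sum_subtractf[symmetric]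
      proof (rule order_trans[OF sum_abs sum_mono])
        fix j assume "j \<in> S"
        then have "j < m" using True by auto
        then show "\<bar>x j - r {j}\<bar> \<le> d"
          using near[of "{j}"] by (simp add: additive_valuation_single)
      qed
      moreover have "\<bar>(\<Sum>j\<in>S. x j) - r S\<bar> < d"
        using near[OF True] True by (simp add: additive_valuation_def)
      ultimately have "\<bar>r S - (\<Sum>j\<in>S. r {j})\<bar> \<le> d + real (card S) * d" by simp
      also have "\<dots> = d * (1 + real (card S))" by (simp add: algebra_simps)
      also have "\<dots> = e" by (simp add: d_def)
      finally show ?thesis .
    qed
    then have "\<bar>r S - (\<Sum>j\<in>S. r {j})\<bar> \<le> 0" by (rule field_le_epsilon) simp
    then show ?thesis using True by (simp add: additive_valuation_def)
  qed
qed

text \<open>\<open>J\<close> has positive probability and \<open>constrained_valuation m J\<close>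
  is continuous in the item values, so item values near those of \<open>r\<close> produce positive
  mass near the image. This makes the incentive constraints of a mechanism for the constrained law
  applicable.\<close>

lemma constrained_law_support:
  assumes r: "r \<in> support m additive_law" and J: "J \<in> set_pmf D0"
  shows "constrained_valuation m J (\<lambda>j. r {j}) \<in> support m constrained_law"
  unfolding support_def
proof (intro CollectI conjI allI impI)
  interpret V: prob_space "PiM {..<m} D" by (rule prob_space_values)
  interpret F: prob_space constrained_law by (rule constrained_law_props(2))
  let ?v = "constrained_valuation m J (\<lambda>j. r {j})"
  show "?v \<in> space (valuations m)"
    by (auto simp: valuations_def space_PiM constrained_valuation_def)
  fix e :: real assume e: "0 < e"
  \<comment> \<open>A feasible set has at most \<open>m\<close> items, so its value moves by at most
    \<open>real m * d\<close>, which is strictly below \<open>e\<close>.\<close>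
  define d where "d = e / (1 + real m)"
  have d: "0 < d" using e by (simp add: d_def)
  let ?U = "{w \<in> space (valuations m). \<forall>T\<in>Pow {..<m}. \<bar>w T - r T\<bar> < d}"
  let ?W = "{w \<in> space (valuations m). \<forall>T\<in>Pow {..<m}. \<bar>w T - ?v T\<bar> < e}"
  have nbhd: "{w \<in> space (valuations m). \<forall>T\<in>Pow {..<m}. \<bar>w T - u T\<bar> < c} \<in> sets (valuations m)"
    for u :: valuation and c
  proof (rule sets.sets_Collect_finite_All)
    fix T assume "T \<in> Pow {..<m}"
    then have [measurable]: "(\<lambda>w. w T) \<in> borel_measurable (valuations m)"
      by (intro measurable_valuation_apply) auto
    show "{w \<in> space (valuations m). \<bar>w T - u T\<bar> < c} \<in> sets (valuations m)" by measurable
  qed simp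
  let ?X = "additive_valuation m -` ?U \<inter> space (PiM {..<m} D)"
  have X: "?X \<in> sets (PiM {..<m} D)"
    by (rule measurable_sets[OF additive_law_props(3) nbhd])
  have posX: "0 < emeasure (PiM {..<m} D) ?X"
  proof -
    have "0 < measure additive_law ?U" using r d by (simp add: support_def)
    then show ?thesis
      unfolding additive_law_def measure_def emeasure_distr[OF additive_law_props(3) nbhd]
      by (simp add: enn2real_positive_iff)
  qed
  have near: "constrained_valuation m J x \<in> ?W" if x: "x \<in> ?X" for x
  proof -
    have xj: "\<bar>x j - r {j}\<bar> \<le> d" if "j < m" for j
    proof -
      have "\<bar>additive_valuation m x {j} - r {j}\<bar> < d" using x that by auto
      then show ?thesis using that by (simp add: additive_valuation_single)
    qed
    have "\<bar>constrained_valuation m J x T - ?v T\<bar> < e" if T: "T \<subseteq> {..<m}" for T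
    proof -
      have "\<bar>(\<Sum>j\<in>R. x j) - (\<Sum>j\<in>R. r {j})\<bar> \<le> real m * d" if "R \<subseteq> T" for R
      proof -
        have R: "R \<subseteq> {..<m}" "card R \<le> m" using that T card_mono[of "{..<m}" R] by auto
        have "\<bar>(\<Sum>j\<in>R. x j) - (\<Sum>j\<in>R. r {j})\<bar> \<le> (\<Sum>j\<in>R. d)"
          unfolding sum_subtractf[symmetric] using R xj by (intro order_trans[OF sum_abs sum_mono]) auto
        also have "\<dots> \<le> real m * d" using R d by simp
        finally show ?thesis .
      qed
      then have "\<bar>constrained_valuation m J x T - ?v T\<bar> \<le> real m * d"
        using T empty_in_system[OF J] unfolding constrained_valuation_def
        by (simp, intro abs_Max_diff_le) (auto intro!: finite_subset[of _ "Pow {..<m}"])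
      also have "real m * d < e" using e by (simp add: d_def field_simps)
      finally show ?thesis .
    qed
    then show ?thesis
      by (auto simp: valuations_def space_PiM constrained_valuation_def)
  qed
  have "0 < emeasure (PiM {..<m} D) ?X * pmf D0 J"
    using posX J by (simp add: ennreal_zero_less_mult_iff pmf_positive)
  also have "\<dots> = (\<integral>\<^sup>+x. indicator ?X x \<partial>PiM {..<m} D) * pmf D0 J"
    using X by simp
  also have "\<dots> \<le> (\<integral>\<^sup>+x. indicator ?W (constrained_valuation m J x) \<partial>PiM {..<m} D) * pmf D0 J"
    using near by (intro mult_right_mono nn_integral_mono) (auto simp: indicator_def)
  also have "\<dots> \<le> (\<Sum>J\<in>set_pmf D0.
      (\<integral>\<^sup>+x. indicator ?W (constrained_valuation m J x) \<partial>PiM {..<m} D) * pmf D0 J)"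
    using J finite_systems by (intro member_le_sum) auto
  also have "\<dots> = (\<integral>\<^sup>+v. indicator ?W v \<partial>constrained_law)"
    by (rule constrained_law_props(3)[symmetric, OF borel_measurable_indicator[OF nbhd]])
  also have "\<dots> = emeasure constrained_law ?W"
    using nbhd constrained_law_props(1) by simp
  finally show "0 < measure constrained_law ?W"
    by (simp add: F.emeasure_eq_measure)
qed

end

section \<open>The mechanism for additive bidders obtained from one for constrained bidders\<close>

definition reduced_mechanism :: "nat \<Rightarrow> nat \<Rightarrow> nat set set measure \<Rightarrow> mechanism \<Rightarrow> mechanism" where
  "reduced_mechanism n m Q M b = PiM {..<n} (\<lambda>_. Q) \<bind>
     (\<lambda>C. M (constrain n m C b) \<bind> (\<lambda>a. return (outcomes n m) (trim n C b a)))"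

lemma measurable_outcome_of_bidder:
  assumes "i < n"
  shows "(\<lambda>a. (fst a i, snd a i)) \<in> outcomes n m \<rightarrow>\<^sub>M count_space (Pow {..<m}) \<Otimes>\<^sub>M borel"
  unfolding outcomes_def
proof (rule measurable_Pair)
  have "(\<lambda>A. A i) \<in> count_space (allocations n m) \<rightarrow>\<^sub>M count_space (Pow {..<m})"
    using assms by (auto simp: allocations_def)
  then show "(\<lambda>a. fst a i) \<in> count_space (allocations n m) \<Otimes>\<^sub>M PiM {..<n} (\<lambda>_. borel)
      \<rightarrow>\<^sub>M count_space (Pow {..<m})"
    by (rule measurable_compose[OF measurable_fst])
  show "(\<lambda>a. snd a i) \<in> borel_measurable (count_space (allocations n m) \<Otimes>\<^sub>M PiM {..<n} (\<lambda>_. borel))"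
    using assms by (intro measurable_compose[OF measurable_snd measurable_component_singleton]) auto
qed

lemma measurable_bid_update:
  assumes "i < n" "r \<in> space (valuations m)"
  shows "(\<lambda>b. b(i := r)) \<in> PiM {..<n} (\<lambda>_. valuations m) \<rightarrow>\<^sub>M PiM {..<n} (\<lambda>_. valuations m)"
  using assms by (intro measurable_fun_upd[where J = "{..<n}"]) auto

context auction
begin

context
  fixes n :: nat and M :: mechanism
  assumes M: "is_mechanism n m M"
begin

private abbreviation "V \<equiv> PiM {..<n} (\<lambda>_. valuations m)"
private abbreviation "M' \<equiv> reduced_mechanism n m systems M"

lemma kernel: "M \<in> V \<rightarrow>\<^sub>M prob_algebra (outcomes n m)"
  using M by (simp add: is_mechanism_def)

lemma trimmed_kernel:
  "(\<lambda>b. M (constrain n m C b) \<bind> (\<lambda>a. return (outcomes n m) (trim n C b a)))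
    \<in> V \<rightarrow>\<^sub>M prob_algebra (outcomes n m)"
proof (rule measurable_bind_prob_space2)
  show "(\<lambda>b. M (constrain n m C b)) \<in> V \<rightarrow>\<^sub>M prob_algebra (outcomes n m)"
    by (rule measurable_compose[OF measurable_constrain kernel])
  have "(\<lambda>p. return (outcomes n m) (case p of (b, a) \<Rightarrow> trim n C b a))
      \<in> V \<Otimes>\<^sub>M outcomes n m \<rightarrow>\<^sub>M prob_algebra (outcomes n m)"
    by (rule measurable_compose[OF measurable_trim measurable_return_prob_space])
  then show "(\<lambda>(b, a). return (outcomes n m) (trim n C b a))
      \<in> V \<Otimes>\<^sub>M outcomes n m \<rightarrow>\<^sub>M prob_algebra (outcomes n m)"
    by (simp add: split_beta')
qed

lemma profile_kernel:
  "(\<lambda>C. M (constrain n m C b) \<bind> (\<lambda>a. return (outcomes n m) (trim n C b a)))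
    \<in> PiM {..<n} (\<lambda>_. systems) \<rightarrow>\<^sub>M prob_algebra (outcomes n m)"
  if "b \<in> space V"
  unfolding measurable_cong_sets[OF sets_PiM_systems refl]
  using measurable_space[OF trimmed_kernel that] by simp

lemma is_mechanism_reduced: "is_mechanism n m M'"
  unfolding is_mechanism_def reduced_mechanism_def
proof (rule measurable_bind_prob_space2)
  show "(\<lambda>b. PiM {..<n} (\<lambda>_. systems)) \<in> V \<rightarrow>\<^sub>M prob_algebra (PiM {..<n} (\<lambda>_. systems))"
    by (rule measurable_const)
       (auto simp: space_prob_algebra intro!: prob_space_PiM prob_space_systems)
  have sets: "sets (V \<Otimes>\<^sub>M PiM {..<n} (\<lambda>_. systems)) = sets (V \<Otimes>\<^sub>M count_space ({..<n} \<rightarrow>\<^sub>E set_pmf D0))"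
    by (intro sets_pair_measure_cong refl sets_PiM_systems)
  show "(\<lambda>(b, C). M (constrain n m C b) \<bind> (\<lambda>a. return (outcomes n m) (trim n C b a)))
      \<in> V \<Otimes>\<^sub>M PiM {..<n} (\<lambda>_. systems) \<rightarrow>\<^sub>M prob_algebra (outcomes n m)"
    unfolding measurable_cong_sets[OF sets refl] split_beta'
    by (rule measurable_compose_countable'[where I = "{..<n} \<rightarrow>\<^sub>E set_pmf D0" and g = snd and
          f = "\<lambda>C p. M (constrain n m C (fst p)) \<bind> (\<lambda>a. return (outcomes n m) (trim n C (fst p) a))"])
       (auto intro: measurable_compose[OF measurable_fst trimmed_kernel] countable_finite finite_system_profiles)
qed

lemma nn_integral_reduced:
  assumes b: "b \<in> space V" and h: "h \<in> borel_measurable (outcomes n m)"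
  shows "(\<integral>\<^sup>+a. h a \<partial>M' b)
    = (\<integral>\<^sup>+C. \<integral>\<^sup>+a. h (trim n C b a) \<partial>M (constrain n m C b) \<partial>PiM {..<n} (\<lambda>_. systems))"
proof -
  have "(\<integral>\<^sup>+a. h a \<partial>M' b)
      = (\<integral>\<^sup>+C. \<integral>\<^sup>+a. h a \<partial>(M (constrain n m C b) \<bind> (\<lambda>a. return (outcomes n m) (trim n C b a)))
          \<partial>PiM {..<n} (\<lambda>_. systems))"
    unfolding reduced_mechanism_def
    by (rule nn_integral_bind[OF h measurable_prob_algebraD[OF profile_kernel[OF b]]])
  also have "\<dots> = (\<integral>\<^sup>+C. \<integral>\<^sup>+a. h (trim n C b a) \<partial>M (constrain n m C b) \<partial>PiM {..<n} (\<lambda>_. systems))"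
  proof (rule nn_integral_cong)
    fix C
    have "M (constrain n m C b) \<in> space (prob_algebra (outcomes n m))"
      using measurable_space[OF kernel] measurable_space[OF measurable_constrain b] by blast
    then have sets: "sets (M (constrain n m C b)) = sets (outcomes n m)"
      by (simp add: space_prob_algebra)
    have trim: "trim n C b \<in> outcomes n m \<rightarrow>\<^sub>M outcomes n m"
      using measurable_compose[OF measurable_Pair1'[OF b] measurable_trim] by simp
    have "(\<integral>\<^sup>+a. h a \<partial>(M (constrain n m C b) \<bind> (\<lambda>a. return (outcomes n m) (trim n C b a))))
        = (\<integral>\<^sup>+a. \<integral>\<^sup>+a'. h a' \<partial>return (outcomes n m) (trim n C b a) \<partial>M (constrain n m C b))"
    proof (rule nn_integral_bind[OF h])
      show "(\<lambda>a. return (outcomes n m) (trim n C b a)) \<in> M (constrain n m C b) \<rightarrow>\<^sub>M subprob_algebra (outcomes n m)"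
        unfolding measurable_cong_sets[OF sets refl]
        by (intro measurable_prob_algebraD measurable_compose[OF trim measurable_return_prob_space])
    qed
    also have "\<dots> = (\<integral>\<^sup>+a. h (trim n C b a) \<partial>M (constrain n m C b))"
      using measurable_space[OF trim] sets_eq_imp_space_eq[OF sets]
      by (intro nn_integral_cong nn_integral_return h) auto
    finally show "(\<integral>\<^sup>+a. h a \<partial>(M (constrain n m C b) \<bind> (\<lambda>a. return (outcomes n m) (trim n C b a))))
        = (\<integral>\<^sup>+a. h (trim n C b a) \<partial>M (constrain n m C b))" .
  qed
  finally show ?thesis .
qed

lemma nn_integral_kernel_measurable:
  assumes "K \<in> V \<rightarrow>\<^sub>M prob_algebra (outcomes n m)" "h \<in> borel_measurable (outcomes n m)"
  shows "(\<lambda>b. \<integral>\<^sup>+a. h a \<partial>K b) \<in> borel_measurable V"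
  by (rule measurable_compose[OF measurable_prob_algebraD[OF assms(1)]
        nn_integral_measurable_subprob_algebra[OF assms(2)]])

lemma payment_measurable:
  assumes "k \<in> borel_measurable (PiM {..<n} (\<lambda>_. borel))"
  shows "(\<lambda>a. k (snd a)) \<in> borel_measurable (outcomes n m)"
  unfolding outcomes_def by (rule measurable_compose[OF measurable_snd assms])

lemma nn_integral_truthful_outcome:
  assumes K: "K \<in> V \<rightarrow>\<^sub>M prob_algebra (outcomes n m)" and h: "h \<in> borel_measurable (outcomes n m)"
    and F: "sets F = sets (valuations m)"
  shows "(\<integral>\<^sup>+a. h a \<partial>truthful_outcome n F K) = (\<integral>\<^sup>+b. \<integral>\<^sup>+a. h a \<partial>K b \<partial>PiM {..<n} (\<lambda>_. F))"
  unfolding truthful_outcome_def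
proof (rule nn_integral_bind[OF h])
  have "sets (PiM {..<n} (\<lambda>_. F)) = sets V" by (intro sets_PiM_cong refl F)
  from measurable_prob_algebraD[OF K] show "K \<in> PiM {..<n} (\<lambda>_. F) \<rightarrow>\<^sub>M subprob_algebra (outcomes n m)"
    unfolding measurable_cong_sets[OF \<open>sets (PiM {..<n} (\<lambda>_. F)) = sets V\<close> refl] .
qed

lemma additive_profile_in_space: "(\<lambda>i\<in>{..<n}. additive_valuation m (x i)) \<in> space V"
  by (auto simp: space_PiM valuations_def additive_valuation_def)

text \<open>Trimming leaves payments alone, and constraining a truthful additive profile by drawn
  systems yields a truthful constrained profile. The test function \<open>k\<close> is general
  because total revenue and single payments are both needed.\<close>

lemma truthful_payments:
  assumes k: "k \<in> borel_measurable (PiM {..<n} (\<lambda>_. borel))"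
  shows "(\<integral>\<^sup>+a. k (snd a) \<partial>truthful_outcome n additive_law M')
    = (\<integral>\<^sup>+a. k (snd a) \<partial>truthful_outcome n constrained_law M)"
proof -
  note h = payment_measurable[OF k]
  have M'_kernel: "M' \<in> V \<rightarrow>\<^sub>M prob_algebra (outcomes n m)"
    using is_mechanism_reduced by (simp add: is_mechanism_def)
  have "(\<integral>\<^sup>+a. k (snd a) \<partial>truthful_outcome n additive_law M')
      = (\<integral>\<^sup>+x. \<integral>\<^sup>+a. k (snd a) \<partial>M' (\<lambda>i\<in>{..<n}. additive_valuation m (x i)) \<partial>PiM {..<n} (\<lambda>_. PiM {..<m} D))"
    unfolding nn_integral_truthful_outcome[OF M'_kernel h additive_law_props(1)]
    by (rule nn_integral_additive_profile[OF nn_integral_kernel_measurable[OF M'_kernel h]])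
  also have "\<dots> = (\<integral>\<^sup>+x. \<integral>\<^sup>+C. \<integral>\<^sup>+a. k (snd a)
      \<partial>M (\<lambda>i\<in>{..<n}. constrained_valuation m (C i) (x i))
      \<partial>PiM {..<n} (\<lambda>_. systems) \<partial>PiM {..<n} (\<lambda>_. PiM {..<m} D))"
  proof (rule nn_integral_cong)
    fix x
    from nn_integral_reduced[OF additive_profile_in_space h]
    show "(\<integral>\<^sup>+a. k (snd a) \<partial>M' (\<lambda>i\<in>{..<n}. additive_valuation m (x i)))
        = (\<integral>\<^sup>+C. \<integral>\<^sup>+a. k (snd a) \<partial>M (\<lambda>i\<in>{..<n}. constrained_valuation m (C i) (x i))
            \<partial>PiM {..<n} (\<lambda>_. systems))"
      by (simp only: constrain_additive trim_def snd_conv)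
  qed
  also have "\<dots> = (\<integral>\<^sup>+a. k (snd a) \<partial>truthful_outcome n constrained_law M)"
    unfolding nn_integral_truthful_outcome[OF kernel h constrained_law_props(1)]
    by (rule nn_integral_constrained_profile[OF nn_integral_kernel_measurable[OF kernel h], symmetric])
  finally show ?thesis .
qed

lemma nn_integral_interim_outcome:
  assumes K: "K \<in> V \<rightarrow>\<^sub>M prob_algebra (outcomes n m)" and h: "h \<in> borel_measurable (outcomes n m)"
    and F: "sets F = sets (valuations m)" and i: "i < n" "r \<in> space (valuations m)"
  shows "(\<integral>\<^sup>+a. h a \<partial>interim_outcome n F K i r)
    = (\<integral>\<^sup>+b. \<integral>\<^sup>+a. h a \<partial>K (b(i := r)) \<partial>PiM {..<n} (\<lambda>_. F))"
proof -
  have sets: "sets (PiM {..<n} (\<lambda>_. F)) = sets V" by (intro sets_PiM_cong refl F)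
  have "(\<lambda>b. K (b(i := r))) \<in> PiM {..<n} (\<lambda>_. F) \<rightarrow>\<^sub>M subprob_algebra (outcomes n m)"
    unfolding measurable_cong_sets[OF sets refl]
    by (intro measurable_prob_algebraD measurable_compose[OF measurable_bid_update[OF i] K])
  then show ?thesis
    unfolding interim_outcome_def by (rule nn_integral_bind[OF h])
qed

text \<open>The system drawn for \<open>i\<close> is independent of the bids of the others. So
  reporting \<open>r\<close> amounts to a random report in the original mechanism: with probability
  \<open>pmf D0 J\<close> it is the type with item values \<open>z\<close> and system
  \<open>J\<close>, and the bundle received is then trimmed.\<close>

lemma nn_integral_interim_reduced:
  assumes i: "i < n" and r: "r \<in> space (valuations m)" "r = additive_valuation m z"
    and k: "k \<in> borel_measurable (count_space (Pow {..<m}) \<Otimes>\<^sub>M borel)"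
  shows "(\<integral>\<^sup>+a. k (fst a i, snd a i) \<partial>interim_outcome n additive_law M' i r)
    = (\<Sum>J\<in>set_pmf D0. (\<integral>\<^sup>+a. k (best_part J r (fst a i), snd a i)
        \<partial>interim_outcome n constrained_law M i (constrained_valuation m J z)) * pmf D0 J)"
proof -
  let ?X = "PiM {..<n} (\<lambda>_. PiM {..<m} D)" and ?S = "PiM {..<n} (\<lambda>_. systems)"
  interpret S: prob_space ?S by (intro prob_space_PiM prob_space_systems)
  have M'_kernel: "M' \<in> V \<rightarrow>\<^sub>M prob_algebra (outcomes n m)"
    using is_mechanism_reduced by (simp add: is_mechanism_def)
  define cv where "cv J = constrained_valuation m J z" for J
  have cv: "cv J \<in> space (valuations m)" for J
    by (auto simp: cv_def valuations_def space_PiM constrained_valuation_def)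
  have h: "(\<lambda>a. k (fst a i, snd a i)) \<in> borel_measurable (outcomes n m)"
    by (rule measurable_compose[OF measurable_outcome_of_bidder[OF i] k])
  have hJ: "(\<lambda>a. k (best_part J r (fst a i), snd a i)) \<in> borel_measurable (outcomes n m)" for J
  proof -
    have "best_part J r \<in> count_space (Pow {..<m}) \<rightarrow>\<^sub>M count_space (Pow {..<m})"
      unfolding measurable_count_space_eq1
    proof (rule Pi_I)
      fix S assume "S \<in> Pow {..<m}"
      then show "best_part J r S \<in> space (count_space (Pow {..<m}))"
        using best_part_subset[of S m J r] by auto
    qed
    from measurable_compose[OF measurable_fst this]
    have "(\<lambda>p. (best_part J r (fst p), snd p))
        \<in> count_space (Pow {..<m}) \<Otimes>\<^sub>M borel \<rightarrow>\<^sub>M count_space (Pow {..<m}) \<Otimes>\<^sub>M (borel :: real measure)"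
      by (intro measurable_Pair measurable_snd)
    from measurable_compose[OF measurable_compose[OF measurable_outcome_of_bidder[OF i] this] k]
    show ?thesis by simp
  qed
  \<comment> \<open>Bid \<open>i\<close> of \<open>b\<close> is overwritten, so this depends only on
    the bids of the others.\<close>
  define \<Psi> where "\<Psi> J b = (\<integral>\<^sup>+a. k (best_part J r (fst a i), snd a i) \<partial>M (b(i := cv J)))" for J b
  have \<Psi>: "\<Psi> J \<in> borel_measurable V" for J
    unfolding \<Psi>_def
    by (intro nn_integral_kernel_measurable[OF _ hJ] measurable_compose[OF measurable_bid_update[OF i cv] kernel])
  let ?b = "\<lambda>C x. \<lambda>i\<in>{..<n}. constrained_valuation m (C i) (x i)"
  have "(\<integral>\<^sup>+a. k (fst a i, snd a i) \<partial>interim_outcome n additive_law M' i r)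
      = (\<integral>\<^sup>+b. \<integral>\<^sup>+a. k (fst a i, snd a i) \<partial>M' (b(i := r)) \<partial>PiM {..<n} (\<lambda>_. additive_law))"
    by (rule nn_integral_interim_outcome[OF M'_kernel h additive_law_props(1) i r(1)])
  also have "\<dots> = (\<integral>\<^sup>+x. \<integral>\<^sup>+a. k (fst a i, snd a i)
      \<partial>M' ((\<lambda>i\<in>{..<n}. additive_valuation m (x i))(i := r)) \<partial>?X)"
  proof (rule nn_integral_additive_profile)
    have "(\<lambda>b. M' (b(i := r))) \<in> V \<rightarrow>\<^sub>M prob_algebra (outcomes n m)"
      by (rule measurable_compose[OF measurable_bid_update[OF i r(1)] M'_kernel])
    from nn_integral_kernel_measurable[OF this h]
    show "(\<lambda>b. \<integral>\<^sup>+a. k (fst a i, snd a i) \<partial>M' (b(i := r))) \<in> borel_measurable V" .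
  qed
  also have "\<dots> = (\<integral>\<^sup>+x. \<integral>\<^sup>+C. \<Psi> (C i) (?b C x) \<partial>?S \<partial>?X)"
  proof (rule nn_integral_cong)
    fix x
    let ?a = "(\<lambda>i\<in>{..<n}. additive_valuation m (x i))(i := r)"
    have a: "?a \<in> space V"
      using measurable_space[OF measurable_bid_update[OF i r(1)] additive_profile_in_space] .
    have "constrain n m C ?a = (?b C x)(i := cv (C i))" for C
    proof
      fix l
      show "constrain n m C ?a l = ((?b C x)(i := cv (C i))) l"
        using i unfolding constrain_def cv_def r(2)
        by (auto simp: additive_valuation_single restrict_def intro!: constrained_valuation_cong)
    qed
    then show "(\<integral>\<^sup>+a. k (fst a i, snd a i) \<partial>M' ?a) = (\<integral>\<^sup>+C. \<Psi> (C i) (?b C x) \<partial>?S)"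
      unfolding nn_integral_reduced[OF a h] using i by (simp add: \<Psi>_def trim_def)
  qed
  also have "\<dots> = (\<integral>\<^sup>+x. (\<Sum>J\<in>set_pmf D0. (\<integral>\<^sup>+C. \<Psi> J (?b C x) \<partial>?S) * ennreal (pmf D0 J)) \<partial>?X)"
  proof (rule nn_integral_cong)
    fix x
    \<comment> \<open>Redrawing coordinate \<open>i\<close> separates the system of the reporting
      bidder from the profile; in the profile its value is invisible, since bid \<open>i\<close> is
      overwritten.\<close>
    have "(\<integral>\<^sup>+C. \<Psi> (C i) (?b C x) \<partial>?S)
        = (\<integral>\<^sup>+C. \<integral>\<^sup>+J. \<Psi> ((C(i := J)) i) (?b (C(i := J)) x) \<partial>systems \<partial>?S)"
      using i prob_space_systems by (intro nn_integral_PiM_resample borel_measurable_PiM_systems) auto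
    also have "\<dots> = (\<integral>\<^sup>+C. \<integral>\<^sup>+J. \<Psi> J (?b C x) \<partial>systems \<partial>?S)"
    proof -
      have "(?b (C(i := J)) x)(i := cv J) = (?b C x)(i := cv J)" for C J
        by (auto simp: fun_eq_iff)
      then show ?thesis by (simp add: \<Psi>_def)
    qed
    also have "\<dots> = (\<integral>\<^sup>+C. (\<Sum>J\<in>set_pmf D0. \<Psi> J (?b C x) * ennreal (pmf D0 J)) \<partial>?S)"
      by (simp only: nn_integral_systems)
    also have "\<dots> = (\<Sum>J\<in>set_pmf D0. (\<integral>\<^sup>+C. \<Psi> J (?b C x) \<partial>?S) * ennreal (pmf D0 J))"
      by (intro nn_integral_weighted_sum borel_measurable_PiM_systems)
    finally show "(\<integral>\<^sup>+C. \<Psi> (C i) (?b C x) \<partial>?S)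
        = (\<Sum>J\<in>set_pmf D0. (\<integral>\<^sup>+C. \<Psi> J (?b C x) \<partial>?S) * ennreal (pmf D0 J))" .
  qed
  also have "\<dots> = (\<Sum>J\<in>set_pmf D0. (\<integral>\<^sup>+x. \<integral>\<^sup>+C. \<Psi> J (?b C x) \<partial>?S \<partial>?X) * ennreal (pmf D0 J))"
    using measurable_compose[OF measurable_profile \<Psi>]
    by (intro nn_integral_weighted_sum S.borel_measurable_nn_integral) (simp add: split_beta')
  also have "\<dots> = (\<Sum>J\<in>set_pmf D0. (\<integral>\<^sup>+b. \<Psi> J b \<partial>PiM {..<n} (\<lambda>_. constrained_law)) * ennreal (pmf D0 J))"
    by (simp only: nn_integral_constrained_profile[OF \<Psi>])
  also have "\<dots> = (\<Sum>J\<in>set_pmf D0. (\<integral>\<^sup>+a. k (best_part J r (fst a i), snd a i)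
        \<partial>interim_outcome n constrained_law M i (constrained_valuation m J z)) * pmf D0 J)"
    unfolding \<Psi>_def
    by (simp only: nn_integral_interim_outcome[OF kernel hJ constrained_law_props(1) i cv] cv_def[symmetric])
  finally show ?thesis .
qed

end

section \<open>Interim utilities and incentives in the reduced mechanism\<close>

lemma interim_outcome_props:
  assumes K: "is_mechanism n m K" and F: "sets F = sets (valuations m)" "prob_space F"
    and i: "i < n" "r \<in> space (valuations m)"
  shows "prob_space (interim_outcome n F K i r)" "sets (interim_outcome n F K i r) = sets (outcomes n m)"
proof -
  have "sets (PiM {..<n} (\<lambda>_. F)) = sets (PiM {..<n} (\<lambda>_. valuations m))"
    by (intro sets_PiM_cong refl F)
  then have P: "PiM {..<n} (\<lambda>_. F) \<in> space (prob_algebra (PiM {..<n} (\<lambda>_. valuations m)))"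
    by (simp add: space_prob_algebra prob_space_PiM F)
  have "(\<lambda>b. K (b(i := r))) \<in> PiM {..<n} (\<lambda>_. valuations m) \<rightarrow>\<^sub>M prob_algebra (outcomes n m)"
    using K by (intro measurable_compose[OF measurable_bid_update[OF i]]) (simp add: is_mechanism_def)
  from prob_space_bind'[OF P this] sets_bind'[OF P this]
  show "prob_space (interim_outcome n F K i r)" "sets (interim_outcome n F K i r) = sets (outcomes n m)"
    by (simp_all add: interim_outcome_def)
qed

lemma measurable_bundle_minus_payment:
  fixes g :: "nat set \<Rightarrow> real"
  assumes "i < n"
  shows "(\<lambda>a. g (fst a i) - snd a i) \<in> borel_measurable (outcomes n m)"
proof -
  have "(\<lambda>p. g (fst p)) \<in> borel_measurable (count_space (Pow {..<m}) \<Otimes>\<^sub>M (borel :: real measure))"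
    by (rule measurable_compose[OF measurable_fst]) simp
  then have "(\<lambda>p. g (fst p) - snd p) \<in> borel_measurable (count_space (Pow {..<m}) \<Otimes>\<^sub>M (borel :: real measure))"
    by (intro borel_measurable_diff measurable_snd)
  from measurable_compose[OF measurable_outcome_of_bidder[OF assms] this] show ?thesis by simp
qed

lemma bundle_in_items:
  assumes "sets N = sets (outcomes n m)" "a \<in> space N" "i < n"
  shows "fst a i \<subseteq> {..<m}"
proof -
  have "fst a \<in> allocations n m"
    using assms(2) sets_eq_imp_space_eq[OF assms(1)] by (auto simp: outcomes_def space_pair_measure)
  then show ?thesis using assms(3) by (auto simp: allocations_def)
qed

text \<open>There are finitely many bundles, so the value of the bundle is bounded and integrability
  rests on the payment alone.\<close>

lemma integrable_bundle_minus_payment: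
  fixes g :: "nat set \<Rightarrow> real"
  assumes N: "prob_space N" "sets N = sets (outcomes n m)" and i: "i < n"
    and p: "integrable N (\<lambda>a. snd a i)"
  shows "integrable N (\<lambda>a. g (fst a i) - snd a i)"
proof -
  interpret prob_space N by fact
  have "integrable N (\<lambda>a. g (fst a i))"
  proof (rule integrable_const_bound[where B = "\<Sum>S\<in>Pow {..<m}. \<bar>g S\<bar>"])
    show "AE a in N. norm (g (fst a i)) \<le> (\<Sum>S\<in>Pow {..<m}. \<bar>g S\<bar>)"
    proof (rule AE_I2)
      fix a assume "a \<in> space N"
      then have "fst a i \<in> Pow {..<m}" using bundle_in_items[OF N(2) _ i] by auto
      then show "norm (g (fst a i)) \<le> (\<Sum>S\<in>Pow {..<m}. \<bar>g S\<bar>)"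
        unfolding real_norm_def by (intro member_le_sum[where f = "\<lambda>S. \<bar>g S\<bar>"]) auto
    qed
    have "(\<lambda>a. (g (fst a i) - snd a i) + snd a i) \<in> borel_measurable N"
      using measurable_bundle_minus_payment[OF i, of g] borel_measurable_integrable[OF p]
      by (intro borel_measurable_add) (simp_all add: measurable_cong_sets[OF N(2) refl])
    then show "(\<lambda>a. g (fst a i)) \<in> borel_measurable N" by simp
  qed
  then show ?thesis using p by (rule Bochner_Integration.integrable_diff)
qed

context
  fixes n :: nat and M :: mechanism
  assumes M: "is_mechanism n m M" and ex: "expectations_exist n m constrained_law M"
begin

lemma support_in_space: "r \<in> support m F \<Longrightarrow> r \<in> space (valuations m)"
  by (simp add: support_def)

lemma interim_payment_integrable:
  assumes "i < n" "r \<in> support m constrained_law"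
  shows "integrable (interim_outcome n constrained_law M i r) (\<lambda>a. snd a i)"
  using ex assms by (simp add: expectations_exist_def split_beta')

text \<open>The function \<open>g\<close> is left general: the constant 0 gives integrability of the
  payments, and a valuation gives the interim utility.\<close>

lemma interim_mixture:
  fixes g :: "nat set \<Rightarrow> real"
  assumes i: "i < n" and r: "r \<in> support m additive_law"
  defines "N J \<equiv> interim_outcome n constrained_law M i (constrained_valuation m J (\<lambda>j. r {j}))"
  shows "integrable (interim_outcome n additive_law (reduced_mechanism n m systems M) i r)
      (\<lambda>a. g (fst a i) - snd a i)"
    and "(\<integral>a. g (fst a i) - snd a i \<partial>interim_outcome n additive_law (reduced_mechanism n m systems M) i r)
      = (\<Sum>J\<in>set_pmf D0. (\<integral>a. g (best_part J r (fst a i)) - snd a i \<partial>N J) * pmf D0 J)"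
proof -
  let ?N' = "interim_outcome n additive_law (reduced_mechanism n m systems M) i r"
  note rspace = support_in_space[OF r]
  have M': "is_mechanism n m (reduced_mechanism n m systems M)"
    by (rule is_mechanism_reduced[OF M])
  have sets: "sets ?N' = sets (outcomes n m)"
    by (rule interim_outcome_props(2)[OF M' additive_law_props(1,2) i rspace])
  have meas: "(\<lambda>a. g (fst a i) - snd a i) \<in> borel_measurable ?N'"
    unfolding measurable_cong_sets[OF sets refl] by (rule measurable_bundle_minus_payment[OF i])
  have int: "integrable (N J) (\<lambda>a. g (best_part J r (fst a i)) - snd a i)" if J: "J \<in> set_pmf D0" for J
  proof -
    note supp = constrained_law_support[OF r J]
    show ?thesis
      unfolding N_def
      by (rule integrable_bundle_minus_payment[OF interim_outcome_props[OF M constrained_law_props(1,2) i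
              support_in_space[OF supp]] i interim_payment_integrable[OF i supp]])
  qed
  have eq: "(\<integral>\<^sup>+a. k (g (fst a i) - snd a i) \<partial>?N')
      = (\<Sum>J\<in>set_pmf D0. (\<integral>\<^sup>+a. k (g (best_part J r (fst a i)) - snd a i) \<partial>N J) * ennreal (pmf D0 J))"
    if k: "k \<in> borel_measurable borel" for k :: "real \<Rightarrow> ennreal"
  proof -
    have "(\<lambda>p. g (fst p)) \<in> borel_measurable (count_space (Pow {..<m}) \<Otimes>\<^sub>M (borel :: real measure))"
      by (rule measurable_compose[OF measurable_fst]) simp
    then have "(\<lambda>p. g (fst p) - snd p) \<in> borel_measurable (count_space (Pow {..<m}) \<Otimes>\<^sub>M (borel :: real measure))"
      by (intro borel_measurable_diff measurable_snd)
    from nn_integral_interim_reduced[OF M i rspace additive_law_support[OF r] measurable_compose[OF this k]]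
    show ?thesis by (simp add: N_def)
  qed
  show "integrable ?N' (\<lambda>a. g (fst a i) - snd a i)"
    by (rule integral_mixture(1)[OF meas pmf_nonneg int eq])
  show "(\<integral>a. g (fst a i) - snd a i \<partial>?N')
      = (\<Sum>J\<in>set_pmf D0. (\<integral>a. g (best_part J r (fst a i)) - snd a i \<partial>N J) * pmf D0 J)"
    by (rule integral_mixture(2)[OF meas pmf_nonneg int eq])
qed

text \<open>The trimmed bundle is a set of \<open>J\<close> inside the original bundle, so its value
  under the true \<open>v\<close> is at most the constrained valuation of that bundle. It is chosen
  to be best for the report, hence equality when the report is true.\<close>

lemma interim_utility_reduced:
  assumes i: "i < n" and v: "v \<in> support m additive_law" and r: "r \<in> support m additive_law"
  shows "interim_utility n additive_law (reduced_mechanism n m systems M) i v r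
    \<le> (\<Sum>J\<in>set_pmf D0. interim_utility n constrained_law M i
        (constrained_valuation m J (\<lambda>j. v {j})) (constrained_valuation m J (\<lambda>j. r {j})) * pmf D0 J)"
    and "interim_utility n additive_law (reduced_mechanism n m systems M) i r r
    = (\<Sum>J\<in>set_pmf D0. interim_utility n constrained_law M i
        (constrained_valuation m J (\<lambda>j. r {j})) (constrained_valuation m J (\<lambda>j. r {j})) * pmf D0 J)"
proof -
  let ?cv = "\<lambda>v J. constrained_valuation m J (\<lambda>j. v {j})"
  let ?N = "\<lambda>J. interim_outcome n constrained_law M i (?cv r J)"
  have props: "prob_space (?N J)" "sets (?N J) = sets (outcomes n m)" "integrable (?N J) (\<lambda>a. snd a i)"
    if "J \<in> set_pmf D0" for J
    using constrained_law_support[OF r that]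
    by (auto intro!: interim_outcome_props[OF M constrained_law_props(1,2) i] support_in_space
        interim_payment_integrable[OF i])
  have additive: "v S = (\<Sum>j\<in>S. v {j})" if "v \<in> support m additive_law" "S \<subseteq> {..<m}" for v S
    using fun_cong[OF additive_law_support[OF that(1)], of S] that(2) by (simp add: additive_valuation_def)
  have part: "best_part J r (fst a i) \<subseteq> fst a i" "best_part J r (fst a i) \<in> J" "fst a i \<subseteq> {..<m}"
    if J: "J \<in> set_pmf D0" and a: "a \<in> space (?N J)" for J a
  proof -
    show items: "fst a i \<subseteq> {..<m}" by (rule bundle_in_items[OF props(2)[OF J] a i])
    show "best_part J r (fst a i) \<subseteq> fst a i" "best_part J r (fst a i) \<in> J"
      by (rule best_part[OF items empty_in_system[OF J]])+
  qed
  show "interim_utility n additive_law (reduced_mechanism n m systems M) i v r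
    \<le> (\<Sum>J\<in>set_pmf D0. interim_utility n constrained_law M i (?cv v J) (?cv r J) * pmf D0 J)"
    unfolding interim_utility_def split_beta' interim_mixture(2)[OF i r]
  proof (intro sum_mono mult_right_mono pmf_nonneg integral_mono)
    fix J a assume J: "J \<in> set_pmf D0" and a: "a \<in> space (?N J)"
    note part = part[OF this]
    have "v (best_part J r (fst a i)) = (\<Sum>j\<in>best_part J r (fst a i). v {j})"
      using part by (intro additive[OF v]) auto
    also have "\<dots> \<le> ?cv v J (fst a i)"
      by (rule sum_le_constrained_valuation[OF part(3,1,2)])
    finally show "v (best_part J r (fst a i)) - snd a i \<le> ?cv v J (fst a i) - snd a i" by simp
  qed (auto intro!: integrable_bundle_minus_payment[OF _ _ i] props)
  show "interim_utility n additive_law (reduced_mechanism n m systems M) i r r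
    = (\<Sum>J\<in>set_pmf D0. interim_utility n constrained_law M i (?cv r J) (?cv r J) * pmf D0 J)"
    unfolding interim_utility_def split_beta' interim_mixture(2)[OF i r]
  proof (intro sum.cong refl arg_cong2[where f = times] Bochner_Integration.integral_cong)
    fix J a assume J: "J \<in> set_pmf D0" and a: "a \<in> space (?N J)"
    note part = part[OF this]
    have "r (best_part J r (fst a i)) = (\<Sum>j\<in>best_part J r (fst a i). r {j})"
      using part by (intro additive[OF r]) auto
    also have "\<dots> = ?cv r J (fst a i)"
      by (rule best_part(3)[OF part(3) empty_in_system[OF J]])
    finally show "r (best_part J r (fst a i)) - snd a i = ?cv r J (fst a i) - snd a i" by simp
  qed
qed

text \<open>A misreport yields at most the average over \<open>J\<close> of misreport utilities in
  \<open>M\<close>. BIC of \<open>M\<close> for each \<open>J\<close> bounds this by the average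
  truthful utility, which is exactly the truthful utility in the reduced mechanism.\<close>

lemma reduced_feasible:
  assumes bic: "BIC n m constrained_law M" and bir: "BIR n m constrained_law M"
  shows "expectations_exist n m additive_law (reduced_mechanism n m systems M)"
    and "BIC n m additive_law (reduced_mechanism n m systems M)"
    and "BIR n m additive_law (reduced_mechanism n m systems M)"
proof -
  show "expectations_exist n m additive_law (reduced_mechanism n m systems M)"
    unfolding expectations_exist_def split_beta'
  proof (intro conjI allI impI ballI)
    fix i r assume "i < n" "r \<in> support m additive_law"
    from interim_mixture(1)[OF this, of "\<lambda>_. 0"]
    show "integrable (interim_outcome n additive_law (reduced_mechanism n m systems M) i r) (\<lambda>a. snd a i)"
      by simp
  next
    fix i assume i: "i < n"
    have "(\<lambda>p. ennreal (- p i)) \<in> borel_measurable (PiM {..<n} (\<lambda>_. borel))"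
      using i by (intro measurable_compose[OF borel_measurable_uminus measurable_ennreal]
          measurable_component_singleton) auto
    from truthful_payments[OF M this] ex i
    show "(\<integral>\<^sup>+a. ennreal (- snd a i) \<partial>truthful_outcome n additive_law (reduced_mechanism n m systems M)) < \<infinity>"
      by (simp add: expectations_exist_def split_beta')
  qed
  show "BIC n m additive_law (reduced_mechanism n m systems M)"
    unfolding BIC_def
  proof (intro allI impI ballI)
    fix i v r assume i: "i < n" and v: "v \<in> support m additive_law" and r: "r \<in> support m additive_law"
    have "(\<Sum>J\<in>set_pmf D0. interim_utility n constrained_law M i
        (constrained_valuation m J (\<lambda>j. v {j})) (constrained_valuation m J (\<lambda>j. r {j})) * pmf D0 J)
      \<le> (\<Sum>J\<in>set_pmf D0. interim_utility n constrained_law M i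
        (constrained_valuation m J (\<lambda>j. v {j})) (constrained_valuation m J (\<lambda>j. v {j})) * pmf D0 J)"
      using bic i constrained_law_support[OF v] constrained_law_support[OF r]
      by (intro sum_mono mult_right_mono pmf_nonneg) (auto simp: BIC_def)
    then show "interim_utility n additive_law (reduced_mechanism n m systems M) i v r
        \<le> interim_utility n additive_law (reduced_mechanism n m systems M) i v v"
      using interim_utility_reduced(1)[OF i v r] interim_utility_reduced(2)[OF i v v] by linarith
  qed
  show "BIR n m additive_law (reduced_mechanism n m systems M)"
    unfolding BIR_def
  proof (intro allI impI ballI)
    fix i v assume i: "i < n" and v: "v \<in> support m additive_law"
    show "0 \<le> interim_utility n additive_law (reduced_mechanism n m systems M) i v v"
      unfolding interim_utility_reduced(2)[OF i v v]
      using bir i constrained_law_support[OF v]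
      by (intro sum_nonneg mult_nonneg_nonneg pmf_nonneg) (auto simp: BIR_def)
  qed
qed

lemma Rev_reduced:
  "Rev (reduced_mechanism n m systems M) additive_law n = Rev M constrained_law n"
proof -
  have sum: "(\<lambda>p. \<Sum>i<n. p i) \<in> borel_measurable (PiM {..<n} (\<lambda>_. borel :: real measure))"
    by (intro borel_measurable_sum measurable_component_singleton) auto
  show ?thesis
    unfolding Rev_def split_beta'
      truthful_payments[OF M measurable_compose[OF sum measurable_ennreal]]
      truthful_payments[OF M measurable_compose[OF borel_measurable_uminus[OF sum] measurable_ennreal]] ..
qed

end

lemma OPT_constrained_le_additive: "OPT m constrained_law n \<le> OPT m additive_law n"
  unfolding OPT_def[of m constrained_law]
proof (rule SUP_least, safe)
  fix M assume M: "is_mechanism n m M" and ex: "expectations_exist n m constrained_law M"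
    and ic: "BIC n m constrained_law M" "BIR n m constrained_law M"
  show "Rev M constrained_law n \<le> OPT m additive_law n"
    unfolding Rev_reduced[OF M ex, symmetric] OPT_def
    using is_mechanism_reduced[OF M] reduced_feasible[OF M ex ic] by (intro SUP_upper) auto
qed

end

theorem theorem5p7:
  fixes n m :: nat and X :: enat
  assumes "n \<ge> 1" and "m \<ge> 1"
    and "X = competition_complexity n m (additive_class m)"
  shows "competition_complexity n m (constrained_class m) \<le> X + enat (2 * (m - 1))"
proof (cases "X = \<infinity>")
  case False
  let ?A = "{c. \<forall>F\<in>additive_class m. OPT m F n \<le> Rev (VCG (n + c) m) F (n + c)}"
  have "X = Inf (enat ` ?A)" using assms(3) by (simp add: competition_complexity_def)
  \<comment> \<open>A finite infimum in \<open>enat\<close> is attained, so some number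
    \<open>c\<close> of additional bidders works for all additive laws at once.\<close>
  then have "X \<in> enat ` ?A" using False Inf_enat_in[of "enat ` ?A"] by metis
  then obtain c where c: "X = enat c" "c \<in> ?A" by blast
  have "c + 2 * (m - 1) \<in> {c. \<forall>F\<in>constrained_class m. OPT m F n \<le> Rev (VCG (n + c) m) F (n + c)}"
  proof (intro CollectI ballI)
    fix F assume "F \<in> constrained_class m"
    then obtain D0 D where F: "F = distr (measure_pmf D0 \<Otimes>\<^sub>M PiM {..<m} D) (valuations m)
          (\<lambda>(\<I>, x). constrained_valuation m \<I> x)"
        and D0: "\<forall>\<I>\<in>set_pmf D0. downward_closed m \<I> \<and> (\<forall>j<m. {j} \<in> \<I>)"
        and D: "\<forall>j<m. regular (D j)"
      unfolding constrained_class_def by blast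
    \<comment> \<open>The locale speaks about all indices, so the family is continued beyond
      \<open>m\<close> by \<open>D 0\<close>, which is regular as m is positive. The product over
      the items stays the same.\<close>
    define D' where "D' j = D (if j < m then j else 0)" for j
    have reg: "regular (D' j)" for j using D assms(2) by (simp add: D'_def)
    have PiM_D': "PiM {..<m} D = PiM {..<m} D'" by (intro PiM_cong) (auto simp: D'_def)
    interpret value_distributions m D'
      by (rule value_distributions.intro) (rule regular_properties[OF reg])+
    interpret auction m D' D0
      by unfold_locales (use assms(2) D0 in auto)
    have F_eq: "F = constrained_law" by (simp add: F constrained_law_def PiM_D')
    have "additive_law \<in> additive_class m"
      unfolding additive_class_def additive_law_def using reg by blast
    then have "OPT m additive_law n \<le> Rev (VCG (n + c) m) additive_law (n + c)"
      using c(2) by blast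
    also have "\<dots> \<le> Rev (VCG (n + (c + 2 * (m - 1))) m) constrained_law (n + (c + 2 * (m - 1)))"
      \<comment> \<open>The bound is used with \<open>k = n + c\<close>, which is positive since n
        is at least 1.\<close>
      using assms(1) Rev_VCG_constrained_law_ge[of "n + c"]
      by (subst Rev_VCG_additive_law) auto
    finally show "OPT m F n \<le> Rev (VCG (n + (c + 2 * (m - 1))) m) F (n + (c + 2 * (m - 1)))"
      unfolding F_eq using OPT_constrained_le_additive by (rule order_trans[rotated])
  qed
  then have "competition_complexity n m (constrained_class m) \<le> enat (c + 2 * (m - 1))"
    unfolding competition_complexity_def by (intro Inf_lower imageI)
  then show ?thesis by (simp add: c(1))
qed simp

end
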